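(* Let $p=2$ and let $G$ be a profinite group of Galois relation type (relative to $2$) such that $G(2)\not\cong\mathbb{Z}/2$, where $G(2)$ is the maximal pro-$2$ quotient of $G$. Then $G^{(3)}$ is the intersection of all normal open subgroups $N$ of $G$ such that $G/N$ is isomorphic to one of the groups $1$, $\mathbb{Z}/4$, $D_4$.
   Context: $G^{(1)}=G$ and $G^{(i+1)}=(G^{(i)})^2[G^{(i)},G]$ is the closed subgroup of $G$ generated by all $h^2$ and $[h,g]=h^{-1}g^{-1}hg$, $h\in G^{(i)}$, $g\in G$. $H^i(G)=H^i(G,\mathbb{Z}/2)$ is continuous cohomology with trivial action. The Bockstein map $\beta_G\colon H^1(G)\to H^2(G)$ is the connecting homomorphism of $0\to\mathbb{Z}/2\to\mathbb{Z}/4\to\mathbb{Z}/2\to0$. $G$ has Galois relation type (relative to $2$) if: (i) the kernel of the cup product homomorphism $H^1(G)\otimes_{\mathbb{Z}}H^1(G)\to H^2(G)$ is generated by elements of the form $\psi\otimes\psi'$ with $\psi,\psi'\in H^1(G)$; and (ii) there exists $\xi\in H^1(G)$ such that $\psi\cup\xi+\beta_G(\psi)=0$ for every $\psi\in H^1(G)$. (The paper's third condition, for $q=p^d$, that $H^1(G,\mathbb{Z}/q)\to H^1(G,\mathbb{Z}/p^i)$ is surjective for $1\le i\le d$, is vacuous for $q=p=2$.) $D_4=\langle r,s\mid r^4=s^2=(rs)^2=1\rangle$ is the dihedral group of order $8$. *)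

theory Defs
  imports "HOL-Analysis.Analysis" "HOL-Algebra.Free_Abelian_Groups" "HOL-Algebra.Generated_Groups"
begin

section \<open>Profinite groups\<close>

definition topological_group :: "('a, 'm) monoid_scheme \<Rightarrow> 'a topology \<Rightarrow> bool" where
  "topological_group G T \<longleftrightarrow>
     group G \<and> topspace T = carrier G \<and>
     continuous_map (prod_topology T T) T (\<lambda>(g, h). g \<otimes>\<^bsub>G\<^esub> h) \<and>
     continuous_map T T (\<lambda>g. inv\<^bsub>G\<^esub> g)"

definition totally_disconnected_space :: "'a topology \<Rightarrow> bool" where
  "totally_disconnected_space T \<longleftrightarrow> (\<forall>S. connectedin T S \<longrightarrow> (\<exists>x. S \<subseteq> {x}))"

definition profinite_group :: "('a, 'm) monoid_scheme \<Rightarrow> 'a topology \<Rightarrow> bool" where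
  "profinite_group G T \<longleftrightarrow>
     topological_group G T \<and> compact_space T \<and> Hausdorff_space T \<and> totally_disconnected_space T"

definition closed_subgroup_generated ::
    "('a, 'm) monoid_scheme \<Rightarrow> 'a topology \<Rightarrow> 'a set \<Rightarrow> 'a set" where
  "closed_subgroup_generated G T S = \<Inter>{K. subgroup K G \<and> closedin T K \<and> S \<subseteq> K}"

text \<open>
  The descending \<open>2\<close>-central series, indexed from \<open>1\<close>; the value at index \<open>0\<close> is a dummy.
\<close>

fun two_central_series ::
    "('a, 'm) monoid_scheme \<Rightarrow> 'a topology \<Rightarrow> nat \<Rightarrow> 'a set" where
  "two_central_series G T 0 = carrier G"
| "two_central_series G T (Suc 0) = carrier G"
| "two_central_series G T (Suc (Suc i)) =
     closed_subgroup_generated G T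
       ({h \<otimes>\<^bsub>G\<^esub> h | h. h \<in> two_central_series G T (Suc i)} \<union>
        {inv\<^bsub>G\<^esub> h \<otimes>\<^bsub>G\<^esub> inv\<^bsub>G\<^esub> g \<otimes>\<^bsub>G\<^esub> h \<otimes>\<^bsub>G\<^esub> g | h g.
           h \<in> two_central_series G T (Suc i) \<and> g \<in> carrier G})"

definition pro2_kernel :: "('a, 'm) monoid_scheme \<Rightarrow> 'a topology \<Rightarrow> 'a set" where
  "pro2_kernel G T = \<Inter>{N. N \<lhd> G \<and> openin T N \<and> (\<exists>n::nat. order (G Mod N) = 2 ^ n)}"

definition maximal_pro2_quotient ::
    "('a, 'm) monoid_scheme \<Rightarrow> 'a topology \<Rightarrow> 'a set monoid" where
  "maximal_pro2_quotient G T = G Mod pro2_kernel G T"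


section \<open>Continuous cohomology in degrees 1 and 2\<close>

text \<open>
  The complex of continuous inhomogeneous cochains, in degrees up to \<open>3\<close>, of \<open>G\<close> with
  coefficients in a discrete abelian group \<open>A\<close> on which \<open>G\<close> acts trivially. The group \<open>A\<close> is
  written multiplicatively, as always for HOL-Algebra groups, so the coboundaries are the
  multiplicative forms of
    \<open>(d0 a)(g) = g a - a = a - a\<close>,
    \<open>(d1 f)(g,h) = f h - f (g h) + f g\<close>,
    \<open>(d2 c)(g,h,k) = c(h,k) - c(g h,k) + c(g,h k) - c(g,h)\<close>.
  Cochains are extensional functions, so that equality of cochains is equality in HOL.
\<close>

definition continuous_functions_group ::
    "'x topology \<Rightarrow> ('b, 'n) monoid_scheme \<Rightarrow> ('x \<Rightarrow> 'b) monoid" where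
  "continuous_functions_group X A =
     \<lparr>carrier = {f \<in> topspace X \<rightarrow>\<^sub>E carrier A. continuous_map X (discrete_topology (carrier A)) f},
      monoid.mult = (\<lambda>f g. \<lambda>x\<in>topspace X. f x \<otimes>\<^bsub>A\<^esub> g x),
      one = (\<lambda>x\<in>topspace X. \<one>\<^bsub>A\<^esub>)\<rparr>"

abbreviation (input) cochains1 :: "'a topology \<Rightarrow> ('b, 'n) monoid_scheme \<Rightarrow> ('a \<Rightarrow> 'b) monoid" where
  "cochains1 T A \<equiv> continuous_functions_group T A"

abbreviation (input) cochains2 :: "'a topology \<Rightarrow> ('b, 'n) monoid_scheme \<Rightarrow> ('a \<times> 'a \<Rightarrow> 'b) monoid" where
  "cochains2 T A \<equiv> continuous_functions_group (prod_topology T T) A"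

abbreviation (input) cochains3 ::
    "'a topology \<Rightarrow> ('b, 'n) monoid_scheme \<Rightarrow> ('a \<times> 'a \<times> 'a \<Rightarrow> 'b) monoid" where
  "cochains3 T A \<equiv> continuous_functions_group (prod_topology T (prod_topology T T)) A"

definition coboundary0 ::
    "('a, 'm) monoid_scheme \<Rightarrow> ('b, 'n) monoid_scheme \<Rightarrow> 'b \<Rightarrow> 'a \<Rightarrow> 'b" where
  "coboundary0 G A a = (\<lambda>g\<in>carrier G. a \<otimes>\<^bsub>A\<^esub> inv\<^bsub>A\<^esub> a)"

definition coboundary1 ::
    "('a, 'm) monoid_scheme \<Rightarrow> ('b, 'n) monoid_scheme \<Rightarrow> ('a \<Rightarrow> 'b) \<Rightarrow> 'a \<times> 'a \<Rightarrow> 'b" where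
  "coboundary1 G A f =
     (\<lambda>(g, h)\<in>carrier G \<times> carrier G. f h \<otimes>\<^bsub>A\<^esub> inv\<^bsub>A\<^esub> f (g \<otimes>\<^bsub>G\<^esub> h) \<otimes>\<^bsub>A\<^esub> f g)"

definition coboundary2 ::
    "('a, 'm) monoid_scheme \<Rightarrow> ('b, 'n) monoid_scheme \<Rightarrow> ('a \<times> 'a \<Rightarrow> 'b) \<Rightarrow> 'a \<times> 'a \<times> 'a \<Rightarrow> 'b" where
  "coboundary2 G A c =
     (\<lambda>(g, h, k)\<in>carrier G \<times> carrier G \<times> carrier G.
        c (h, k) \<otimes>\<^bsub>A\<^esub> inv\<^bsub>A\<^esub> c (g \<otimes>\<^bsub>G\<^esub> h, k) \<otimes>\<^bsub>A\<^esub> c (g, h \<otimes>\<^bsub>G\<^esub> k) \<otimes>\<^bsub>A\<^esub> inv\<^bsub>A\<^esub> c (g, h))"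

definition cocycles1 ::
    "('a, 'm) monoid_scheme \<Rightarrow> 'a topology \<Rightarrow> ('b, 'n) monoid_scheme \<Rightarrow> ('a \<Rightarrow> 'b) set" where
  "cocycles1 G T A = kernel (cochains1 T A) (cochains2 T A) (coboundary1 G A)"

definition cocycles2 ::
    "('a, 'm) monoid_scheme \<Rightarrow> 'a topology \<Rightarrow> ('b, 'n) monoid_scheme \<Rightarrow> ('a \<times> 'a \<Rightarrow> 'b) set" where
  "cocycles2 G T A = kernel (cochains2 T A) (cochains3 T A) (coboundary2 G A)"

definition cohomology1 ::
    "('a, 'm) monoid_scheme \<Rightarrow> 'a topology \<Rightarrow> ('b, 'n) monoid_scheme \<Rightarrow> ('a \<Rightarrow> 'b) set monoid" where
  "cohomology1 G T A =
     (cochains1 T A)\<lparr>carrier := cocycles1 G T A\<rparr> Mod (coboundary0 G A ` carrier A)"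

definition cohomology2 ::
    "('a, 'm) monoid_scheme \<Rightarrow> 'a topology \<Rightarrow> ('b, 'n) monoid_scheme \<Rightarrow> ('a \<times> 'a \<Rightarrow> 'b) set monoid" where
  "cohomology2 G T A =
     (cochains2 T A)\<lparr>carrier := cocycles2 G T A\<rparr> Mod (coboundary1 G A ` carrier (cochains1 T A))"

abbreviation H1 :: "('a, 'm) monoid_scheme \<Rightarrow> 'a topology \<Rightarrow> ('a \<Rightarrow> int) set monoid" where
  "H1 G T \<equiv> cohomology1 G T (integer_mod_group 2)"

abbreviation H2 :: "('a, 'm) monoid_scheme \<Rightarrow> 'a topology \<Rightarrow> ('a \<times> 'a \<Rightarrow> int) set monoid" where
  "H2 G T \<equiv> cohomology2 G T (integer_mod_group 2)"

text \<open>
  Elements of \<open>H1 G T\<close> and \<open>H2 G T\<close> are classes, i.e. sets of cocycles. The lemmas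
  \<open>cup_unique\<close>, \<open>bockstein_unique\<close> and \<open>cup_hom_unique\<close> below show that the definite
  descriptions in the following definitions always denote.
\<close>

definition cup_cochain ::
    "('a, 'm) monoid_scheme \<Rightarrow> ('a \<Rightarrow> int) \<Rightarrow> ('a \<Rightarrow> int) \<Rightarrow> 'a \<times> 'a \<Rightarrow> int" where
  "cup_cochain G f f' = (\<lambda>(g, h)\<in>carrier G \<times> carrier G. (f g * f' h) mod 2)"

definition is_cup ::
    "('a, 'm) monoid_scheme \<Rightarrow> 'a topology \<Rightarrow> ('a \<Rightarrow> int) set \<Rightarrow> ('a \<Rightarrow> int) set \<Rightarrow>
     ('a \<times> 'a \<Rightarrow> int) set \<Rightarrow> bool" where
  "is_cup G T \<psi> \<psi>' \<omega> \<longleftrightarrow>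
     \<omega> \<in> carrier (H2 G T) \<and> (\<exists>f\<in>\<psi>. \<exists>f'\<in>\<psi>'. cup_cochain G f f' \<in> \<omega>)"

definition cup ::
    "('a, 'm) monoid_scheme \<Rightarrow> 'a topology \<Rightarrow> ('a \<Rightarrow> int) set \<Rightarrow> ('a \<Rightarrow> int) set \<Rightarrow>
     ('a \<times> 'a \<Rightarrow> int) set" where
  "cup G T \<psi> \<psi>' = (THE \<omega>. is_cup G T \<psi> \<psi>' \<omega>)"

text \<open>
  The connecting homomorphism of \<open>0 \<rightarrow> \<int>/2 \<rightarrow> \<int>/4 \<rightarrow> \<int>/2 \<rightarrow> 0\<close>, with first map \<open>x \<mapsto> 2 * x\<close> and second
  map \<open>y \<mapsto> y mod 2\<close>: lift a cocycle \<open>f\<close> to a continuous \<open>\<int>/4\<close>-cochain \<open>F\<close> and pull the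
  coboundary of \<open>F\<close> back to a \<open>\<int>/2\<close>-cocycle \<open>c\<close>.
\<close>

definition is_bockstein ::
    "('a, 'm) monoid_scheme \<Rightarrow> 'a topology \<Rightarrow> ('a \<Rightarrow> int) set \<Rightarrow> ('a \<times> 'a \<Rightarrow> int) set \<Rightarrow> bool" where
  "is_bockstein G T \<psi> \<omega> \<longleftrightarrow>
     \<omega> \<in> carrier (H2 G T) \<and>
     (\<exists>f\<in>\<psi>. \<exists>F\<in>carrier (cochains1 T (integer_mod_group 4)). \<exists>c\<in>\<omega>.
        (\<forall>g\<in>carrier G. F g mod 2 = f g) \<and>
        (\<forall>g\<in>carrier G. \<forall>h\<in>carrier G. 2 * c (g, h) = coboundary1 G (integer_mod_group 4) F (g, h)))"

definition bockstein ::
    "('a, 'm) monoid_scheme \<Rightarrow> 'a topology \<Rightarrow> ('a \<Rightarrow> int) set \<Rightarrow> ('a \<times> 'a \<Rightarrow> int) set" where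
  "bockstein G T \<psi> = (THE \<omega>. is_bockstein G T \<psi> \<omega>)"


section \<open>Tensor products of abelian groups\<close>

definition tensor_relations ::
    "('a, 'm) monoid_scheme \<Rightarrow> ('b, 'n) monoid_scheme \<Rightarrow> ('a \<times> 'b \<Rightarrow>\<^sub>0 int) set" where
  "tensor_relations A B =
     {frag_of (a \<otimes>\<^bsub>A\<^esub> a', b) - frag_of (a, b) - frag_of (a', b) | a a' b.
        a \<in> carrier A \<and> a' \<in> carrier A \<and> b \<in> carrier B} \<union>
     {frag_of (a, b \<otimes>\<^bsub>B\<^esub> b') - frag_of (a, b) - frag_of (a, b') | a b b'.
        a \<in> carrier A \<and> b \<in> carrier B \<and> b' \<in> carrier B}"

definition tensor_null ::
    "('a, 'm) monoid_scheme \<Rightarrow> ('b, 'n) monoid_scheme \<Rightarrow> ('a \<times> 'b \<Rightarrow>\<^sub>0 int) set" where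
  "tensor_null A B =
     generate (free_Abelian_group (carrier A \<times> carrier B)) (tensor_relations A B)"

definition tensor_product ::
    "('a, 'm) monoid_scheme \<Rightarrow> ('b, 'n) monoid_scheme \<Rightarrow> ('a \<times> 'b \<Rightarrow>\<^sub>0 int) set monoid" where
  "tensor_product A B = free_Abelian_group (carrier A \<times> carrier B) Mod tensor_null A B"

definition pure_tensor ::
    "('a, 'm) monoid_scheme \<Rightarrow> ('b, 'n) monoid_scheme \<Rightarrow> 'a \<Rightarrow> 'b \<Rightarrow> ('a \<times> 'b \<Rightarrow>\<^sub>0 int) set" where
  "pure_tensor A B a b =
     tensor_null A B #>\<^bsub>free_Abelian_group (carrier A \<times> carrier B)\<^esub> frag_of (a, b)"

definition is_cup_hom ::
    "('a, 'm) monoid_scheme \<Rightarrow> 'a topology \<Rightarrow>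
     ((('a \<Rightarrow> int) set \<times> ('a \<Rightarrow> int) set \<Rightarrow>\<^sub>0 int) set \<Rightarrow> ('a \<times> 'a \<Rightarrow> int) set) \<Rightarrow> bool" where
  "is_cup_hom G T u \<longleftrightarrow>
     u \<in> hom (tensor_product (H1 G T) (H1 G T)) (H2 G T) \<and>
     u \<in> extensional (carrier (tensor_product (H1 G T) (H1 G T))) \<and>
     (\<forall>\<psi>\<in>carrier (H1 G T). \<forall>\<psi>'\<in>carrier (H1 G T).
        u (pure_tensor (H1 G T) (H1 G T) \<psi> \<psi>') = cup G T \<psi> \<psi>')"

definition cup_hom ::
    "('a, 'm) monoid_scheme \<Rightarrow> 'a topology \<Rightarrow>
     (('a \<Rightarrow> int) set \<times> ('a \<Rightarrow> int) set \<Rightarrow>\<^sub>0 int) set \<Rightarrow> ('a \<times> 'a \<Rightarrow> int) set" where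
  "cup_hom G T = (THE u. is_cup_hom G T u)"


section \<open>Galois relation type relative to 2\<close>

definition galois_relation_type_2 :: "('a, 'm) monoid_scheme \<Rightarrow> 'a topology \<Rightarrow> bool" where
  "galois_relation_type_2 G T \<longleftrightarrow>
     (\<exists>S \<subseteq> {pure_tensor (H1 G T) (H1 G T) \<psi> \<psi>' | \<psi> \<psi>'.
               \<psi> \<in> carrier (H1 G T) \<and> \<psi>' \<in> carrier (H1 G T)}.
        kernel (tensor_product (H1 G T) (H1 G T)) (H2 G T) (cup_hom G T) =
        generate (tensor_product (H1 G T) (H1 G T)) S) \<and>
     (\<exists>\<xi>\<in>carrier (H1 G T). \<forall>\<psi>\<in>carrier (H1 G T).
        cup G T \<psi> \<xi> \<otimes>\<^bsub>H2 G T\<^esub> bockstein G T \<psi> = \<one>\<^bsub>H2 G T\<^esub>)"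


section \<open>The dihedral group of order 8\<close>

text \<open>The pair \<open>(i, j)\<close> stands for \<open>r\<^sup>i s\<^sup>j\<close>.\<close>

definition dihedral4 :: "(int \<times> int) monoid" where
  "dihedral4 =
     \<lparr>carrier = {0..<4} \<times> {0..<2},
      monoid.mult = (\<lambda>(i, j) (k, l). ((if j = 0 then i + k else i - k) mod 4, (j + l) mod 2)),
      one = (0, 0)\<rparr>"

end

theory Submission
  imports Defs "HOL-Algebra.SndIsomorphismGrp" "HOL-Algebra.Sylow"
begin

text \<open>
  One inclusion holds because in the groups \<open>1\<close>, \<open>\<int>/4\<close>, \<open>D\<^sub>4\<close> every square is central and squares to
  the identity, so that every homomorphism to one of them kills the third term of the series.

  For the converse, an element \<open>\<sigma>\<close> outside the third term has to survive in a quotient \<open>\<int>/4\<close> or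
  \<open>D\<^sub>4\<close>. A class in \<open>H\<^sup>1\<close> is the same as a character \<open>f\<close>, i.e. a continuous homomorphism to \<open>\<int>/2\<close>.
  That \<open>f \<union> f' = 0\<close> means that some continuous \<open>F\<close> satisfies \<open>F (g h) = F g + F h + f g f' h\<close>
  (\<open>splits_cup F f f'\<close>), and then the matrices with rows \<open>(1, f, F)\<close>, \<open>(0, 1, f')\<close>, \<open>(0, 0, 1)\<close> define
  a homomorphism to the unitriangular group over the field with two elements, which is \<open>D\<^sub>4\<close>. Its
  image is \<open>D\<^sub>4\<close> if \<open>f\<close> and \<open>f'\<close> are distinct and nonzero, and \<open>\<int>/4\<close> if \<open>f = f'\<close> is nonzero
  (\<open>admissible_D4\<close>, \<open>admissible_Z4\<close>). Hence it is enough to find such data for which \<open>f \<sigma>\<close>, \<open>f' \<sigma>\<close>, \<open>F \<sigma>\<close> are not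
  all zero.

  Let \<open>\<sigma>\<close> lie in the second term of the series. Take \<open>N\<close> maximal among the open normal subgroups
  that contain the third term but not \<open>\<sigma>\<close>. The image \<open>z\<close> of \<open>\<sigma>\<close> in the finite group \<open>G/N\<close> is a
  central involution, and all squares of \<open>G/N\<close> lie in \<open>{1, z}\<close>. On such a group there is a function
  \<open>F\<close> with \<open>F z = 1\<close> whose coboundary is a sum of products \<open>a\<^sub>i \<union> b\<^sub>i\<close> of characters
  (\<open>bilinear_coboundary_exists\<close>); this elementary statement takes the place of the computation of
  \<open>H\<^sup>2\<close> of an elementary abelian group and of the five term exact sequence. Pulled back to \<open>G\<close>, it
  shows that the tensor \<open>\<Sum> a\<^sub>i \<otimes> b\<^sub>i\<close> lies in the kernel of the cup product. By condition (i) it is a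
  combination of tensors \<open>\<psi> \<otimes> \<psi>'\<close> with \<open>\<psi> \<union> \<psi>' = 0\<close>. Splittings of these add up to \<open>F\<close> up to a
  character, and characters vanish at \<open>\<sigma>\<close>; so one of the splittings is nonzero at \<open>\<sigma>\<close>
  (\<open>cup_kernel_condition\<close>).

  Let \<open>\<sigma>\<close> lie outside the second term. Then \<open>f \<sigma> = 1\<close> for some character \<open>f\<close>. The Bockstein map is
  \<open>f \<mapsto> f \<union> f\<close>, so condition (ii) says that \<open>f \<union> (f + \<xi>) = 0\<close> for every \<open>f\<close>, which gives the data
  unless \<open>f = \<xi>\<close>. If \<open>f = \<xi>\<close> and there is a further nonzero character \<open>h\<close>, then \<open>h\<close> or \<open>h + \<xi>\<close> can
  take the place of \<open>f\<close>. If \<open>\<xi>\<close> is the only nonzero character, then \<open>G(2)\<close> is procyclic, and since it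
  is not of order \<open>2\<close> the character \<open>\<xi>\<close> lifts to \<open>\<int>/4\<close>, that is \<open>\<xi> \<union> \<xi> = 0\<close>
  (\<open>unique_character_self_splits\<close>).
\<close>

section \<open>Open normal subgroups of profinite groups\<close>

locale profinite = group G for G (structure) and T :: "'a topology" +
  assumes profinite: "profinite_group G T"
begin

lemma topspace_eq [simp]: "topspace T = carrier G"
  and compact: "compact_space T"
  and Hausdorff: "Hausdorff_space T"
  and continuous_mult: "continuous_map (prod_topology T T) T (\<lambda>(g, h). g \<otimes> h)"
  using profinite by (auto simp: profinite_group_def topological_group_def)

lemma continuous_mult_maps:
  assumes "continuous_map X T f" "continuous_map X T g"
  shows "continuous_map X T (\<lambda>x. f x \<otimes> g x)"
  using continuous_map_compose[OF continuous_map_pairedI[OF assms] continuous_mult]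
  by (simp add: o_def)

lemma clopen_separation:
  assumes "x \<in> carrier G" "y \<in> carrier G" "x \<noteq> y"
  obtains C where "openin T C" "closedin T C" "x \<in> C" "y \<notin> C"
proof -
  have "\<not> connected_component_of T x y"
  proof
    assume "connected_component_of T x y"
    then obtain S where "connectedin T S" "x \<in> S" "y \<in> S"
      by (auto simp: connected_component_of_def)
    with assms(3) show False
      using profinite unfolding profinite_group_def totally_disconnected_space_def by blast
  qed
  then have "\<not> quasi_component_of T x y"
    using quasi_eq_connected_component_of[of T x] compact Hausdorff by simp
  with assms that show thesis
    unfolding quasi_component_of by auto
qed

text \<open>
  The normal open subgroups of a profinite group form a basis at the identity: a clopen set \<open>C\<close>
  contains its two-sided stabilizer. The complement of the stabilizer is the projection of a clopen
  subset of \<open>(G \<times> G) \<times> G\<close> along the compact factor \<open>G \<times> G\<close>, hence closed.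
\<close>
lemma clopen_core:
  assumes "openin T C" "closedin T C"
  defines "N \<equiv> {g \<in> carrier G. \<forall>x\<in>carrier G. \<forall>y\<in>carrier G. x \<otimes> g \<otimes> y \<in> C \<longleftrightarrow> x \<otimes> y \<in> C}"
  shows "N \<lhd> G" "openin T N" "\<one> \<in> C \<Longrightarrow> N \<subseteq> C"
proof -
  have sub: "subgroup N G"
  proof (rule subgroupI)
    show "N \<noteq> {}" unfolding N_def by (auto intro!: exI[of _ \<one>])
  next
    fix a assume a: "a \<in> N"
    then have aG: "a \<in> carrier G" by (simp add: N_def)
    have "x \<otimes> inv a \<otimes> y \<in> C \<longleftrightarrow> x \<otimes> y \<in> C" if "x \<in> carrier G" "y \<in> carrier G" for x y
    proof -
      have "(x \<otimes> inv a) \<otimes> a \<otimes> y = x \<otimes> y"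
        using that aG by (simp add: m_assoc)
      moreover have "(x \<otimes> inv a) \<otimes> a \<otimes> y \<in> C \<longleftrightarrow> (x \<otimes> inv a) \<otimes> y \<in> C"
        using a that aG unfolding N_def by blast
      ultimately show ?thesis by simp
    qed
    then show "inv a \<in> N" using aG by (simp add: N_def)
  next
    fix a b assume a: "a \<in> N" and b: "b \<in> N"
    then have G: "a \<in> carrier G" "b \<in> carrier G" by (auto simp: N_def)
    have "x \<otimes> (a \<otimes> b) \<otimes> y \<in> C \<longleftrightarrow> x \<otimes> y \<in> C" if "x \<in> carrier G" "y \<in> carrier G" for x y
    proof -
      have "x \<otimes> (a \<otimes> b) \<otimes> y = x \<otimes> a \<otimes> (b \<otimes> y)" "x \<otimes> (b \<otimes> y) = x \<otimes> b \<otimes> y"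
        using that G by (simp_all add: m_assoc)
      then show ?thesis
        using a b that G by (simp add: N_def)
    qed
    then show "a \<otimes> b \<in> N" using G by (simp add: N_def)
  qed (auto simp: N_def)
  have "g \<otimes> h \<otimes> inv g \<in> N" if g: "g \<in> carrier G" and h: "h \<in> N" for g h
  proof -
    have hG: "h \<in> carrier G" using h by (simp add: N_def)
    have "x \<otimes> (g \<otimes> h \<otimes> inv g) \<otimes> y \<in> C \<longleftrightarrow> x \<otimes> y \<in> C" if "x \<in> carrier G" "y \<in> carrier G" for x y
    proof -
      have "x \<otimes> (g \<otimes> h \<otimes> inv g) \<otimes> y = (x \<otimes> g) \<otimes> h \<otimes> (inv g \<otimes> y)"
        "(x \<otimes> g) \<otimes> (inv g \<otimes> y) = x \<otimes> y"
        using that hG g r_inv[of g] m_assoc[of g "inv g" y] by (simp_all add: m_assoc)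
      then show ?thesis
        using h that hG g by (simp add: N_def)
    qed
    then show ?thesis using hG g by (simp add: N_def)
  qed
  with sub show "N \<lhd> G"
    by (auto simp: normal_inv_iff)
  let ?P = "prod_topology (prod_topology T T) T"
  have proj: "continuous_map ?P T (\<lambda>p. fst (fst p))" "continuous_map ?P T (\<lambda>p. snd (fst p))"
    "continuous_map ?P T snd"
    using continuous_map_compose[OF continuous_map_fst[of "prod_topology T T" T] continuous_map_fst[of T T]]
      continuous_map_compose[OF continuous_map_fst[of "prod_topology T T" T] continuous_map_snd[of T T]]
      continuous_map_snd[of "prod_topology T T" T]
    by (simp_all add: o_def)
  have c1: "continuous_map ?P T (\<lambda>p. fst (fst p) \<otimes> snd p \<otimes> snd (fst p))"
    by (intro continuous_mult_maps proj)
  have c2: "continuous_map ?P T (\<lambda>p. fst (fst p) \<otimes> snd (fst p))"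
    by (intro continuous_mult_maps proj)
  \<comment> \<open>The bad triples, as the symmetric difference of two clopen sets.\<close>
  define D where "D = {p \<in> topspace ?P. (fst (fst p) \<otimes> snd p \<otimes> snd (fst p) \<in> C) \<noteq> (fst (fst p) \<otimes> snd (fst p) \<in> C)}"
  define D1 where "D1 = {p \<in> topspace ?P. fst (fst p) \<otimes> snd p \<otimes> snd (fst p) \<in> C}"
  define D2 where "D2 = {p \<in> topspace ?P. fst (fst p) \<otimes> snd (fst p) \<in> C}"
  have "closedin ?P D1" "openin ?P D1" "closedin ?P D2" "openin ?P D2"
    using openin_continuous_map_preimage[OF c1 assms(1)] closedin_continuous_map_preimage[OF c1 assms(2)]
     openin_continuous_map_preimage[OF c2 assms(1)] closedin_continuous_map_preimage[OF c2 assms(2)]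
    by (simp_all add: D1_def D2_def)
  then have "closedin ?P ((D1 - D2) \<union> (D2 - D1))"
    by (intro closedin_Un closedin_diff)
  also have "(D1 - D2) \<union> (D2 - D1) = D"
    by (auto simp: D_def D1_def D2_def)
  finally have "closedin T (snd ` D)"
    using closed_map_snd[of "prod_topology T T" T] compact
    by (auto simp: compact_space_prod_topology closed_map_def)
  moreover have "carrier G - snd ` D = N"
    by (force simp: D_def N_def image_iff)
  ultimately show "openin T N"
    using openin_diff[OF openin_topspace] by (metis topspace_eq)
  show "N \<subseteq> C" if "\<one> \<in> C"
    using that unfolding N_def by (auto dest!: bspec[of _ _ \<one>])
qed

lemma continuous_translation:
  "a \<in> carrier G \<Longrightarrow> continuous_map T T (\<lambda>g. g \<otimes> a)"
  by (intro continuous_mult_maps) auto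

lemma openin_coset:
  assumes "openin T N" "a \<in> carrier G"
  shows "openin T (N #> a)"
proof -
  have "N \<subseteq> carrier G" using openin_subset[OF assms(1)] by simp
  then have "N #> a = {g \<in> topspace T. g \<otimes> inv a \<in> N}"
    using assms(2)
    by (force simp: r_coset_def m_assoc)
  then show ?thesis
    using openin_continuous_map_preimage[OF continuous_translation[OF inv_closed[OF assms(2)]] assms(1)] by simp
qed

text \<open>
  A set that is stable under an open subgroup is clopen, because the set and its complement are
  unions of open cosets. All continuity and openness statements about functions and subgroups
  that come from a finite quotient rest on this.
\<close>
lemma openin_union_cosets:
  assumes "subgroup N G" "openin T N" "S \<subseteq> carrier G" "\<And>n s. n \<in> N \<Longrightarrow> s \<in> S \<Longrightarrow> n \<otimes> s \<in> S"
  shows "openin T S"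
proof -
  have "S = (\<Union>s\<in>S. N #> s)"
  proof
    show "S \<subseteq> (\<Union>s\<in>S. N #> s)" using assms(1,3) rcos_self by blast
    show "(\<Union>s\<in>S. N #> s) \<subseteq> S" using assms(4) by (auto simp: r_coset_def)
  qed
  then show ?thesis
    using assms(3) openin_coset[OF assms(2)] openin_Union[of "(\<lambda>s. N #> s) ` S" T] by (metis image_iff in_mono)
qed

lemma closedin_union_cosets:
  assumes "subgroup N G" "openin T N" "S \<subseteq> carrier G" "\<And>n s. n \<in> N \<Longrightarrow> s \<in> S \<Longrightarrow> n \<otimes> s \<in> S"
  shows "closedin T S"
proof -
  have "openin T (carrier G - S)"
  proof (rule openin_union_cosets[OF assms(1,2)])
    fix n s assume n: "n \<in> N" and s: "s \<in> carrier G - S"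
    have nG: "n \<in> carrier G" using n assms(1) by (simp add: subgroup.mem_carrier)
    have "s \<in> S" if "n \<otimes> s \<in> S"
    proof -
      have "inv n \<otimes> (n \<otimes> s) \<in> S"
        using assms(4)[OF subgroup.m_inv_closed[OF assms(1) n] that] .
      moreover have "inv n \<otimes> (n \<otimes> s) = s" using nG s by (simp flip: m_assoc)
      ultimately show ?thesis by simp
    qed
    with s nG show "n \<otimes> s \<in> carrier G - S" by auto
  qed auto
  then show ?thesis using assms(3) by (simp add: closedin_def)
qed

lemma openin_supergroup:
  assumes "subgroup N G" "openin T N" "subgroup H G" "N \<subseteq> H"
  shows "openin T H" "closedin T H"
  using openin_union_cosets[OF assms(1,2) subgroup.subset[OF assms(3)]] 
    closedin_union_cosets[OF assms(1,2) subgroup.subset[OF assms(3)]] assms(4) subgroup.m_closed[OF assms(3)]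
  by blast+

lemma continuous_map_coset_invariant:
  assumes "subgroup N G" "openin T N" "\<And>g. g \<in> carrier G \<Longrightarrow> f g \<in> D"
    "\<And>n g. n \<in> N \<Longrightarrow> g \<in> carrier G \<Longrightarrow> f (n \<otimes> g) = f g"
  shows "continuous_map T (discrete_topology D) f"
  unfolding continuous_map
proof (intro conjI allI impI)
  fix U assume "openin (discrete_topology D) U"
  show "openin T {x \<in> topspace T. f x \<in> U}"
    using assms(4) subgroup.mem_carrier[OF assms(1)] by (intro openin_union_cosets[OF assms(1,2)]) auto
qed (use assms(3) in auto)

lemma openin_kernel:
  assumes "continuous_map T (discrete_topology D) f"
  shows "openin T {g \<in> carrier G. f g = d}" "closedin T {g \<in> carrier G. f g = d}"
proof -
  have *: "{g \<in> carrier G. f g = d} = {g \<in> topspace T. f g \<in> D \<inter> {d}}"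
    using continuous_map_image_subset_topspace[OF assms] by auto
  show "openin T {g \<in> carrier G. f g = d}" "closedin T {g \<in> carrier G. f g = d}"
    unfolding * by (rule openin_continuous_map_preimage[OF assms] closedin_continuous_map_preimage[OF assms], simp)+
qed

lemma finite_rcosets:
  assumes "subgroup N G" "openin T N"
  shows "finite (rcosets N)"
proof -
  have "\<Union>(rcosets N) = topspace T" using rcosets_part_G[OF assms(1)] by simp
  then obtain \<F> where F: "finite \<F>" "\<F> \<subseteq> rcosets N" "topspace T \<subseteq> \<Union>\<F>"
    using compact openin_coset[OF assms(2)] unfolding compact_space_alt
    by (smt (verit) RCOSETS_def UN_iff singletonD subset_refl)
  have "rcosets N \<subseteq> \<F>"
  proof
    fix c assume c: "c \<in> rcosets N"
    then obtain x where x: "x \<in> carrier G" "c = N #> x" by (auto simp: RCOSETS_def)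
    then have "x \<in> c" using rcos_self assms(1) by simp
    from x F(3) obtain d where d: "d \<in> \<F>" "x \<in> d" by auto
    then have "c = d" using rcos_disjoint[OF assms(1)] c F(2) \<open>x \<in> c\<close>
      by (meson disjnt_iff pairwiseD subsetD)
    with d show "c \<in> \<F>" by simp
  qed
  with F(1) show ?thesis by (rule finite_subset[rotated])
qed

text \<open>
  The quotient by a closed normal subgroup is residually finite. For \<open>k \<in> K\<close> some open normal
  subgroup omits \<open>k \<otimes> inv \<sigma>\<close>, and by compactness of \<open>K\<close> the intersection \<open>N\<close> of finitely many of
  these works for all \<open>k\<close>; then \<open>\<sigma> \<notin> N K\<close>.
\<close>
lemma open_normal_separation:
  assumes "K \<lhd> G" "closedin T K" "\<sigma> \<in> carrier G" "\<sigma> \<notin> K"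
  obtains N where "N \<lhd> G" "openin T N" "K \<subseteq> N" "\<sigma> \<notin> N"
proof -
  have KG: "k \<in> carrier G" if "k \<in> K" for k 
    using that assms(1) by (meson normal_imp_subgroup subgroup.mem_carrier)
  have "\<exists>N. N \<lhd> G \<and> openin T N \<and> k \<otimes> inv \<sigma> \<notin> N" if k: "k \<in> K" for k
  proof -
    have "\<one> \<noteq> k \<otimes> inv \<sigma>"
    proof
      assume "\<one> = k \<otimes> inv \<sigma>"
      then have "k = \<sigma>" using KG[OF k] assms(3) by (metis inv_comm inv_equality inv_inv inv_closed)
      with k assms(4) show False by simp
    qed
    then obtain C where "openin T C" "closedin T C" "\<one> \<in> C" "k \<otimes> inv \<sigma> \<notin> C"
      using clopen_separation[of \<one> "k \<otimes> inv \<sigma>"] KG[OF k] assms(3) by auto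
    with clopen_core[of C] show ?thesis by blast
  qed
  then obtain M where M: "\<And>k. k \<in> K \<Longrightarrow> M k \<lhd> G" "\<And>k. k \<in> K \<Longrightarrow> openin T (M k)"
      "\<And>k. k \<in> K \<Longrightarrow> k \<otimes> inv \<sigma> \<notin> M k"
    by metis
  have Msub: "\<And>k. k \<in> K \<Longrightarrow> subgroup (M k) G" using M(1) normal_imp_subgroup by blast
  have "compactin T K" using assms(2) compact closedin_compact_space by blast
  moreover have "\<forall>U\<in>(\<lambda>k. M k #> k) ` K. openin T U" using M(2) KG openin_coset by auto
  moreover have "K \<subseteq> \<Union>((\<lambda>k. M k #> k) ` K)" using rcos_self Msub KG by blast
  ultimately obtain \<F> where "finite \<F>" "\<F> \<subseteq> (\<lambda>k. M k #> k) ` K" "K \<subseteq> \<Union>\<F>"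
    unfolding compactin_def by meson
  then obtain F where F: "finite F" "F \<subseteq> K" "K \<subseteq> (\<Union>k\<in>F. M k #> k)"
    by (metis (no_types, lifting) finite_subset_image)
  define N where "N = carrier G \<inter> (\<Inter>k\<in>F. M k)"
  have N: "N \<lhd> G" "openin T N"
    unfolding N_def using F(1,2)
  proof (induction F)
    case empty
    { case 1 show ?case by (simp add: normal_inv_iff subgroup_self) }
    { case 2 show ?case using openin_topspace[of T] by simp }
  next
    case (insert k F)
    have eq: "carrier G \<inter> (\<Inter>k\<in>insert k F. M k) = (carrier G \<inter> (\<Inter>k\<in>F. M k)) \<inter> M k" by auto
    { case 1 show ?case unfolding eq using insert 1 M(1) by (auto intro: normal_subgroup_intersect) }
    { case 2 show ?case unfolding eq using insert 2 M(2) by auto }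
  qed
  show thesis
  proof (rule that)
    show n: "N <#> K \<lhd> G" using normal_subgroup_set_mult_closed[OF N(1) assms(1)] .
    have "\<one> \<in> N" "\<one> \<in> K" using N(1) assms(1) by (simp_all add: normal_imp_subgroup subgroup.one_closed)
    then have "N \<subseteq> N <#> K" and *: "K \<subseteq> N <#> K"
      using N(1) assms(1) KG unfolding set_mult_def
      by (force intro: r_one[symmetric] l_one[symmetric] simp: N_def)+
    then show "openin T (N <#> K)"
      using openin_supergroup(1)[OF _ N(2)] N(1) n by (simp add: normal_imp_subgroup)
    show "K \<subseteq> N <#> K" by fact
    show "\<sigma> \<notin> N <#> K"
    proof
      assume "\<sigma> \<in> N <#> K"
      then obtain n k where nk: "n \<in> N" "k \<in> K" "\<sigma> = n \<otimes> k" by (auto simp: set_mult_def)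
      with F obtain j n' where j: "j \<in> F" "n' \<in> M j" "k = n' \<otimes> j"
        unfolding r_coset_def by blast
      have n: "n \<in> M j" using nk j N_def by auto
      have sj: "subgroup (M j) G" using j F Msub by auto
      have G: "n \<in> carrier G" "n' \<in> carrier G" "j \<in> carrier G"
        using n j sj F KG by (auto intro: subgroup.mem_carrier)
      have "j \<otimes> inv \<sigma> = inv n' \<otimes> inv n"
        using nk j G by (simp add: inv_mult_group m_assoc r_inv flip: m_assoc)
      then have "j \<otimes> inv \<sigma> \<in> M j"
        using n j sj by (simp add: subgroup.m_inv_closed subgroup.m_closed)
      with M(3) j F show False by auto
    qed
  qed
qed

text \<open>
  Only finitely many subgroups contain a given open subgroup, since each is a union of cosets.
\<close>
lemma maximal_open_normal_separation:
  assumes "K \<lhd> G" "closedin T K" "\<sigma> \<in> carrier G" "\<sigma> \<notin> K"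
  obtains N where "N \<lhd> G" "openin T N" "K \<subseteq> N" "\<sigma> \<notin> N"
    "\<And>M. M \<lhd> G \<Longrightarrow> N \<subset> M \<Longrightarrow> \<sigma> \<in> M"
proof -
  obtain L where L: "L \<lhd> G" "openin T L" "K \<subseteq> L" "\<sigma> \<notin> L"
    using open_normal_separation[OF assms] .
  have sL: "subgroup L G" using L normal_imp_subgroup by blast
  define \<A> where "\<A> = {M. M \<lhd> G \<and> L \<subseteq> M \<and> \<sigma> \<notin> M}"
  have "M \<in> Union ` Pow (rcosets L)" if "M \<in> \<A>" for M
  proof -
    have sM: "subgroup M G" "L \<subseteq> M" using that by (auto simp: \<A>_def normal_imp_subgroup)
    have "M = \<Union>((\<lambda>m. L #> m) ` M)"
      using rcos_self[OF _ sL] subgroup.mem_carrier[OF sM(1)] sM subgroup.m_closed[OF sM(1)]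
      by (auto simp: r_coset_def)
    moreover have "(\<lambda>m. L #> m) ` M \<in> Pow (rcosets L)"
      using subgroup.mem_carrier[OF sM(1)] by (auto simp: RCOSETS_def)
    ultimately show ?thesis by blast
  qed
  then have "finite \<A>"
    using finite_rcosets[OF sL L(2)] by (meson finite_Pow_iff finite_imageI finite_subset subsetI)
  moreover have "L \<in> \<A>" using L by (simp add: \<A>_def)
  ultimately obtain N where N: "N \<in> \<A>" "\<And>M. M \<in> \<A> \<Longrightarrow> N \<subseteq> M \<Longrightarrow> N = M"
    using finite_has_maximal by (metis empty_iff)
  show thesis
  proof (rule that)
    show "N \<lhd> G" "K \<subseteq> N" "\<sigma> \<notin> N" using N L by (auto simp: \<A>_def)
    then show "openin T N"
      using openin_supergroup(1)[OF sL L(2), of N] N(1) by (simp add: \<A>_def normal_imp_subgroup)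
    show "\<sigma> \<in> M" if "M \<lhd> G" "N \<subset> M" for M
    proof (rule ccontr)
      assume "\<sigma> \<notin> M"
      with that N(1) have "M \<in> \<A>" by (auto simp: \<A>_def)
      with N(2) that show False by blast
    qed
  qed
qed

end

section \<open>Squares, commutators and the central series\<close>

lemma (in group) commutator_eq_squares:
  assumes "x \<in> carrier G" "y \<in> carrier G"
  shows "inv x \<otimes> inv y \<otimes> x \<otimes> y =
    (inv x \<otimes> inv x) \<otimes> ((x \<otimes> inv y) \<otimes> (x \<otimes> inv y)) \<otimes> (y \<otimes> y)"
proof -
  have "inv x \<otimes> (x \<otimes> w) = w" "inv y \<otimes> (y \<otimes> w) = w" if "w \<in> carrier G" for w
    using assms that by (simp_all flip: m_assoc)
  then show ?thesis using assms by (simp add: m_assoc)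
qed

lemma (in group) conjugate_eq_mult_commutator:
  assumes "h \<in> carrier G" "g \<in> carrier G"
  shows "inv g \<otimes> h \<otimes> g = h \<otimes> (inv h \<otimes> inv g \<otimes> h \<otimes> g)"
  using assms by (simp flip: m_assoc)

lemma (in group) normal_if_commutators:
  assumes "subgroup K G"
    and "\<And>h g. h \<in> K \<Longrightarrow> g \<in> carrier G \<Longrightarrow> inv h \<otimes> inv g \<otimes> h \<otimes> g \<in> K"
  shows "K \<lhd> G"
  unfolding normal_inv_iff
proof (intro conjI ballI)
  fix g h assume g: "g \<in> carrier G" and h: "h \<in> K"
  have "h \<otimes> (inv h \<otimes> inv (inv g) \<otimes> h \<otimes> inv g) \<in> K"
    using assms(2)[OF h, of "inv g"] g h subgroup.m_closed[OF assms(1)] by simp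
  then show "g \<otimes> h \<otimes> inv g \<in> K"
    using conjugate_eq_mult_commutator[of h "inv g"] g subgroup.mem_carrier[OF assms(1) h] by simp
qed (rule assms)

context profinite
begin

lemma closed_subgroup_generated:
  assumes "S \<subseteq> carrier G"
  shows "subgroup (closed_subgroup_generated G T S) G"
    and "closedin T (closed_subgroup_generated G T S)"
    and "S \<subseteq> closed_subgroup_generated G T S"
proof -
  have "carrier G \<in> {K. subgroup K G \<and> closedin T K \<and> S \<subseteq> K}"
    using assms subgroup_self closedin_topspace[of T] by simp
  then have ne: "{K. subgroup K G \<and> closedin T K \<and> S \<subseteq> K} \<noteq> {}" by blast
  show "subgroup (closed_subgroup_generated G T S) G" 
    unfolding closed_subgroup_generated_def by (rule subgroups_Inter) (use ne in auto)
  show "closedin T (closed_subgroup_generated G T S)"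
    unfolding closed_subgroup_generated_def by (rule closedin_Inter) (use ne in auto)
  show "S \<subseteq> closed_subgroup_generated G T S"
    unfolding closed_subgroup_generated_def by blast
qed

lemma closed_subgroup_generated_least:
  "subgroup K G \<Longrightarrow> closedin T K \<Longrightarrow> S \<subseteq> K \<Longrightarrow> closed_subgroup_generated G T S \<subseteq> K"
  unfolding closed_subgroup_generated_def by blast

abbreviation "G2 \<equiv> two_central_series G T 2"
abbreviation "G3 \<equiv> two_central_series G T 3"

lemma G2_unfold: "G2 = closed_subgroup_generated G T
       ({h \<otimes> h | h. h \<in> carrier G} \<union> {inv h \<otimes> inv g \<otimes> h \<otimes> g | h g. h \<in> carrier G \<and> g \<in> carrier G})"
  by (simp add: numeral_2_eq_2)

lemma G3_unfold: "G3 = closed_subgroup_generated G T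
       ({h \<otimes> h | h. h \<in> G2} \<union> {inv h \<otimes> inv g \<otimes> h \<otimes> g | h g. h \<in> G2 \<and> g \<in> carrier G})"
  by (simp add: numeral_2_eq_2 numeral_3_eq_3)

lemma G2_squares: "h \<in> carrier G \<Longrightarrow> h \<otimes> h \<in> G2"
  and G2_normal: "G2 \<lhd> G"
  and G2_closed: "closedin T G2"
proof -
  let ?S = "{h \<otimes> h | h. h \<in> carrier G} \<union> {inv h \<otimes> inv g \<otimes> h \<otimes> g | h g. h \<in> carrier G \<and> g \<in> carrier G}"
  have S: "?S \<subseteq> carrier G" by auto
  note * = closed_subgroup_generated[OF S, folded G2_unfold]
  show "h \<otimes> h \<in> G2" if "h \<in> carrier G" using *(3) that by auto
  show "closedin T G2" by (rule *(2))
  show "G2 \<lhd> G"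
  proof (rule normal_if_commutators[OF *(1)])
    fix h g assume "h \<in> G2" "g \<in> carrier G"
    with subgroup.mem_carrier[OF *(1)] have "inv h \<otimes> inv g \<otimes> h \<otimes> g \<in> ?S" by blast
    with *(3) show "inv h \<otimes> inv g \<otimes> h \<otimes> g \<in> G2" by blast
  qed
qed

lemma G2_carrier: "h \<in> G2 \<Longrightarrow> h \<in> carrier G"
  using G2_normal by (meson normal_imp_subgroup subgroup.mem_carrier)

lemma G2_least:
  assumes "subgroup K G" "closedin T K" "\<And>g. g \<in> carrier G \<Longrightarrow> g \<otimes> g \<in> K"
  shows "G2 \<subseteq> K"
  unfolding G2_unfold
proof (rule closed_subgroup_generated_least[OF assms(1,2)])
  have "inv h \<otimes> inv g \<otimes> h \<otimes> g \<in> K" if "h \<in> carrier G" "g \<in> carrier G" for h g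
    using that by (subst commutator_eq_squares) (auto intro!: subgroup.m_closed[OF assms(1)] assms(3))
  then show "{h \<otimes> h |h. h \<in> carrier G} \<union> {inv h \<otimes> inv g \<otimes> h \<otimes> g |h g. h \<in> carrier G \<and> g \<in> carrier G} \<subseteq> K"
    using assms(3) by auto
qed

lemma G3_squares: "h \<in> G2 \<Longrightarrow> h \<otimes> h \<in> G3"
  and G3_commutators: "h \<in> G2 \<Longrightarrow> g \<in> carrier G \<Longrightarrow> inv h \<otimes> inv g \<otimes> h \<otimes> g \<in> G3"
  and G3_normal: "G3 \<lhd> G"
  and G3_closed: "closedin T G3"
proof -
  let ?S = "{h \<otimes> h | h. h \<in> G2} \<union> {inv h \<otimes> inv g \<otimes> h \<otimes> g | h g. h \<in> G2 \<and> g \<in> carrier G}"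
  have S: "?S \<subseteq> carrier G" using G2_carrier by auto
  note * = closed_subgroup_generated[OF S, folded G3_unfold]
  have sub2: "subgroup G2 G" using G2_normal by (simp add: normal_imp_subgroup)
  have "inv h \<otimes> inv g \<otimes> h \<otimes> g \<in> G2" if "h \<in> G2" "g \<in> carrier G" for h g
    using that G2_carrier
    by (subst commutator_eq_squares) (auto intro!: subgroup.m_closed[OF sub2] G2_squares)
  then have "?S \<subseteq> G2" using G2_squares G2_carrier by auto
  then have "G3 \<subseteq> G2"
    using closed_subgroup_generated_least[OF sub2 G2_closed] by (simp add: G3_unfold)
  show "h \<otimes> h \<in> G3" if "h \<in> G2" using *(3) that by auto
  show com: "inv h \<otimes> inv g \<otimes> h \<otimes> g \<in> G3" if "h \<in> G2" "g \<in> carrier G" for h g using *(3) that by auto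
  show "closedin T G3" by (rule *(2))
  show "G3 \<lhd> G"
    using *(1) com \<open>G3 \<subseteq> G2\<close> by (intro normal_if_commutators) auto
qed

text \<open>
  The elements that \<open>\<phi>\<close> sends to central elements of order at most two form a closed subgroup that
  contains the squares, hence the second term of the series; for such elements the generators of
  the third term are killed by \<open>\<phi>\<close>.
\<close>
lemma G3_subset_open_kernel:
  assumes \<phi>: "group_hom G H \<phi>" and N: "openin T (kernel G H \<phi>)"
    and sq: "\<And>u. u \<in> carrier H \<Longrightarrow> (u \<otimes>\<^bsub>H\<^esub> u) \<otimes>\<^bsub>H\<^esub> (u \<otimes>\<^bsub>H\<^esub> u) = \<one>\<^bsub>H\<^esub>"
    and central: "\<And>u v. u \<in> carrier H \<Longrightarrow> v \<in> carrier H \<Longrightarrow> (u \<otimes>\<^bsub>H\<^esub> u) \<otimes>\<^bsub>H\<^esub> v = v \<otimes>\<^bsub>H\<^esub> (u \<otimes>\<^bsub>H\<^esub> u)"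
  shows "G3 \<subseteq> kernel G H \<phi>"
proof -
  interpret \<phi>: group_hom G H \<phi> by (rule \<phi>)
  let ?Z = "{g \<in> carrier G. \<phi> g \<otimes>\<^bsub>H\<^esub> \<phi> g = \<one>\<^bsub>H\<^esub> \<and> (\<forall>v\<in>carrier H. \<phi> g \<otimes>\<^bsub>H\<^esub> v = v \<otimes>\<^bsub>H\<^esub> \<phi> g)}"
  have Z: "subgroup ?Z G"
  proof (rule subgroupI)
    fix a assume "a \<in> ?Z"
    then have a: "a \<in> carrier G" "\<phi> a \<otimes>\<^bsub>H\<^esub> \<phi> a = \<one>\<^bsub>H\<^esub>" "\<And>v. v \<in> carrier H \<Longrightarrow> \<phi> a \<otimes>\<^bsub>H\<^esub> v = v \<otimes>\<^bsub>H\<^esub> \<phi> a"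
      by blast+
    have "\<phi> (inv a) = \<phi> a" using a(1) \<phi>.H.inv_equality[OF a(2)] by simp
    then show "inv a \<in> ?Z" using \<open>a \<in> ?Z\<close> by simp
  next
    fix a b assume "a \<in> ?Z" "b \<in> ?Z"
    then have a: "a \<in> carrier G" "\<phi> a \<otimes>\<^bsub>H\<^esub> \<phi> a = \<one>\<^bsub>H\<^esub>" "\<And>v. v \<in> carrier H \<Longrightarrow> \<phi> a \<otimes>\<^bsub>H\<^esub> v = v \<otimes>\<^bsub>H\<^esub> \<phi> a"
      and b: "b \<in> carrier G" "\<phi> b \<otimes>\<^bsub>H\<^esub> \<phi> b = \<one>\<^bsub>H\<^esub>" "\<And>v. v \<in> carrier H \<Longrightarrow> \<phi> b \<otimes>\<^bsub>H\<^esub> v = v \<otimes>\<^bsub>H\<^esub> \<phi> b"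
      by blast+
    have "(\<phi> a \<otimes>\<^bsub>H\<^esub> \<phi> b) \<otimes>\<^bsub>H\<^esub> (\<phi> a \<otimes>\<^bsub>H\<^esub> \<phi> b) = \<phi> a \<otimes>\<^bsub>H\<^esub> ((\<phi> b \<otimes>\<^bsub>H\<^esub> \<phi> a) \<otimes>\<^bsub>H\<^esub> \<phi> b)"
      using a(1) b(1) by (simp add: \<phi>.H.m_assoc)
    also have "\<phi> b \<otimes>\<^bsub>H\<^esub> \<phi> a = \<phi> a \<otimes>\<^bsub>H\<^esub> \<phi> b" using a(1) b(1) b(3)[of "\<phi> a"] by simp
    also have "\<phi> a \<otimes>\<^bsub>H\<^esub> ((\<phi> a \<otimes>\<^bsub>H\<^esub> \<phi> b) \<otimes>\<^bsub>H\<^esub> \<phi> b) = (\<phi> a \<otimes>\<^bsub>H\<^esub> \<phi> a) \<otimes>\<^bsub>H\<^esub> (\<phi> b \<otimes>\<^bsub>H\<^esub> \<phi> b)"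
      using a(1) b(1) by (simp add: \<phi>.H.m_assoc)
    finally have 1: "\<phi> (a \<otimes> b) \<otimes>\<^bsub>H\<^esub> \<phi> (a \<otimes> b) = \<one>\<^bsub>H\<^esub>" using a(1,2) b(1,2) by simp
    have 2: "\<phi> (a \<otimes> b) \<otimes>\<^bsub>H\<^esub> v = v \<otimes>\<^bsub>H\<^esub> \<phi> (a \<otimes> b)" if v: "v \<in> carrier H" for v
    proof -
      have "\<phi> a \<otimes>\<^bsub>H\<^esub> \<phi> b \<otimes>\<^bsub>H\<^esub> v = \<phi> a \<otimes>\<^bsub>H\<^esub> (v \<otimes>\<^bsub>H\<^esub> \<phi> b)"
        using a(1) b(1) v by (simp add: \<phi>.H.m_assoc b(3)[OF v])
      also have "\<dots> = v \<otimes>\<^bsub>H\<^esub> \<phi> a \<otimes>\<^bsub>H\<^esub> \<phi> b"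
        using a(1) b(1) v by (simp add: a(3)[OF v] flip: \<phi>.H.m_assoc)
      finally show ?thesis using a(1) b(1) v by (simp add: \<phi>.H.m_assoc)
    qed
    show "a \<otimes> b \<in> ?Z"
      unfolding mem_Collect_eq by (intro conjI ballI 1 2 m_closed a(1) b(1))
  next
    have "\<one> \<in> ?Z" by simp
    then show "?Z \<noteq> {}" by blast
  next
    show "?Z \<subseteq> carrier G" by blast
  qed
  have NZ: "kernel G H \<phi> \<subseteq> ?Z" by (auto simp: kernel_def)
  have subN: "subgroup (kernel G H \<phi>) G" by (rule \<phi>.subgroup_kernel)
  have "G2 \<subseteq> ?Z"
    proof (rule G2_least[OF Z openin_supergroup(2)[OF subN N Z NZ]])
    fix g assume "g \<in> carrier G"
    then show "g \<otimes> g \<in> ?Z"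
      using sq[of "\<phi> g"] central[of "\<phi> g"] unfolding mem_Collect_eq by (metis \<phi>.hom_mult \<phi>.hom_closed m_closed)
  qed
  then have 3: "\<phi> h \<otimes>\<^bsub>H\<^esub> \<phi> h = \<one>\<^bsub>H\<^esub>" "\<And>v. v \<in> carrier H \<Longrightarrow> \<phi> h \<otimes>\<^bsub>H\<^esub> v = v \<otimes>\<^bsub>H\<^esub> \<phi> h" if "h \<in> G2" for h
    using that by blast+
  have "inv h \<otimes> inv g \<otimes> h \<otimes> g \<in> kernel G H \<phi>" if h: "h \<in> G2" and g: "g \<in> carrier G" for h g
  proof -
    have hG: "h \<in> carrier G" using G2_carrier[OF h] .
    have "\<phi> (inv h \<otimes> inv g \<otimes> h \<otimes> g) = inv\<^bsub>H\<^esub> \<phi> h \<otimes>\<^bsub>H\<^esub> inv\<^bsub>H\<^esub> \<phi> g \<otimes>\<^bsub>H\<^esub> (\<phi> h \<otimes>\<^bsub>H\<^esub> \<phi> g)"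
      using hG g by (simp add: \<phi>.H.m_assoc)
    also have "\<dots> = inv\<^bsub>H\<^esub> \<phi> h \<otimes>\<^bsub>H\<^esub> inv\<^bsub>H\<^esub> \<phi> g \<otimes>\<^bsub>H\<^esub> (\<phi> g \<otimes>\<^bsub>H\<^esub> \<phi> h)"
      using 3(2)[OF h, of "\<phi> g"] hG g by simp
    also have "\<dots> = \<one>\<^bsub>H\<^esub>"
      using hG g by (simp flip: \<phi>.H.inv_mult_group)
    finally show ?thesis using hG g by (simp add: kernel_def)
  qed
  moreover have "h \<otimes> h \<in> kernel G H \<phi>" if h: "h \<in> G2" for h
    using 3(1)[OF h] G2_carrier[OF h] by (simp add: kernel_def)
  ultimately show ?thesis
    unfolding G3_unfold
    by (intro closed_subgroup_generated_least[OF subN openin_supergroup(2)[OF subN N subN]]) auto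
qed

end

section \<open>The easy inclusion\<close>

lemma dihedral4_simps:
  "carrier dihedral4 = {0..<4} \<times> {0..<2}"
  "(i, j) \<otimes>\<^bsub>dihedral4\<^esub> (k, l) = ((if j = 0 then i + k else i - k) mod 4, (j + l) mod 2)"
  "\<one>\<^bsub>dihedral4\<^esub> = (0, 0)"
  by (simp_all add: dihedral4_def)

lemma group_dihedral4: "group dihedral4"
proof (rule groupI)
  fix x y z assume "x \<in> carrier dihedral4" "y \<in> carrier dihedral4" "z \<in> carrier dihedral4"
  moreover have "(j + l) mod 2 = (0::int) \<longleftrightarrow> j = l" if "j \<in> {0..<2}" "l \<in> {0..<2}" for j l
    using that by (auto simp: atLeastLessThan_def) presburger+
  ultimately show "(x \<otimes>\<^bsub>dihedral4\<^esub> y) \<otimes>\<^bsub>dihedral4\<^esub> z = x \<otimes>\<^bsub>dihedral4\<^esub> (y \<otimes>\<^bsub>dihedral4\<^esub> z)"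
    by (cases x; cases y; cases z) (auto simp: dihedral4_simps mod_simps algebra_simps)
next
  fix x assume x: "x \<in> carrier dihedral4"
  obtain i j where ij: "x = (i, j)" "0 \<le> i" "i < 4" "0 \<le> j" "j < 2"
    using x by (cases x) (auto simp: dihedral4_simps)
  show "\<exists>y\<in>carrier dihedral4. y \<otimes>\<^bsub>dihedral4\<^esub> x = \<one>\<^bsub>dihedral4\<^esub>"
  proof (cases "j = 0")
    case True
    with ij show ?thesis
      by (intro bexI[of _ "((- i) mod 4, 0)"]) (auto simp: dihedral4_simps mod_simps)
  next
    case False
    with ij have "j = 1" by simp
    with ij show ?thesis
      by (intro bexI[of _ x]) (auto simp: dihedral4_simps)
  qed
qed (auto simp: dihedral4_simps)

lemma dihedral4_squares:
  assumes "u \<in> carrier dihedral4" "v \<in> carrier dihedral4"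
  shows "(u \<otimes>\<^bsub>dihedral4\<^esub> u) \<otimes>\<^bsub>dihedral4\<^esub> (u \<otimes>\<^bsub>dihedral4\<^esub> u) = \<one>\<^bsub>dihedral4\<^esub>"
    and "(u \<otimes>\<^bsub>dihedral4\<^esub> u) \<otimes>\<^bsub>dihedral4\<^esub> v = v \<otimes>\<^bsub>dihedral4\<^esub> (u \<otimes>\<^bsub>dihedral4\<^esub> u)"
proof -
  obtain i j k l where [simp]: "u = (i, j)" "v = (k, l)" by (cases u, cases v)
  have sq: "u \<otimes>\<^bsub>dihedral4\<^esub> u = ((if j = 0 then 2 * i else 0) mod 4, 0)"
    using assms(1) by (auto simp: dihedral4_simps)
  have "(2 * i + k) mod 4 = (k - 2 * i + 4 * i) mod 4" by (rule arg_cong[where f = "\<lambda>x. x mod 4"]) linarith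
  also have "\<dots> = (k - 2 * i) mod 4" by (rule mod_mult_self2)
  finally have "((2 * i) mod 4 + k) mod 4 = (k - (2 * i) mod 4) mod 4" by (simp add: mod_simps)
  then show "(u \<otimes>\<^bsub>dihedral4\<^esub> u) \<otimes>\<^bsub>dihedral4\<^esub> (u \<otimes>\<^bsub>dihedral4\<^esub> u) = \<one>\<^bsub>dihedral4\<^esub>"
    and "(u \<otimes>\<^bsub>dihedral4\<^esub> u) \<otimes>\<^bsub>dihedral4\<^esub> v = v \<otimes>\<^bsub>dihedral4\<^esub> (u \<otimes>\<^bsub>dihedral4\<^esub> u)"
    unfolding sq using assms(2) by (auto simp: dihedral4_simps add.commute mod_simps)
qed

lemma integer_mod_group4_squares:
  assumes "u \<in> carrier (integer_mod_group 4)" "v \<in> carrier (integer_mod_group 4)"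
  shows "(u \<otimes>\<^bsub>integer_mod_group 4\<^esub> u) \<otimes>\<^bsub>integer_mod_group 4\<^esub> (u \<otimes>\<^bsub>integer_mod_group 4\<^esub> u) = \<one>\<^bsub>integer_mod_group 4\<^esub>"
    and "(u \<otimes>\<^bsub>integer_mod_group 4\<^esub> u) \<otimes>\<^bsub>integer_mod_group 4\<^esub> v = v \<otimes>\<^bsub>integer_mod_group 4\<^esub> (u \<otimes>\<^bsub>integer_mod_group 4\<^esub> u)"
proof -
  show "(u \<otimes>\<^bsub>integer_mod_group 4\<^esub> u) \<otimes>\<^bsub>integer_mod_group 4\<^esub> (u \<otimes>\<^bsub>integer_mod_group 4\<^esub> u) = \<one>\<^bsub>integer_mod_group 4\<^esub>"
    by (simp add: mod_simps)
  show "(u \<otimes>\<^bsub>integer_mod_group 4\<^esub> u) \<otimes>\<^bsub>integer_mod_group 4\<^esub> v = v \<otimes>\<^bsub>integer_mod_group 4\<^esub> (u \<otimes>\<^bsub>integer_mod_group 4\<^esub> u)"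
    by (simp add: add.commute)
qed

lemma (in normal) group_hom_factor_iso:
  assumes "h \<in> iso (G Mod H) K" "group K"
  shows "group_hom G K (\<lambda>g. h (H #> g))" "kernel G K (\<lambda>g. h (H #> g)) = H"
proof -
  interpret h: group_hom "G Mod H" K h
    using assms factorgroup_is_group by (simp add: group_hom_def group_hom_axioms_def iso_def)
  have "(\<lambda>g. h (H #> g)) \<in> hom G K"
    using r_coset_hom_Mod h.homh by (auto simp: hom_def Pi_iff)
  then show "group_hom G K (\<lambda>g. h (H #> g))"
    using assms(2) by (simp add: group_hom_def group_hom_axioms_def is_group)
  have inj: "inj_on h (carrier (G Mod H))" using assms(1) by (simp add: iso_def bij_betw_def)
  have "h (H #> g) = \<one>\<^bsub>K\<^esub> \<longleftrightarrow> g \<in> H" if g: "g \<in> carrier G" for g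
  proof -
    have m: "H #> g \<in> carrier (G Mod H)" "H \<in> carrier (G Mod H)"
      using g factorgroup_is_group group.is_monoid monoid.one_closed[of "G Mod H"] by (auto simp: carrier_FactGroup)
    have "h (H #> g) = \<one>\<^bsub>K\<^esub> \<longleftrightarrow> h (H #> g) = h H"
      using h.hom_one by simp
    also have "\<dots> \<longleftrightarrow> H #> g = H" using inj m by (simp add: inj_on_eq_iff)
    also have "\<dots> \<longleftrightarrow> g \<in> H" using g coset_join1 coset_join2 is_subgroup by blast
    finally show ?thesis .
  qed
  then show "kernel G K (\<lambda>g. h (H #> g)) = H"
    using subset by (auto simp: kernel_def)
qed

context profinite
begin

lemma G3_subset_admissible:
  assumes "N \<lhd> G" "openin T N"
    and "trivial_group (G Mod N) \<or> G Mod N \<cong> integer_mod_group 4 \<or> G Mod N \<cong> dihedral4"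
  shows "G3 \<subseteq> N"
proof -
  interpret N: normal N G by (rule assms(1))
  consider "trivial_group (G Mod N)" | h where "h \<in> iso (G Mod N) (integer_mod_group 4)"
    | h where "h \<in> iso (G Mod N) dihedral4"
    using assms(3) by (auto simp: is_iso_def)
  then show ?thesis
  proof cases
    case 1
    have "id \<in> iso (G Mod N) (G Mod N)" by (simp add: iso_def hom_def bij_betw_def)
    note h = N.group_hom_factor_iso[OF this N.factorgroup_is_group]
    have "u = \<one>\<^bsub>G Mod N\<^esub>" if "u \<in> carrier (G Mod N)" for u
      using 1 that by (auto simp: trivial_group_def)
    then show ?thesis
      using G3_subset_open_kernel[OF h(1)] h(2) assms(2) N.factorgroup_is_group
      by (metis group.is_monoid monoid.m_closed monoid.one_closed)
  next
    case 2
    note h = N.group_hom_factor_iso[OF this group_integer_mod_group]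
    show ?thesis
      using G3_subset_open_kernel[OF h(1)] h(2) assms(2) integer_mod_group4_squares by metis
  next
    case 3
    note h = N.group_hom_factor_iso[OF this group_dihedral4]
    show ?thesis
      using G3_subset_open_kernel[OF h(1)] h(2) assms(2) dihedral4_squares by metis
  qed
qed

end

section \<open>Finite groups whose squares lie in a central subgroup of order two\<close>

locale central_involution = group +
  fixes z
  assumes z_closed [simp]: "z \<in> carrier G" and z_nontrivial: "z \<noteq> \<one>" and z_square: "z \<otimes> z = \<one>"
    and z_central: "g \<in> carrier G \<Longrightarrow> z \<otimes> g = g \<otimes> z"
    and squares: "g \<in> carrier G \<Longrightarrow> g \<otimes> g \<in> {\<one>, z}"
begin

definition z_power :: "int \<Rightarrow> 'a" where
  "z_power k = (if even k then \<one> else z)"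

lemma z_power_closed [simp]: "z_power k \<in> carrier G"
  by (simp add: z_power_def)

lemma z_power_add: "z_power (j + k) = z_power j \<otimes> z_power k"
  by (auto simp: z_power_def z_square)

lemma z_power_eq_iff: "z_power j = z_power k \<longleftrightarrow> even (j + k)"
  using z_nontrivial by (auto simp: z_power_def)

lemma z_power_central: "g \<in> carrier G \<Longrightarrow> z_power k \<otimes> g = g \<otimes> z_power k"
  by (simp add: z_power_def z_central)

text \<open>
  The exponent of \<open>z\<close> in the commutator of \<open>x\<close> and \<open>g\<close>; it is a homomorphism in \<open>g\<close> because
  commutators are central.
\<close>
definition commutation :: "'a \<Rightarrow> 'a \<Rightarrow> int" where
  "commutation x g = (if x \<otimes> g = g \<otimes> x then 0 else 1)"

lemma commutation:
  assumes "x \<in> carrier G" "g \<in> carrier G"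
  shows "x \<otimes> g = g \<otimes> x \<otimes> z_power (commutation x g)"
proof -
  have "inv x \<otimes> inv g \<otimes> x \<otimes> g \<in> {\<one>, z}"
  proof -
    have mult: "u \<otimes> v \<in> {\<one>, z}" if "u \<in> {\<one>, z}" "v \<in> {\<one>, z}" for u v
      using that by (auto simp: z_square)
    show ?thesis
      unfolding commutator_eq_squares[OF assms] by (intro mult squares) (use assms in auto)
  qed
  moreover have "(g \<otimes> x) \<otimes> (inv x \<otimes> inv g \<otimes> x \<otimes> g) = x \<otimes> g"
  proof -
    have "x \<otimes> (inv x \<otimes> w) = w" "g \<otimes> (inv g \<otimes> w) = w" if "w \<in> carrier G" for w
      using assms that by (simp_all flip: m_assoc)
    then show ?thesis using assms by (simp add: m_assoc)
  qed
  ultimately show ?thesis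
    using assms by (auto simp: commutation_def z_power_def)
qed

lemma commutation_mult:
  assumes "x \<in> carrier G" "g \<in> carrier G" "h \<in> carrier G"
  shows "commutation x (g \<otimes> h) = (commutation x g + commutation x h) mod 2"
proof -
  have "(g \<otimes> h \<otimes> x) \<otimes> z_power (commutation x (g \<otimes> h)) = x \<otimes> (g \<otimes> h)"
    using commutation[of x "g \<otimes> h"] assms by simp
  also have "\<dots> = (x \<otimes> g) \<otimes> h"
    using assms by (simp add: m_assoc)
  also have "\<dots> = (g \<otimes> x \<otimes> z_power (commutation x g)) \<otimes> h"
    using commutation[of x g] assms by simp
  also have "\<dots> = g \<otimes> (x \<otimes> h) \<otimes> z_power (commutation x g)"
    using assms by (simp add: m_assoc z_power_central)
  also have "\<dots> = g \<otimes> (h \<otimes> x \<otimes> z_power (commutation x h)) \<otimes> z_power (commutation x g)"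
    using commutation[of x h] assms by simp
  also have "\<dots> = (g \<otimes> h \<otimes> x) \<otimes> z_power (commutation x h + commutation x g)"
    using assms by (simp add: m_assoc z_power_add)
  finally have "even (commutation x (g \<otimes> h) + (commutation x h + commutation x g))"
    using assms by (simp add: z_power_eq_iff)
  then show ?thesis
    by (auto simp: commutation_def split: if_splits)
qed

text \<open>
  Characters that vanish at \<open>z\<close> vanish on all squares and commutators; this is what allows them to be
  extended to larger subgroups.
\<close>
definition character_on :: "'a set \<Rightarrow> ('a \<Rightarrow> int) \<Rightarrow> bool" where
  "character_on R a \<longleftrightarrow> (\<forall>g\<in>R. a g \<in> {0, 1}) \<and> a z = 0 \<and> (\<forall>g\<in>R. \<forall>h\<in>R. a (g \<otimes> h) = (a g + a h) mod 2)"

text \<open>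
  Since \<open>F\<close> takes values modulo \<open>2\<close>, the last conjunct says that the coboundary of \<open>F\<close> is the sum
  of the cup products of the pairs in \<open>ps\<close>.
\<close>
definition bilinear_coboundary_on :: "'a set \<Rightarrow> ('a \<Rightarrow> int) \<Rightarrow> (('a \<Rightarrow> int) \<times> ('a \<Rightarrow> int)) list \<Rightarrow> bool" where
  "bilinear_coboundary_on R F ps \<longleftrightarrow>
     (\<forall>g\<in>R. F g \<in> {0, 1}) \<and> F z = 1 \<and> (\<forall>(a, b)\<in>set ps. character_on R a \<and> character_on R b) \<and>
     (\<forall>g\<in>R. \<forall>h\<in>R. F (g \<otimes> h) = (F g + F h + (\<Sum>(a, b)\<leftarrow>ps. a g * b h)) mod 2)"

lemma character_on_z_power:
  assumes "character_on R a" "z \<in> R" "g \<in> R" "subgroup R G"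
  shows "a (g \<otimes> z_power k) = a g"
proof -
  have "a g \<in> {0, 1}" "a (g \<otimes> z) = (a g + 0) mod 2"
    using assms by (auto simp: character_on_def)
  then show ?thesis using subgroup.mem_carrier[OF assms(4,3)] by (auto simp: z_power_def)
qed

lemma bilinear_coboundary_on_z_power:
  assumes "bilinear_coboundary_on R F ps" "z \<in> R" "g \<in> R" "subgroup R G"
  shows "F (g \<otimes> z_power k) = (F g + k) mod 2"
proof -
  have "(\<Sum>(a, b)\<leftarrow>ps. a g * b z) = (\<Sum>p\<leftarrow>ps. 0)"
    using assms(1) by (intro arg_cong[where f = sum_list] map_cong)
      (auto simp: bilinear_coboundary_on_def character_on_def)
  then have "F g \<in> {0, 1}" "F (g \<otimes> z) = (F g + 1) mod 2"
    using assms(1-3) by (auto simp: bilinear_coboundary_on_def)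
  then show ?thesis 
    using subgroup.mem_carrier[OF assms(4,3)] by (auto simp: z_power_def elim!: evenE oddE)
qed

text \<open>
  The induction step from \<open>R\<close> to \<open>R \<union> R x\<close>. Extend \<open>F\<close> and the characters along the projection
  \<open>\<rho> (r x\<^sup>e) = r\<close>. Moving \<open>x\<close> past \<open>s\<close> costs the commutator of \<open>x\<close> and \<open>s\<close>, and \<open>x\<^sup>2\<close> is a power
  \<open>z\<^sup>\<epsilon>\<close>; so the new coboundary has one further product \<open>\<psi> \<union> c\<close>, where \<open>\<psi>\<close> is the character with
  kernel \<open>R\<close> and \<open>c\<close> is the sum of the commutator character of \<open>x\<close> and \<open>\<epsilon> \<psi>\<close>.
\<close>
lemma bilinear_coboundary_extend:
  assumes R: "subgroup R G" "z \<in> R" and F: "bilinear_coboundary_on R F ps"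
    and x: "x \<in> carrier G" "x \<notin> R"
  shows "\<exists>R' F' ps'. subgroup R' G \<and> R \<subset> R' \<and> bilinear_coboundary_on R' F' ps'"
proof -
  define R' where "R' = R \<union> (\<lambda>r. r \<otimes> x) ` R"
  define \<rho> where "\<rho> = (\<lambda>g. if g \<in> R then g else g \<otimes> inv x)"
  define \<psi> :: "'a \<Rightarrow> int" where "\<psi> = (\<lambda>g. if g \<in> R then 0 else 1)"
  define \<epsilon> :: int where "\<epsilon> = (if x \<otimes> x = \<one> then 0 else 1)"
  define c where "c = (\<lambda>h. (commutation x h + \<epsilon> * \<psi> h) mod 2)"
  have \<epsilon>: "x \<otimes> x = z_power \<epsilon>"
    using squares[OF x(1)] by (auto simp: \<epsilon>_def z_power_def)
  have RG: "\<And>r. r \<in> R \<Longrightarrow> r \<in> carrier G" using subgroup.mem_carrier[OF R(1)] .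
  have mR: "\<And>r s. r \<in> R \<Longrightarrow> s \<in> R \<Longrightarrow> r \<otimes> s \<in> R" using subgroup.m_closed[OF R(1)] .
  have zR: "z_power k \<in> R" for k using R by (simp add: z_power_def subgroup.one_closed)
  have notin: "r \<otimes> x \<notin> R" if r: "r \<in> R" for r
  proof
    assume "r \<otimes> x \<in> R"
    then have "inv r \<otimes> (r \<otimes> x) \<in> R" using r R(1) by (simp add: subgroup.m_closed subgroup.m_inv_closed)
    then show False using x RG[OF r] by (simp flip: m_assoc)
  qed
  have on_R: "\<rho> r = r" "\<psi> r = 0" if "r \<in> R" for r using that by (simp_all add: \<rho>_def \<psi>_def)
  have on_Rx: "\<rho> (r \<otimes> x) = r" "\<psi> (r \<otimes> x) = 1" if "r \<in> R" for r
    using notin[OF that] RG[OF that] x by (simp_all add: \<rho>_def \<psi>_def m_assoc)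
  have \<rho>_R: "\<rho> g \<in> R" if "g \<in> R'" for g using that on_R on_Rx by (auto simp: R'_def)
  have R'G: "g \<in> carrier G" if "g \<in> R'" for g using that RG x by (auto simp: R'_def)
  have prods: "(r \<otimes> x) \<otimes> s = (r \<otimes> s \<otimes> z_power (commutation x s)) \<otimes> x"
     "(r \<otimes> x) \<otimes> (s \<otimes> x) = r \<otimes> s \<otimes> z_power (commutation x s + \<epsilon>)"
    if "r \<in> R" "s \<in> R" for r s
  proof -
    have rs: "r \<in> carrier G" "s \<in> carrier G" using that RG by auto
    have "(r \<otimes> x) \<otimes> s = r \<otimes> (s \<otimes> x \<otimes> z_power (commutation x s))"
      using rs x commutation[of x s] by (simp add: m_assoc)
    also have "\<dots> = (r \<otimes> s \<otimes> z_power (commutation x s)) \<otimes> x"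
      using rs x by (simp add: m_assoc z_power_central)
    finally show 1: "(r \<otimes> x) \<otimes> s = (r \<otimes> s \<otimes> z_power (commutation x s)) \<otimes> x" .
    have "(r \<otimes> x) \<otimes> (s \<otimes> x) = ((r \<otimes> x) \<otimes> s) \<otimes> x" using rs x by (simp add: m_assoc)
    also have "\<dots> = r \<otimes> s \<otimes> (z_power (commutation x s) \<otimes> (x \<otimes> x))"
      using rs x by (simp add: 1 m_assoc)
    finally show "(r \<otimes> x) \<otimes> (s \<otimes> x) = r \<otimes> s \<otimes> z_power (commutation x s + \<epsilon>)"
      by (simp add: \<epsilon> z_power_add)
  qed
  have com_Rx: "commutation x (s \<otimes> x) = commutation x s" if "s \<in> R" for s
    using commutation_mult[OF x(1) RG[OF that] x(1)] by (simp add: commutation_def)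
  \<comment> \<open>The exponent of \<open>z\<close> collects the commutator, if \<open>g \<in> R x\<close>, and \<open>x\<^sup>2\<close>, if also \<open>h \<in> R x\<close>.\<close>
  have key: "g \<otimes> h \<in> R' \<and> \<psi> (g \<otimes> h) = (\<psi> g + \<psi> h) mod 2 \<and>
      \<rho> (g \<otimes> h) = \<rho> g \<otimes> \<rho> h \<otimes> z_power (\<psi> g * c h)" if "g \<in> R'" "h \<in> R'" for g h
  proof -
    have zp: "z_power (k mod 2) = z_power k" for k by (simp add: z_power_eq_iff)
    consider "g \<in> R" "h \<in> R" | s where "g \<in> R" "s \<in> R" "h = s \<otimes> x"
      | r where "r \<in> R" "g = r \<otimes> x" "h \<in> R" | r s where "r \<in> R" "s \<in> R" "g = r \<otimes> x" "h = s \<otimes> x"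
      using \<open>g \<in> R'\<close> \<open>h \<in> R'\<close> unfolding R'_def by blast
    then show ?thesis
    proof cases
      case 1
      then show ?thesis using mR RG by (auto simp: R'_def on_R z_power_def)
    next
      case 2
      then have "g \<otimes> h = (g \<otimes> s) \<otimes> x" using x RG by (simp add: m_assoc)
      with 2 show ?thesis using mR RG by (auto simp: R'_def on_R on_Rx z_power_def)
    next
      case 3
      have "r \<otimes> h \<otimes> z_power (commutation x h) \<in> R" using 3 mR zR by blast
      then show ?thesis using 3 prods(1)[OF 3(1,3)] by (auto simp: R'_def on_R on_Rx c_def zp)
    next
      case 4
      have "r \<otimes> s \<otimes> z_power (commutation x s + \<epsilon>) \<in> R" using 4 mR zR by blast
      then show ?thesis using 4 prods(2)[OF 4(1,2)] by (auto simp: R'_def on_R on_Rx c_def com_Rx zp)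
    qed
  qed
  have "subgroup R' G"
  proof (rule subgroupI)
    fix a assume a: "a \<in> R'"
    have "inv a = a \<otimes> inv (a \<otimes> a)" using R'G[OF a] by (simp add: inv_mult_group flip: m_assoc)
    moreover have *: "inv (a \<otimes> a) \<in> R'"
      using squares[OF R'G[OF a]] R subgroup.m_inv_closed[OF R(1)] subgroup.one_closed[OF R(1)]
      by (auto simp: R'_def)
    ultimately show "inv a \<in> R'" using key[OF a *] by simp
  next
    show "R' \<noteq> {}" using R(2) by (auto simp: R'_def)
  qed (use key R'G in auto)
  moreover have "R \<subset> R'"
  proof -
    have "x \<in> R'" using subgroup.one_closed[OF R(1)] x(1) by (force simp: R'_def)
    then show ?thesis using x by (auto simp: R'_def)
  qed
  moreover have "bilinear_coboundary_on R' (F \<circ> \<rho>) ((\<psi>, c) # map (\<lambda>(a, b). (a \<circ> \<rho>, b \<circ> \<rho>)) ps)"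
    unfolding bilinear_coboundary_on_def
  proof (intro conjI ballI)
    have lift: "character_on R' (a \<circ> \<rho>)" if a: "character_on R a" for a
    proof -
      have "a (\<rho> (g \<otimes> h)) = (a (\<rho> g) + a (\<rho> h)) mod 2" if "g \<in> R'" "h \<in> R'" for g h
        using that key[OF that] \<rho>_R mR character_on_z_power[OF a R(2) _ R(1)] a by (simp add: character_on_def)
      then show ?thesis using a \<rho>_R on_R[OF R(2)] by (simp add: character_on_def)
    qed
    have "character_on R' \<psi>"
      using key on_R[OF R(2)] by (auto simp: character_on_def \<psi>_def)
    moreover have "character_on R' c"
    proof -
      have "commutation x z = 0" using z_central[OF x(1)] by (simp add: commutation_def)
      moreover have "c (g \<otimes> h) = (c g + c h) mod 2" if "g \<in> R'" "h \<in> R'" for g h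
        using key[OF that, THEN conjunct2, THEN conjunct1]
          commutation_mult[OF x(1) R'G[OF that(1)] R'G[OF that(2)]]
        by (cases "x \<otimes> x = \<one>") (simp_all add: c_def \<epsilon>_def mod_simps, presburger)
      moreover have "c g \<in> {0, 1}" for g by (simp add: c_def) presburger
      ultimately show ?thesis using on_R[OF R(2)] by (simp add: character_on_def c_def)
    qed
    ultimately show "case p of (a, b) \<Rightarrow> character_on R' a \<and> character_on R' b"
      if "p \<in> set ((\<psi>, c) # map (\<lambda>(a, b). (a \<circ> \<rho>, b \<circ> \<rho>)) ps)" for p
      using that lift F by (auto simp: bilinear_coboundary_on_def)
    show "(F \<circ> \<rho>) g \<in> {0, 1}" if "g \<in> R'" for g
      using \<rho>_R[OF that] F by (simp add: bilinear_coboundary_on_def)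
    show "(F \<circ> \<rho>) z = 1" using F on_R[OF R(2)] by (simp add: bilinear_coboundary_on_def)
    fix g h assume gh: "g \<in> R'" "h \<in> R'"
    have "(F \<circ> \<rho>) (g \<otimes> h) = (F (\<rho> g \<otimes> \<rho> h) + \<psi> g * c h) mod 2"
      using key[OF gh] bilinear_coboundary_on_z_power[OF F R(2) mR R(1)] \<rho>_R gh by simp
    also have "F (\<rho> g \<otimes> \<rho> h) = (F (\<rho> g) + F (\<rho> h) + (\<Sum>(a, b)\<leftarrow>ps. a (\<rho> g) * b (\<rho> h))) mod 2"
      using F \<rho>_R gh by (simp add: bilinear_coboundary_on_def)
    finally show "(F \<circ> \<rho>) (g \<otimes> h) = ((F \<circ> \<rho>) g + (F \<circ> \<rho>) h +
        (\<Sum>(a, b)\<leftarrow>(\<psi>, c) # map (\<lambda>(a, b). (a \<circ> \<rho>, b \<circ> \<rho>)) ps. a g * b h)) mod 2"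
      by (simp add: mod_simps o_def case_prod_unfold algebra_simps)
  qed
  ultimately show ?thesis by blast
qed

text \<open>
  Start with the subgroup \<open>{1, z}\<close>, where the indicator of \<open>z\<close> is a homomorphism.
\<close>
theorem bilinear_coboundary_exists:
  assumes "finite (carrier G)"
  obtains F ps where "bilinear_coboundary_on (carrier G) F ps"
proof -
  define \<A> where "\<A> = {R. subgroup R G \<and> z \<in> R \<and> (\<exists>F ps. bilinear_coboundary_on R F ps)}"
  have "subgroup {\<one>, z} G"
    using inv_equality[OF z_square] by (intro subgroupI) (auto simp: z_square)
  moreover have "bilinear_coboundary_on {\<one>, z} (\<lambda>g. if g = z then 1 else 0) []"
    using z_nontrivial by (auto simp: bilinear_coboundary_on_def z_square)
  ultimately have "{\<one>, z} \<in> \<A>" by (auto simp: \<A>_def)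
  moreover have "finite \<A>"
    using assms subgroup.subset by (intro finite_subset[of \<A> "Pow (carrier G)"]) (auto simp: \<A>_def)
  ultimately obtain R where R: "R \<in> \<A>" "\<And>R'. R' \<in> \<A> \<Longrightarrow> R \<subseteq> R' \<Longrightarrow> R = R'"
    using finite_has_maximal by (metis empty_iff)
  have "R = carrier G"
  proof (rule ccontr)
    assume "R \<noteq> carrier G"
    then obtain x where x: "x \<in> carrier G" "x \<notin> R"
      using R(1) subgroup.subset by (auto simp: \<A>_def)
    from R(1) obtain F ps where "subgroup R G" "z \<in> R" "bilinear_coboundary_on R F ps"
      by (auto simp: \<A>_def)
    from bilinear_coboundary_extend[OF this x] R(2) \<open>z \<in> R\<close> show False
      unfolding \<A>_def by blast
  qed
  with R(1) that show thesis by (auto simp: \<A>_def)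
qed

end

section \<open>Groups of continuous functions\<close>

lemma continuous_map_discrete_combine:
  assumes "continuous_map X (discrete_topology A) f" "continuous_map X (discrete_topology B) g"
    and "\<And>a b. a \<in> A \<Longrightarrow> b \<in> B \<Longrightarrow> op a b \<in> D"
  shows "continuous_map X (discrete_topology D) (\<lambda>x. op (f x) (g x))"
proof -
  have "continuous_map X (discrete_topology (A \<times> B)) (\<lambda>x. (f x, g x))"
    using assms(1,2) by (simp add: prod_topology_discrete_topology continuous_map_paired)
  moreover have "continuous_map (discrete_topology (A \<times> B)) (discrete_topology D) (\<lambda>(a, b). op a b)"
    using assms(3) by auto
  ultimately have "continuous_map X (discrete_topology D) ((\<lambda>(a, b). op a b) \<circ> (\<lambda>x. (f x, g x)))"
    by (rule continuous_map_compose)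
  then show ?thesis by (simp add: o_def)
qed

lemma continuous_functions_group_simps [simp]:
  "f \<otimes>\<^bsub>continuous_functions_group X A\<^esub> g = (\<lambda>x\<in>topspace X. f x \<otimes>\<^bsub>A\<^esub> g x)"
  "\<one>\<^bsub>continuous_functions_group X A\<^esub> = (\<lambda>x\<in>topspace X. \<one>\<^bsub>A\<^esub>)"
  by (simp_all add: continuous_functions_group_def)

lemma carrier_continuous_functions_group:
  "f \<in> carrier (continuous_functions_group X A) \<longleftrightarrow>
     f \<in> extensional (topspace X) \<and> continuous_map X (discrete_topology (carrier A)) f"
  using continuous_map_funspace[of X "discrete_topology (carrier A)" f]
  by (auto simp: continuous_functions_group_def PiE_def)

lemma comm_group_continuous_functions_group:
  assumes "comm_group A"
  shows "comm_group (continuous_functions_group X A)"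
proof -
  interpret A: comm_group A by (rule assms)
  have val: "f x \<in> carrier A" if "f \<in> carrier (continuous_functions_group X A)" "x \<in> topspace X" for f x
    using that continuous_map_image_subset_topspace[of X "discrete_topology (carrier A)" f]
    by (auto simp: carrier_continuous_functions_group)
  show ?thesis
  proof (rule comm_groupI)
    fix f g assume fg: "f \<in> carrier (continuous_functions_group X A)" "g \<in> carrier (continuous_functions_group X A)"
    then show "f \<otimes>\<^bsub>continuous_functions_group X A\<^esub> g \<in> carrier (continuous_functions_group X A)"
      by (auto simp: carrier_continuous_functions_group restrict_continuous_map
          intro: continuous_map_discrete_combine)
    show "f \<otimes>\<^bsub>continuous_functions_group X A\<^esub> g = g \<otimes>\<^bsub>continuous_functions_group X A\<^esub> f"
      using val fg by (auto simp: A.m_comm)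
  next
    show "\<one>\<^bsub>continuous_functions_group X A\<^esub> \<in> carrier (continuous_functions_group X A)"
      by (simp add: carrier_continuous_functions_group restrict_continuous_map)
  next
    fix f g h assume "f \<in> carrier (continuous_functions_group X A)" "g \<in> carrier (continuous_functions_group X A)"
      "h \<in> carrier (continuous_functions_group X A)"
    then show "f \<otimes>\<^bsub>continuous_functions_group X A\<^esub> g \<otimes>\<^bsub>continuous_functions_group X A\<^esub> h =
       f \<otimes>\<^bsub>continuous_functions_group X A\<^esub> (g \<otimes>\<^bsub>continuous_functions_group X A\<^esub> h)"
      using val by (auto simp: A.m_assoc)
  next
    fix f assume f: "f \<in> carrier (continuous_functions_group X A)"
    then show "\<one>\<^bsub>continuous_functions_group X A\<^esub> \<otimes>\<^bsub>continuous_functions_group X A\<^esub> f = f"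
      using val[OF f] by (auto simp: carrier_continuous_functions_group extensional_def)
    have "continuous_map X (discrete_topology (carrier A)) (\<lambda>x. inv\<^bsub>A\<^esub> f x)"
      using f continuous_map_discrete_combine[of X "carrier A" f "carrier A" f "\<lambda>a b. inv\<^bsub>A\<^esub> a"]
      by (auto simp: carrier_continuous_functions_group)
    then show "\<exists>g\<in>carrier (continuous_functions_group X A).
       g \<otimes>\<^bsub>continuous_functions_group X A\<^esub> f = \<one>\<^bsub>continuous_functions_group X A\<^esub>"
      using val[OF f] 
      by (intro bexI[of _ "\<lambda>x\<in>topspace X. inv\<^bsub>A\<^esub> f x"])
        (auto simp: carrier_continuous_functions_group restrict_continuous_map intro!: restrict_ext)
  qed
qed

section \<open>Tensor products of abelian groups\<close>

lemma tensor_relations_subset: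
  fixes A :: "('a, 'm) monoid_scheme" and B :: "('b, 'n) monoid_scheme"
  assumes "group A" "group B"
  shows "tensor_relations A B \<subseteq> carrier (free_Abelian_group (carrier A \<times> carrier B))"
proof -
  interpret A: group A by fact
  interpret B: group B by fact
  have d: "x - y - z \<in> carrier (free_Abelian_group S)" 
    if "x \<in> carrier (free_Abelian_group S)" "y \<in> carrier (free_Abelian_group S)" "z \<in> carrier (free_Abelian_group S)" 
    for x y z and S :: "('a \<times> 'b) set"
    using that keys_diff[of x y] keys_diff[of "x - y" z] unfolding carrier_free_Abelian_group_iff by blast
  show ?thesis
    unfolding tensor_relations_def by (auto intro!: d simp del: carrier_free_Abelian_group_iff)
qed

lemma tensor_null_normal:
  assumes "group A" "group B"
  shows "tensor_null A B \<lhd> free_Abelian_group (carrier A \<times> carrier B)"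
  unfolding tensor_null_def
  using tensor_relations_subset[OF assms] group_free_Abelian_group
  by (intro comm_group.normal_iff_subgroup[THEN iffD2] abelian_free_Abelian_group group.generate_is_subgroup)

lemma group_tensor_product:
  assumes "group A" "group B"
  shows "group (tensor_product A B)"
  using normal.factorgroup_is_group[OF tensor_null_normal[OF assms]] by (simp add: tensor_product_def)

lemma pure_tensor_closed:
  assumes "a \<in> carrier A" "b \<in> carrier B"
  shows "pure_tensor A B a b \<in> carrier (tensor_product A B)"
  using assms by (auto simp: pure_tensor_def tensor_product_def carrier_FactGroup intro!: imageI)

text \<open>
  The tensor product is defined by generators and relations, and a homomorphism from the free abelian
  group kills the relations exactly if it is bilinear on the generators.
\<close>
lemma tensor_product_universal:
  assumes "group A" "group B" "comm_group C"
    and closed: "\<And>a b. a \<in> carrier A \<Longrightarrow> b \<in> carrier B \<Longrightarrow> f a b \<in> carrier C"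
    and left: "\<And>a a' b. a \<in> carrier A \<Longrightarrow> a' \<in> carrier A \<Longrightarrow> b \<in> carrier B \<Longrightarrow>
       f (a \<otimes>\<^bsub>A\<^esub> a') b = f a b \<otimes>\<^bsub>C\<^esub> f a' b"
    and right: "\<And>a b b'. a \<in> carrier A \<Longrightarrow> b \<in> carrier B \<Longrightarrow> b' \<in> carrier B \<Longrightarrow>
       f a (b \<otimes>\<^bsub>B\<^esub> b') = f a b \<otimes>\<^bsub>C\<^esub> f a b'"
  obtains u where "u \<in> hom (tensor_product A B) C"
    "\<And>a b. a \<in> carrier A \<Longrightarrow> b \<in> carrier B \<Longrightarrow> u (pure_tensor A B a b) = f a b"
proof -
  interpret A: group A by fact
  interpret B: group B by fact
  interpret C: comm_group C by fact
  define F where "F = free_Abelian_group (carrier A \<times> carrier B)"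
  have "(\<lambda>x. f (fst x) (snd x)) ` (carrier A \<times> carrier B) \<subseteq> carrier C" using closed by auto
  from C.free_Abelian_group_universal[OF this]
  obtain h where h: "h \<in> hom F C" "\<And>x. x \<in> carrier A \<times> carrier B \<Longrightarrow> h (frag_of x) = f (fst x) (snd x)"
    unfolding F_def by blast
  interpret h: group_hom F C h
    using h(1) by (simp add: group_hom_def group_hom_axioms_def F_def)
  have rel: "frag_of p - frag_of q - frag_of r = frag_of p \<otimes>\<^bsub>F\<^esub> inv\<^bsub>F\<^esub> (frag_of q \<otimes>\<^bsub>F\<^esub> frag_of r)"
    "frag_of q \<in> carrier F" "frag_of r \<in> carrier F" "frag_of p \<in> carrier F"
    if "q \<in> carrier A \<times> carrier B" "r \<in> carrier A \<times> carrier B" "p \<in> carrier A \<times> carrier B" for p q r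
  proof -
    have "frag_of q + frag_of r \<in> carrier F"
      using that keys_add[of "frag_of q" "frag_of r"] by (auto simp: F_def carrier_free_Abelian_group_iff)
    then have "Poly_Mapping.keys (frag_of q + frag_of r) \<subseteq> carrier A \<times> carrier B" by (simp add: F_def)
    then show "frag_of p - frag_of q - frag_of r = frag_of p \<otimes>\<^bsub>F\<^esub> inv\<^bsub>F\<^esub> (frag_of q \<otimes>\<^bsub>F\<^esub> frag_of r)"
      by (simp add: F_def)
  qed (use that in \<open>auto simp: F_def\<close>)
  have h_rel: "h (frag_of p - frag_of q - frag_of r) = \<one>\<^bsub>C\<^esub>" 
    if "q \<in> carrier A \<times> carrier B" "r \<in> carrier A \<times> carrier B" "p \<in> carrier A \<times> carrier B"
      "f (fst p) (snd p) = f (fst q) (snd q) \<otimes>\<^bsub>C\<^esub> f (fst r) (snd r)" for p q r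
    using that rel[OF that(1-3)] closed by (auto simp: h(2) simp del: C.inv_mult_group)
  have "h w = \<one>\<^bsub>C\<^esub>" if "w \<in> tensor_relations A B" for w
    using that by (auto simp: tensor_relations_def left right intro!: h_rel)
  then have "tensor_relations A B \<subseteq> kernel F C h"
    using tensor_relations_subset[OF assms(1,2)] by (auto simp: kernel_def F_def[symmetric])
  then have "tensor_null A B \<subseteq> kernel F C h"
    unfolding tensor_null_def F_def[symmetric]
    by (intro h.generate_subgroup_incl h.subgroup_kernel)
  with h.FactGroup_universal_kernel tensor_null_normal[OF assms(1,2)]
  obtain u where "u \<in> hom (F Mod tensor_null A B) C" 
    "\<And>x. x \<in> carrier F \<Longrightarrow> u (tensor_null A B #>\<^bsub>F\<^esub> x) = h x"
    unfolding F_def by metis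
  note u = this
  show thesis
  proof (rule that)
    show "u \<in> hom (tensor_product A B) C" using u(1) by (simp add: tensor_product_def F_def)
    fix a b assume ab: "a \<in> carrier A" "b \<in> carrier B"
    then have "frag_of (a, b) \<in> carrier F" by (simp add: F_def)
    from u(2)[OF this] show "u (pure_tensor A B a b) = f a b"
      using h(2)[of "(a, b)"] ab by (simp add: pure_tensor_def F_def)
  qed
qed

text \<open>
  Pure tensors generate the tensor product.
\<close>
lemma tensor_product_hom_unique:
  assumes "group A" "group B" "group C"
    and u: "u \<in> hom (tensor_product A B) C" and v: "v \<in> hom (tensor_product A B) C"
    and eq: "\<And>a b. a \<in> carrier A \<Longrightarrow> b \<in> carrier B \<Longrightarrow> u (pure_tensor A B a b) = v (pure_tensor A B a b)"
    and t: "t \<in> carrier (tensor_product A B)"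
  shows "u t = v t"
proof -
  define F where "F = free_Abelian_group (carrier A \<times> carrier B)"
  define N where "N = tensor_null A B"
  interpret N: normal N F
    unfolding N_def F_def by (rule tensor_null_normal[OF assms(1,2)])
  have hom: "(\<lambda>x. w (N #>\<^bsub>F\<^esub> x)) \<in> hom F C" if "w \<in> hom (tensor_product A B) C" for w
    using that N.r_coset_hom_Mod unfolding tensor_product_def F_def[symmetric] N_def[symmetric]
    by (auto simp: hom_def Pi_iff)
  interpret u: group_hom F C "\<lambda>x. u (N #>\<^bsub>F\<^esub> x)"
    using hom[OF u] assms(3) by (simp add: group_hom_def group_hom_axioms_def N.is_group)
  interpret v: group_hom F C "\<lambda>x. v (N #>\<^bsub>F\<^esub> x)"
    using hom[OF v] assms(3) by (simp add: group_hom_def group_hom_axioms_def N.is_group)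
  obtain x where x: "x \<in> carrier F" "t = N #>\<^bsub>F\<^esub> x"
    using t by (auto simp: tensor_product_def carrier_FactGroup F_def N_def)
  have "Poly_Mapping.keys x \<subseteq> carrier A \<times> carrier B" using x(1) by (simp add: F_def)
  then have "u (N #>\<^bsub>F\<^esub> x) = v (N #>\<^bsub>F\<^esub> x)"
  proof (induction x rule: free_Abelian_group_induct[consumes 1, case_names zero diff of])
    case zero
    then show ?case using u.hom_one v.hom_one by (simp add: F_def)
  next
    case (diff x y)
    then have xy: "x \<in> carrier F" "y \<in> carrier F" "x - y = x \<otimes>\<^bsub>F\<^esub> inv\<^bsub>F\<^esub> y" by (auto simp: F_def)
    show ?case
      unfolding xy(3) using xy(1,2) diff(3,4) u.hom_mult[of x "inv\<^bsub>F\<^esub> y"] v.hom_mult[of x "inv\<^bsub>F\<^esub> y"] u.hom_inv[of y] v.hom_inv[of y]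
      by simp
  next
    case (of a)
    then show ?case using eq[of "fst a" "snd a"] by (auto simp: pure_tensor_def F_def N_def)
  qed
  with x show ?thesis by simp
qed

section \<open>Cohomology modulo 2 in degrees one and two\<close>

abbreviation (input) "Z2 \<equiv> integer_mod_group 2"

lemma mod_2_eq_iff: "(x::int) mod 2 = y mod 2 \<longleftrightarrow> (even x \<longleftrightarrow> even y)"
  by presburger

lemma carrier_Z2: "carrier Z2 = {0, 1}"
  by (auto simp: carrier_integer_mod_group)

lemma inv_Z2: "x \<in> {0, 1} \<Longrightarrow> inv\<^bsub>Z2\<^esub> x = x"
  by (auto simp: carrier_Z2)

lemma comm_group_functions_Z2: "comm_group (continuous_functions_group X Z2)"
  by (intro comm_group_continuous_functions_group abelian_integer_mod_group)

lemma functions_Z2_value: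
  assumes "f \<in> carrier (continuous_functions_group X Z2)" "x \<in> topspace X"
  shows "f x = 0 \<or> f x = 1"
  using assms continuous_map_image_subset_topspace[of X "discrete_topology (carrier Z2)" f]
  by (auto simp: carrier_continuous_functions_group carrier_Z2)

text \<open>
  Every element is its own inverse, so subgroups are just nonempty sets closed under addition.
\<close>
lemma functions_Z2_inv:
  assumes "f \<in> carrier (continuous_functions_group X Z2)"
  shows "inv\<^bsub>continuous_functions_group X Z2\<^esub> f = f"
proof -
  interpret K: comm_group "continuous_functions_group X Z2" by (rule comm_group_functions_Z2)
  have "f \<otimes>\<^bsub>continuous_functions_group X Z2\<^esub> f = \<one>\<^bsub>continuous_functions_group X Z2\<^esub>"
    using functions_Z2_value[OF assms] by (auto intro!: restrict_ext)
  then show ?thesis using K.inv_equality assms by blast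
qed

lemma subgroup_functions_Z2:
  assumes "S \<subseteq> carrier (continuous_functions_group X Z2)" "S \<noteq> {}"
    and "\<And>f g. f \<in> S \<Longrightarrow> g \<in> S \<Longrightarrow> f \<otimes>\<^bsub>continuous_functions_group X Z2\<^esub> g \<in> S"
  shows "subgroup S (continuous_functions_group X Z2)"
proof -
  interpret K: comm_group "continuous_functions_group X Z2" by (rule comm_group_functions_Z2)
  show ?thesis
    by (rule K.subgroupI) (use assms functions_Z2_inv[of _ X] in \<open>auto simp del: continuous_functions_group_simps simp: subset_iff\<close>)
qed

context profinite
begin

definition cochain1 :: "('a \<Rightarrow> int) set" where
  "cochain1 = carrier (continuous_functions_group T Z2)"

definition character :: "('a \<Rightarrow> int) set" where
  "character = cocycles1 G T Z2"

definition coboundaries2 :: "('a \<times> 'a \<Rightarrow> int) set" where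
  "coboundaries2 = coboundary1 G Z2 ` carrier (continuous_functions_group T Z2)"

abbreviation "K2 \<equiv> continuous_functions_group (prod_topology T T) Z2"
abbreviation "C2 \<equiv> K2\<lparr>carrier := cocycles2 G T Z2\<rparr>"

lemma cochain1_iff:
  "f \<in> cochain1 \<longleftrightarrow> f \<in> extensional (carrier G) \<and> continuous_map T (discrete_topology {0, 1}) f"
  by (simp add: cochain1_def carrier_continuous_functions_group carrier_Z2)

lemma cochain1_value: "f \<in> cochain1 \<Longrightarrow> g \<in> carrier G \<Longrightarrow> f g = 0 \<or> f g = 1"
  using functions_Z2_value[of f T g] by (simp add: cochain1_def)

lemma coboundary1_Z2:
  assumes "f \<in> cochain1"
  shows "coboundary1 G Z2 f = (\<lambda>(g, h)\<in>carrier G \<times> carrier G. (f g + f h + f (g \<otimes> h)) mod 2)"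
proof -
  have "inv\<^bsub>Z2\<^esub> f (g \<otimes> h) = f (g \<otimes> h)" if "g \<in> carrier G" "h \<in> carrier G" for g h
    using cochain1_value[OF assms, of "g \<otimes> h"] that by (intro inv_Z2) auto
  then show ?thesis
    unfolding coboundary1_def by (intro restrict_ext) (auto simp: mod_simps ac_simps)
qed

lemma character_iff:
  "f \<in> character \<longleftrightarrow> f \<in> cochain1 \<and> (\<forall>g\<in>carrier G. \<forall>h\<in>carrier G. f (g \<otimes> h) = (f g + f h) mod 2)"
proof -
  have "coboundary1 G Z2 f = \<one>\<^bsub>K2\<^esub> \<longleftrightarrow> (\<forall>g\<in>carrier G. \<forall>h\<in>carrier G. f (g \<otimes> h) = (f g + f h) mod 2)"
    if f: "f \<in> cochain1"
  proof -
    have "coboundary1 G Z2 f = \<one>\<^bsub>K2\<^esub> \<longleftrightarrow>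
        (\<forall>g\<in>carrier G. \<forall>h\<in>carrier G. (f g + f h + f (g \<otimes> h)) mod 2 = 0)"
      unfolding coboundary1_Z2[OF f]
      by (auto simp: fun_eq_iff restrict_def)
    also have "\<dots> \<longleftrightarrow> (\<forall>g\<in>carrier G. \<forall>h\<in>carrier G. f (g \<otimes> h) = (f g + f h) mod 2)"
    proof (intro ball_cong refl)
      fix g h assume "g \<in> carrier G" "h \<in> carrier G"
      then have "f (g \<otimes> h) = 0 \<or> f (g \<otimes> h) = 1" using cochain1_value[OF f] by auto
      then show "(f g + f h + f (g \<otimes> h)) mod 2 = 0 \<longleftrightarrow> f (g \<otimes> h) = (f g + f h) mod 2"
        by presburger
    qed
    finally show ?thesis .
  qed
  then show ?thesis
    by (auto simp: character_def cocycles1_def kernel_def cochain1_def)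
qed

lemma character_value: "f \<in> character \<Longrightarrow> g \<in> carrier G \<Longrightarrow> f g = 0 \<or> f g = 1"
  by (simp add: character_iff cochain1_value)

lemma character_mult:
  "f \<in> character \<Longrightarrow> g \<in> carrier G \<Longrightarrow> h \<in> carrier G \<Longrightarrow> f (g \<otimes> h) = (f g + f h) mod 2"
  by (simp add: character_iff)

lemma cocycles2_iff:
  "c \<in> cocycles2 G T Z2 \<longleftrightarrow> c \<in> carrier K2 \<and>
     (\<forall>g\<in>carrier G. \<forall>h\<in>carrier G. \<forall>k\<in>carrier G. even (c (h, k) + c (g \<otimes> h, k) + c (g, h \<otimes> k) + c (g, h)))"
proof -
  have "coboundary2 G Z2 c = \<one>\<^bsub>continuous_functions_group (prod_topology T (prod_topology T T)) Z2\<^esub> \<longleftrightarrow>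
    (\<forall>g\<in>carrier G. \<forall>h\<in>carrier G. \<forall>k\<in>carrier G. even (c (h, k) + c (g \<otimes> h, k) + c (g, h \<otimes> k) + c (g, h)))"
    if c: "c \<in> carrier K2"
  proof -
    have v: "c (g, h) \<in> {0, 1}" if "g \<in> carrier G" "h \<in> carrier G" for g h
      using functions_Z2_value[OF c, of "(g, h)"] that by simp
    have "coboundary2 G Z2 c = (\<lambda>(g, h, k)\<in>carrier G \<times> carrier G \<times> carrier G.
        (c (h, k) + c (g \<otimes> h, k) + c (g, h \<otimes> k) + c (g, h)) mod 2)"
      unfolding coboundary2_def using v
      by (intro restrict_ext) (auto simp: inv_Z2 mod_simps)
    then show ?thesis
      by (auto simp: fun_eq_iff restrict_def even_iff_mod_2_eq_zero)
  qed
  then show ?thesis by (auto simp: cocycles2_def kernel_def)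
qed

lemma carrier_K2:
  "c \<in> carrier K2 \<longleftrightarrow> c \<in> extensional (carrier G \<times> carrier G) \<and>
     continuous_map (prod_topology T T) (discrete_topology {0, 1}) c"
  by (simp add: carrier_continuous_functions_group carrier_Z2)

lemma coboundary_cocycle:
  assumes f: "f \<in> cochain1"
  shows "coboundary1 G Z2 f \<in> cocycles2 G T Z2"
proof -
  have c: "continuous_map T (discrete_topology {0, 1}) f"
    using f by (simp add: cochain1_iff)
  let ?P = "prod_topology T T"
  have 1: "continuous_map ?P (discrete_topology {0, 1}) (\<lambda>p. f (fst p))"
    "continuous_map ?P (discrete_topology {0, 1}) (\<lambda>p. f (snd p))"
    "continuous_map ?P (discrete_topology {0, 1}) (\<lambda>p. f (fst p \<otimes> snd p))"
    using continuous_map_compose[OF continuous_map_fst c] continuous_map_compose[OF continuous_map_snd c]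
      continuous_map_compose[OF continuous_mult_maps[OF continuous_map_fst continuous_map_snd] c]
    by (simp_all add: o_def)
  have "continuous_map ?P (discrete_topology {0, 1}) (\<lambda>p. (f (fst p) + f (snd p)) mod 2)"
    by (rule continuous_map_discrete_combine[OF 1(1,2), where op = "\<lambda>a b. (a + b) mod 2"]) auto
  then have "continuous_map ?P (discrete_topology {0, 1}) (\<lambda>p. ((f (fst p) + f (snd p)) mod 2 + f (fst p \<otimes> snd p)) mod 2)"
    by (rule continuous_map_discrete_combine[OF _ 1(3), where op = "\<lambda>a b. (a + b) mod 2"]) auto
  then have "coboundary1 G Z2 f \<in> carrier K2"
    unfolding coboundary1_Z2[OF f] carrier_K2 
    by (simp add: restrict_continuous_map case_prod_unfold mod_simps)
  then show ?thesis
    by (auto simp: cocycles2_iff coboundary1_Z2[OF f] m_assoc)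
qed

lemma subgroup_cocycles2: "subgroup (cocycles2 G T Z2) K2"
proof (rule subgroup_functions_Z2)
  interpret K: comm_group K2 by (rule comm_group_functions_Z2)
  show "cocycles2 G T Z2 \<subseteq> carrier K2" by (auto simp: cocycles2_iff)
  have "\<one>\<^bsub>K2\<^esub> \<in> cocycles2 G T Z2" unfolding cocycles2_iff using K.one_closed by auto
  then show "cocycles2 G T Z2 \<noteq> {}" by blast
  fix c d assume c: "c \<in> cocycles2 G T Z2" and d: "d \<in> cocycles2 G T Z2"
  then have "c \<otimes>\<^bsub>K2\<^esub> d \<in> carrier K2" using K.m_closed by (auto simp: cocycles2_iff)
  moreover have "even ((c \<otimes>\<^bsub>K2\<^esub> d) (h, k) + (c \<otimes>\<^bsub>K2\<^esub> d) (g \<otimes> h, k) + (c \<otimes>\<^bsub>K2\<^esub> d) (g, h \<otimes> k) + (c \<otimes>\<^bsub>K2\<^esub> d) (g, h))"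
    if "g \<in> carrier G" "h \<in> carrier G" "k \<in> carrier G" for g h k
  proof -
    have "even (c (h, k) + c (g \<otimes> h, k) + c (g, h \<otimes> k) + c (g, h))"
      "even (d (h, k) + d (g \<otimes> h, k) + d (g, h \<otimes> k) + d (g, h))"
      using c d that by (auto simp: cocycles2_iff)
    then show ?thesis using that by auto
  qed
  ultimately show "c \<otimes>\<^bsub>K2\<^esub> d \<in> cocycles2 G T Z2" by (simp add: cocycles2_iff del: continuous_functions_group_simps)
qed

lemma coboundary1_add:
  assumes "f \<in> cochain1" "f' \<in> cochain1"
  shows "f \<otimes>\<^bsub>continuous_functions_group T Z2\<^esub> f' \<in> cochain1"
    "coboundary1 G Z2 f \<otimes>\<^bsub>K2\<^esub> coboundary1 G Z2 f' = coboundary1 G Z2 (f \<otimes>\<^bsub>continuous_functions_group T Z2\<^esub> f')"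
proof -
  interpret K: comm_group "continuous_functions_group T Z2" by (rule comm_group_functions_Z2)
  show *: "f \<otimes>\<^bsub>continuous_functions_group T Z2\<^esub> f' \<in> cochain1"
    using assms K.m_closed by (simp add: cochain1_def del: continuous_functions_group_simps)
  show "coboundary1 G Z2 f \<otimes>\<^bsub>K2\<^esub> coboundary1 G Z2 f' = coboundary1 G Z2 (f \<otimes>\<^bsub>continuous_functions_group T Z2\<^esub> f')"
    unfolding coboundary1_Z2[OF *] coboundary1_Z2[OF assms(1)] coboundary1_Z2[OF assms(2)]
    by (auto simp: mod_2_eq_iff intro!: restrict_ext)
qed

lemma subgroup_coboundaries2: "subgroup coboundaries2 K2"
proof (rule subgroup_functions_Z2)
  interpret K: comm_group "continuous_functions_group T Z2" by (rule comm_group_functions_Z2)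
  show "coboundaries2 \<subseteq> carrier K2"
    using coboundary_cocycle by (auto simp: coboundaries2_def cochain1_def cocycles2_iff)
  show "coboundaries2 \<noteq> {}" using K.one_closed unfolding coboundaries2_def by blast
  show "c \<otimes>\<^bsub>K2\<^esub> d \<in> coboundaries2" if "c \<in> coboundaries2" "d \<in> coboundaries2" for c d
    using that coboundary1_add unfolding coboundaries2_def cochain1_def[symmetric] by auto
qed

lemma comm_group_C2: "comm_group C2"
  by (rule group.group_comm_groupI)
    (use subgroup.subgroup_is_group[OF subgroup_cocycles2 comm_group.axioms(2)[OF comm_group_functions_Z2]] in
      \<open>auto simp: add.commute\<close>)

lemma coboundaries2_normal: "coboundaries2 \<lhd> C2"
proof -
  have "coboundaries2 \<subseteq> cocycles2 G T Z2"
    using coboundary_cocycle by (auto simp: coboundaries2_def cochain1_def)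
  then have "subgroup coboundaries2 C2"
    using group.subgroup_incl[OF comm_group.axioms(2)[OF comm_group_functions_Z2] subgroup_coboundaries2 subgroup_cocycles2]
    by blast
  then show ?thesis using comm_group.normal_iff_subgroup[OF comm_group_C2] by blast
qed

definition class2 :: "('a \<times> 'a \<Rightarrow> int) \<Rightarrow> ('a \<times> 'a \<Rightarrow> int) set" where
  "class2 c = coboundaries2 #>\<^bsub>C2\<^esub> c"

lemma H2_eq: "H2 G T = C2 Mod coboundaries2"
  by (simp add: cohomology2_def coboundaries2_def)

lemma carrier_H2: "carrier (H2 G T) = class2 ` cocycles2 G T Z2"
  unfolding H2_eq carrier_FactGroup class2_def by simp

lemma class2_hom: "class2 \<in> hom C2 (H2 G T)"
  unfolding H2_eq class2_def[abs_def] using normal.r_coset_hom_Mod[OF coboundaries2_normal] .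

lemma class2_unique:
  assumes "\<omega> \<in> carrier (H2 G T)" "c \<in> \<omega>"
  shows "\<omega> = class2 c"
proof -
  interpret C: comm_group C2 by (rule comm_group_C2)
  obtain d where d: "d \<in> carrier C2" "\<omega> = coboundaries2 #>\<^bsub>C2\<^esub> d"
    using assms(1) by (auto simp: carrier_H2 class2_def)
  with assms(2) show ?thesis
    using C.repr_independence[of c coboundaries2 d] normal_imp_subgroup[OF coboundaries2_normal]
    by (simp add: class2_def)
qed

lemma class2_self: "c \<in> cocycles2 G T Z2 \<Longrightarrow> c \<in> class2 c"
  using group.rcos_self[OF comm_group.axioms(2)[OF comm_group_C2], of c]
    normal_imp_subgroup[OF coboundaries2_normal] by (simp add: class2_def)

lemma class2_trivial_iff:
  assumes "c \<in> cocycles2 G T Z2"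
  shows "class2 c = \<one>\<^bsub>H2 G T\<^esub> \<longleftrightarrow> c \<in> coboundaries2"
proof -
  have "class2 c = \<one>\<^bsub>H2 G T\<^esub> \<longleftrightarrow> class2 c = coboundaries2" by (simp add: H2_eq)
  then show ?thesis
    using group.coset_join1[OF comm_group.axioms(2)[OF comm_group_C2], of coboundaries2 c]
    group.coset_join2[OF comm_group.axioms(2)[OF comm_group_C2], of c coboundaries2]
    normal_imp_subgroup[OF coboundaries2_normal] assms by (auto simp: class2_def)
qed

lemma coboundaries1: "coboundary0 G Z2 ` carrier Z2 = {\<lambda>g\<in>carrier G. 0}"
  by (auto simp: coboundary0_def carrier_Z2)

text \<open>
  The action on coefficients is trivial, so the only coboundary in degree one is zero and the class of
  a character is a singleton. Cup products therefore live on the level of cochains.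
\<close>
lemma coset_coboundaries1:
  assumes "f \<in> cochain1"
  shows "(coboundary0 G Z2 ` carrier Z2) #>\<^bsub>(continuous_functions_group T Z2)\<lparr>carrier := S\<rparr>\<^esub> f = {f}"
proof -
  have "(\<lambda>g\<in>carrier G. (0 + f g) mod 2) = f"
    using assms cochain1_value[OF assms] by (force simp: cochain1_iff extensional_def fun_eq_iff)
  then show ?thesis unfolding coboundaries1 r_coset_def by (simp cong: restrict_cong)
qed

lemma carrier_H1: "carrier (H1 G T) = (\<lambda>f. {f}) ` character"
  unfolding cohomology1_def carrier_FactGroup character_def[symmetric]
  using coset_coboundaries1 by (auto simp: character_iff intro!: image_cong)

lemma mult_H1:
  "{f} \<otimes>\<^bsub>H1 G T\<^esub> {f'} = {\<lambda>g\<in>carrier G. (f g + f' g) mod 2}"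
  by (simp add: cohomology1_def set_mult_def)

lemma character_add:
  assumes "f \<in> character" "f' \<in> character"
  shows "(\<lambda>g\<in>carrier G. (f g + f' g) mod 2) \<in> character"
proof -
  have "((f g + f h) mod 2 + (f' g + f' h) mod 2) mod 2 = ((f g + f' g) mod 2 + (f h + f' h) mod 2) mod 2" for g h
    by (auto simp: mod_2_eq_iff)
  then show ?thesis
    using coboundary1_add(1)[of f f'] assms by (simp add: character_iff)
qed

lemma group_H1: "group (H1 G T)"
proof (rule groupI)
  have z: "(\<lambda>g\<in>carrier G. 0) \<in> character"
    by (auto simp: character_iff cochain1_iff restrict_continuous_map)
  have one: "\<one>\<^bsub>H1 G T\<^esub> = {\<lambda>g\<in>carrier G. 0}"
    by (simp add: cohomology1_def coboundaries1)
  with z show "\<one>\<^bsub>H1 G T\<^esub> \<in> carrier (H1 G T)" by (simp add: carrier_H1)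
  fix x assume x: "x \<in> carrier (H1 G T)"
  then obtain f where f: "x = {f}" "f \<in> character" by (auto simp: carrier_H1)
  then have v: "f g = 0 \<or> f g = 1" if "g \<in> carrier G" for g
    using that by (simp add: character_value)
  show "\<one>\<^bsub>H1 G T\<^esub> \<otimes>\<^bsub>H1 G T\<^esub> x = x"
    using f v by (force simp: one mult_H1 fun_eq_iff character_iff cochain1_iff extensional_def)
  have "x \<otimes>\<^bsub>H1 G T\<^esub> x = \<one>\<^bsub>H1 G T\<^esub>"
    using v by (auto simp: one mult_H1 f(1) intro!: restrict_ext)
  with x show "\<exists>y\<in>carrier (H1 G T). y \<otimes>\<^bsub>H1 G T\<^esub> x = \<one>\<^bsub>H1 G T\<^esub>" by blast
  fix y assume "y \<in> carrier (H1 G T)"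
  then obtain f' where f': "y = {f'}" "f' \<in> character" by (auto simp: carrier_H1)
  with f show "x \<otimes>\<^bsub>H1 G T\<^esub> y \<in> carrier (H1 G T)" by (simp add: carrier_H1 mult_H1 character_add)
  fix z assume "z \<in> carrier (H1 G T)"
  then obtain f'' where "z = {f''}" "f'' \<in> character" by (auto simp: carrier_H1)
  with f f' show "x \<otimes>\<^bsub>H1 G T\<^esub> y \<otimes>\<^bsub>H1 G T\<^esub> z = x \<otimes>\<^bsub>H1 G T\<^esub> (y \<otimes>\<^bsub>H1 G T\<^esub> z)"
    by (auto simp: mult_H1 mod_2_eq_iff intro!: restrict_ext)
qed

end

section \<open>Cup products, the Bockstein map and Galois relation type\<close>

context profinite
begin

text \<open>
  The cup product of two characters is a bihomomorphism, and these satisfy the cocycle identity.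
\<close>
lemma cup_cochain_cocycle:
  assumes "f \<in> character" "f' \<in> character"
  shows "cup_cochain G f f' \<in> cocycles2 G T Z2"
proof -
  let ?P = "prod_topology T T"
  have "continuous_map ?P (discrete_topology {0, 1}) (\<lambda>p. f (fst p))"
    "continuous_map ?P (discrete_topology {0, 1}) (\<lambda>p. f' (snd p))"
    using assms continuous_map_compose[OF continuous_map_fst[of T T], of "discrete_topology {0, 1}" f]
      continuous_map_compose[OF continuous_map_snd[of T T], of "discrete_topology {0, 1}" f']
    by (simp_all add: o_def character_iff cochain1_iff)
  then have "continuous_map ?P (discrete_topology {0, 1}) (\<lambda>p. (f (fst p) * f' (snd p)) mod 2)"
    by (rule continuous_map_discrete_combine[where op = "\<lambda>a b. (a * b) mod 2"]) auto
  then have "cup_cochain G f f' \<in> carrier K2"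
    unfolding cup_cochain_def carrier_K2 by (simp add: restrict_continuous_map case_prod_unfold)
  then show ?thesis
    using assms by (auto simp: cocycles2_iff cup_cochain_def character_mult)
qed

lemma cup_eq:
  assumes "f \<in> character" "f' \<in> character"
  shows "cup G T {f} {f'} = class2 (cup_cochain G f f')"
  unfolding cup_def
proof (rule the_equality)
  show "is_cup G T {f} {f'} (class2 (cup_cochain G f f'))"
    using cup_cochain_cocycle[OF assms] class2_self by (auto simp: is_cup_def carrier_H2)
  show "\<omega> = class2 (cup_cochain G f f')" if "is_cup G T {f} {f'} \<omega>" for \<omega>
    using that class2_unique by (auto simp: is_cup_def)
qed

text \<open>
  The coboundary of \<open>F\<close> is \<open>f \<union> f'\<close>, written without signs because values are taken modulo \<open>2\<close>.
\<close>
definition splits_cup :: "('a \<Rightarrow> int) \<Rightarrow> ('a \<Rightarrow> int) \<Rightarrow> ('a \<Rightarrow> int) \<Rightarrow> bool" where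
  "splits_cup F f f' \<longleftrightarrow> F \<in> cochain1 \<and>
     (\<forall>g\<in>carrier G. \<forall>h\<in>carrier G. F (g \<otimes> h) = (F g + F h + f g * f' h) mod 2)"

lemma coboundary_eq_iff:
  assumes "F \<in> cochain1"
  shows "coboundary1 G Z2 F = (\<lambda>(g, h)\<in>carrier G \<times> carrier G. m g h mod 2) \<longleftrightarrow>
     (\<forall>g\<in>carrier G. \<forall>h\<in>carrier G. F (g \<otimes> h) = (F g + F h + m g h) mod 2)"
proof -
  have "coboundary1 G Z2 F = (\<lambda>(g, h)\<in>carrier G \<times> carrier G. m g h mod 2) \<longleftrightarrow>
     (\<forall>g\<in>carrier G. \<forall>h\<in>carrier G. (F g + F h + F (g \<otimes> h)) mod 2 = m g h mod 2)"
    unfolding coboundary1_Z2[OF assms] by (auto simp: fun_eq_iff restrict_def)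
  also have "\<dots> \<longleftrightarrow> (\<forall>g\<in>carrier G. \<forall>h\<in>carrier G. F (g \<otimes> h) = (F g + F h + m g h) mod 2)"
  proof (intro ball_cong refl)
    fix g h assume "g \<in> carrier G" "h \<in> carrier G"
    then have "F (g \<otimes> h) = 0 \<or> F (g \<otimes> h) = 1" using cochain1_value[OF assms] by auto
    then have "F (g \<otimes> h) = F (g \<otimes> h) mod 2" by auto
    then show "(F g + F h + F (g \<otimes> h)) mod 2 = m g h mod 2 \<longleftrightarrow> F (g \<otimes> h) = (F g + F h + m g h) mod 2"
      by (metis (no_types, opaque_lifting) even_add mod_2_eq_iff)
  qed
  finally show ?thesis .
qed

lemma splits_cup_iff:
  "splits_cup F f f' \<longleftrightarrow> F \<in> cochain1 \<and> coboundary1 G Z2 F = cup_cochain G f f'"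
  using coboundary_eq_iff[of F "\<lambda>g h. f g * f' h"] by (auto simp: splits_cup_def cup_cochain_def)

text \<open>
  The function \<open>f\<close> with values \<open>0\<close> and \<open>1\<close> is itself a lift to \<open>\<int>/4\<close>, and \<open>f g + f h - f (g h)\<close> is
  \<open>2\<close> exactly if \<open>f g = f h = 1\<close>. Any other lift \<open>F\<close> is \<open>f + 2 e\<close> with \<open>e = F div 2\<close>, which changes the
  cocycle by the coboundary of \<open>e\<close>.
\<close>
lemma cup_eq_bockstein:
  assumes f: "f \<in> character"
  shows "bockstein G T {f} = class2 (cup_cochain G f f)"
proof -
  have f01: "f g = 0 \<or> f g = 1" if "g \<in> carrier G" for g using character_value[OF f that] .
  have Z4: "carrier (integer_mod_group 4) = {0..<4}" by (simp add: carrier_integer_mod_group)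
  have cob4: "coboundary1 G (integer_mod_group 4) F (g, h) = (F g + F h - F (g \<otimes> h)) mod 4"
    if "F \<in> carrier (continuous_functions_group T (integer_mod_group 4))" "g \<in> carrier G" "h \<in> carrier G" for F g h
  proof -
    have "F (g \<otimes> h) \<in> carrier (integer_mod_group 4)"
      using that continuous_map_image_subset_topspace[of T "discrete_topology (carrier (integer_mod_group 4))" F]
      by (auto simp: carrier_continuous_functions_group)
    then have "coboundary1 G (integer_mod_group 4) F (g, h) = (F h + (- F (g \<otimes> h)) mod 4 + F g) mod 4"
      using that by (simp add: coboundary1_def mod_add_left_eq)
    also have "\<dots> = (F g + F h + (- F (g \<otimes> h)) mod 4) mod 4" by (simp add: ac_simps)
    also have "\<dots> = (F g + F h - F (g \<otimes> h)) mod 4" by (simp add: mod_add_right_eq)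
    finally show ?thesis .
  qed
  show ?thesis
    unfolding bockstein_def
  proof (rule the_equality)
    have c: "continuous_map T (discrete_topology {0, 1}) f"
      using f by (simp add: character_iff cochain1_iff)
    have "continuous_map T (discrete_topology {0..<4}) f"
      by (rule continuous_map_discrete_combine[OF c c, where op = "\<lambda>a b. a"]) auto
    then have F: "f \<in> carrier (continuous_functions_group T (integer_mod_group 4))"
      using f by (simp add: carrier_continuous_functions_group Z4 character_iff cochain1_iff)
    have "2 * cup_cochain G f f (g, h) = coboundary1 G (integer_mod_group 4) f (g, h)"
      if "g \<in> carrier G" "h \<in> carrier G" for g h
      using f01[OF that(1)] f01[OF that(2)] that
      by (auto simp: cob4[OF F that] cup_cochain_def character_mult[OF f that])
    moreover have "f g mod 2 = f g" if "g \<in> carrier G" for g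
      using f01[OF that] by auto
    ultimately show "is_bockstein G T {f} (class2 (cup_cochain G f f))"
      unfolding is_bockstein_def
      using cup_cochain_cocycle[OF f f] class2_self F
      by (auto simp: carrier_H2 intro!: bexI[of _ f] bexI[of _ "cup_cochain G f f"])
  next
    fix \<omega> assume "is_bockstein G T {f} \<omega>"
    then obtain F c where \<omega>: "\<omega> \<in> carrier (H2 G T)" and
      F: "F \<in> carrier (continuous_functions_group T (integer_mod_group 4))" and c: "c \<in> \<omega>"
      and Ff: "\<And>g. g \<in> carrier G \<Longrightarrow> F g mod 2 = f g"
      and cF: "\<And>g h. g \<in> carrier G \<Longrightarrow> h \<in> carrier G \<Longrightarrow> 2 * c (g, h) = coboundary1 G (integer_mod_group 4) F (g, h)"
      by (auto simp: is_bockstein_def)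
    have \<omega>c: "\<omega> = class2 c" using class2_unique[OF \<omega> c] .
    obtain d where d: "d \<in> cocycles2 G T Z2" "\<omega> = class2 d" using \<omega> by (auto simp: carrier_H2)
    interpret C: comm_group C2 by (rule comm_group_C2)
    have "\<omega> \<subseteq> cocycles2 G T Z2"
      using d C.r_coset_subset_G[of coboundaries2 d] subgroup.subset[OF normal_imp_subgroup[OF coboundaries2_normal]]
      by (simp add: class2_def)
    then have cc: "c \<in> cocycles2 G T Z2" using c by blast
    then have cK: "c \<in> carrier K2" by (simp add: cocycles2_iff)
    \<comment> \<open>The lift \<open>F\<close> is \<open>f + 2 e\<close>.\<close>
    define e where "e = (\<lambda>g\<in>carrier G. F g div 2)"
    have cF4: "continuous_map T (discrete_topology {0..<4}) F"
      using F by (simp add: carrier_continuous_functions_group Z4)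
    have "continuous_map T (discrete_topology {0, 1}) (\<lambda>g. F g div 2)"
      by (rule continuous_map_discrete_combine[OF cF4 cF4, where op = "\<lambda>a b. a div 2"]) auto
    then have e: "e \<in> cochain1"
      by (simp add: e_def cochain1_iff restrict_continuous_map)
    have "c = cup_cochain G f f \<otimes>\<^bsub>K2\<^esub> coboundary1 G Z2 e"
    proof
      fix p
      show "c p = (cup_cochain G f f \<otimes>\<^bsub>K2\<^esub> coboundary1 G Z2 e) p"
      proof (cases "p \<in> carrier G \<times> carrier G")
        case False
        then show ?thesis using cK extensional_arb[of c "carrier G \<times> carrier G" p] by (simp add: carrier_K2)
      next
        case True
        then obtain g h where gh: "p = (g, h)" "g \<in> carrier G" "h \<in> carrier G" by blast
        have c01: "c (g, h) = 0 \<or> c (g, h) = 1" using functions_Z2_value[OF cK, of "(g, h)"] gh by simp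
        have F2: "F k = 2 * e k + f k" if "k \<in> carrier G" for k
          using Ff[OF that] that by (simp add: e_def) presburger
        have "2 * c (g, h) = (F g + F h - F (g \<otimes> h)) mod 4"
          using cF cob4[OF F] gh by simp
        also have "\<dots> = (2 * (e g + e h - e (g \<otimes> h)) + (f g + f h - f (g \<otimes> h))) mod 4"
          using gh F2 by (simp add: algebra_simps)
        also have "f g + f h - f (g \<otimes> h) = 2 * (f g * f h)"
          using f01[OF gh(2)] f01[OF gh(3)] gh character_mult[OF f gh(2,3)] by auto
        finally have "2 * c (g, h) = (2 * (e g + e h - e (g \<otimes> h) + f g * f h)) mod 4"
          by (simp add: algebra_simps)
        then have "2 * c (g, h) = 2 * ((e g + e h - e (g \<otimes> h) + f g * f h) mod 2)"
          using mult_mod_right[of 2 "e g + e h - e (g \<otimes> h) + f g * f h" 2] by simp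
        then have "c (g, h) = (e g + e h - e (g \<otimes> h) + f g * f h) mod 2" by simp
        also have "\<dots> = (f g * f h + (e g + e h + e (g \<otimes> h))) mod 2"
          by (auto simp: mod_2_eq_iff)
        finally show ?thesis
          using gh by (simp add: coboundary1_Z2[OF e] cup_cochain_def mod_simps)
      qed
    qed
    then have "\<omega> = class2 (cup_cochain G f f) \<otimes>\<^bsub>H2 G T\<^esub> class2 (coboundary1 G Z2 e)"
      using hom_mult[OF class2_hom, of "cup_cochain G f f" "coboundary1 G Z2 e"]
        coboundary_cocycle[OF e] cup_cochain_cocycle[OF f f] \<omega>c by simp
    also have "class2 (coboundary1 G Z2 e) = \<one>\<^bsub>H2 G T\<^esub>"
      using e coboundary_cocycle[OF e] class2_trivial_iff by (simp add: coboundaries2_def cochain1_def)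
    also have "class2 (cup_cochain G f f) \<otimes>\<^bsub>H2 G T\<^esub> \<one>\<^bsub>H2 G T\<^esub> = class2 (cup_cochain G f f)"
      using normal.factorgroup_is_group[OF coboundaries2_normal] cup_cochain_cocycle[OF f f]
      by (metis H2_eq carrier_H2 group.is_monoid imageI monoid.r_one)
    finally show "\<omega> = class2 (cup_cochain G f f)" .
  qed
qed

lemma splits_cup_exists_iff:
  assumes "f \<in> character" "f' \<in> character"
  shows "(\<exists>F. splits_cup F f f') \<longleftrightarrow> class2 (cup_cochain G f f') = \<one>\<^bsub>H2 G T\<^esub>"
  unfolding class2_trivial_iff[OF cup_cochain_cocycle[OF assms]] splits_cup_iff
    coboundaries2_def cochain1_def image_iff Bex_def by metis

lemma bockstein_condition:
  assumes "galois_relation_type_2 G T"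
  obtains x where "x \<in> character" "\<And>f. f \<in> character \<Longrightarrow> \<exists>F. splits_cup F f (\<lambda>g\<in>carrier G. (f g + x g) mod 2)"
proof -
  obtain x where x: "x \<in> character" and
    rel: "\<And>f. f \<in> character \<Longrightarrow> cup G T {f} {x} \<otimes>\<^bsub>H2 G T\<^esub> bockstein G T {f} = \<one>\<^bsub>H2 G T\<^esub>"
    using assms unfolding galois_relation_type_2_def carrier_H1 by auto
  have "\<exists>F. splits_cup F f (\<lambda>g\<in>carrier G. (f g + x g) mod 2)" if f: "f \<in> character" for f
  proof -
    have "cup_cochain G f (\<lambda>g\<in>carrier G. (f g + x g) mod 2) = cup_cochain G f x \<otimes>\<^bsub>C2\<^esub> cup_cochain G f f"
      by (auto simp: cup_cochain_def mod_2_eq_iff intro!: restrict_ext)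
    then have "class2 (cup_cochain G f (\<lambda>g\<in>carrier G. (f g + x g) mod 2)) = 
      class2 (cup_cochain G f x) \<otimes>\<^bsub>H2 G T\<^esub> class2 (cup_cochain G f f)"
      using hom_mult[OF class2_hom, of "cup_cochain G f x" "cup_cochain G f f"] cup_cochain_cocycle f x by simp
    also have "\<dots> = \<one>\<^bsub>H2 G T\<^esub>"
      using rel[OF f] by (simp add: cup_eq[OF f x] cup_eq_bockstein[OF f])
    finally show ?thesis
      using splits_cup_exists_iff f character_add[OF f x] by blast
  qed
  with x that show thesis by blast
qed

text \<open>
  Cup products of characters are bilinear already as cochains. So the cup product homomorphism lifts
  to a homomorphism \<open>m\<close> to the group of cocycles, and its kernel consists of the tensors \<open>t\<close> for
  which \<open>m t\<close> is a coboundary.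
\<close>
lemma cup_hom_lift:
  obtains m where "m \<in> hom (tensor_product (H1 G T) (H1 G T)) C2"
    and "\<And>f f'. f \<in> character \<Longrightarrow> f' \<in> character \<Longrightarrow> m (pure_tensor (H1 G T) (H1 G T) {f} {f'}) = cup_cochain G f f'"
    and "\<And>t. t \<in> carrier (tensor_product (H1 G T) (H1 G T)) \<Longrightarrow> cup_hom G T t = class2 (m t)"
proof -
  let ?TP = "tensor_product (H1 G T) (H1 G T)"
  obtain m where m: "m \<in> hom ?TP C2" 
    and mp: "\<And>\<psi> \<psi>'. \<psi> \<in> carrier (H1 G T) \<Longrightarrow> \<psi>' \<in> carrier (H1 G T) \<Longrightarrow>
       m (pure_tensor (H1 G T) (H1 G T) \<psi> \<psi>') = cup_cochain G (the_elem \<psi>) (the_elem \<psi>')"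
  proof (rule tensor_product_universal[OF group_H1 group_H1 comm_group_C2,
        where f = "\<lambda>\<psi> \<psi>'. cup_cochain G (the_elem \<psi>) (the_elem \<psi>')"])
    fix a b assume a: "a \<in> carrier (H1 G T)" and b: "b \<in> carrier (H1 G T)"
    then show "cup_cochain G (the_elem a) (the_elem b) \<in> carrier C2"
      by (auto simp: carrier_H1 cup_cochain_cocycle)
    fix a' assume "a' \<in> carrier (H1 G T)"
    with a b show "cup_cochain G (the_elem (a \<otimes>\<^bsub>H1 G T\<^esub> a')) (the_elem b) =
        cup_cochain G (the_elem a) (the_elem b) \<otimes>\<^bsub>C2\<^esub> cup_cochain G (the_elem a') (the_elem b)"
      by (auto simp: carrier_H1 mult_H1 cup_cochain_def mod_2_eq_iff intro!: restrict_ext)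
  next
    fix a b b' assume "a \<in> carrier (H1 G T)" "b \<in> carrier (H1 G T)" "b' \<in> carrier (H1 G T)"
    then show "cup_cochain G (the_elem a) (the_elem (b \<otimes>\<^bsub>H1 G T\<^esub> b')) =
        cup_cochain G (the_elem a) (the_elem b) \<otimes>\<^bsub>C2\<^esub> cup_cochain G (the_elem a) (the_elem b')"
      by (auto simp: carrier_H1 mult_H1 cup_cochain_def mod_2_eq_iff intro!: restrict_ext)
  qed blast
  have mchar: "m (pure_tensor (H1 G T) (H1 G T) {f} {f'}) = cup_cochain G f f'"
    if "f \<in> character" "f' \<in> character" for f f'
    using mp[of "{f}" "{f'}"] that by (simp add: carrier_H1)
  have hom: "class2 \<circ> m \<in> hom ?TP (H2 G T)" using m class2_hom unfolding hom_def Pi_iff by auto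
  have "is_cup_hom G T (restrict (class2 \<circ> m) (carrier ?TP))"
    unfolding is_cup_hom_def
  proof (intro conjI ballI)
    interpret TP: group ?TP by (rule group_tensor_product[OF group_H1 group_H1])
    show "restrict (class2 \<circ> m) (carrier ?TP) \<in> hom ?TP (H2 G T)"
      using hom TP.m_closed by (auto simp: hom_def Pi_iff)
    fix \<psi> \<psi>' assume "\<psi> \<in> carrier (H1 G T)" "\<psi>' \<in> carrier (H1 G T)"
    then show "restrict (class2 \<circ> m) (carrier ?TP) (pure_tensor (H1 G T) (H1 G T) \<psi> \<psi>') = cup G T \<psi> \<psi>'"
      using pure_tensor_closed[of \<psi> "H1 G T" \<psi>' "H1 G T"] by (auto simp: carrier_H1 mchar cup_eq)
  qed auto
  moreover have "u = restrict (class2 \<circ> m) (carrier ?TP)" if u: "is_cup_hom G T u" for u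
  proof (rule extensionalityI)
    show "u \<in> extensional (carrier ?TP)" using u by (simp add: is_cup_hom_def)
    show "u t = restrict (class2 \<circ> m) (carrier ?TP) t" if t: "t \<in> carrier ?TP" for t
    proof -
      have "u t = (class2 \<circ> m) t"
      proof (rule tensor_product_hom_unique[OF group_H1 group_H1 _ _ hom _ t])
        show "group (H2 G T)" unfolding H2_eq using normal.factorgroup_is_group[OF coboundaries2_normal] .
        show "u \<in> hom ?TP (H2 G T)" using u by (simp add: is_cup_hom_def)
        show "u (pure_tensor (H1 G T) (H1 G T) \<psi> \<psi>') = (class2 \<circ> m) (pure_tensor (H1 G T) (H1 G T) \<psi> \<psi>')"
          if "\<psi> \<in> carrier (H1 G T)" "\<psi>' \<in> carrier (H1 G T)" for \<psi> \<psi>'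
          using that u by (auto simp: is_cup_hom_def carrier_H1 mchar cup_eq)
      qed
      then show ?thesis using t by simp
    qed
  qed auto
  ultimately have "cup_hom G T = restrict (class2 \<circ> m) (carrier ?TP)"
    unfolding cup_hom_def by (rule the_equality)
  with m mchar that[of m] show thesis by simp
qed

lemma tensor_of_list:
  assumes m: "m \<in> hom (tensor_product (H1 G T) (H1 G T)) C2"
    and "\<And>f f'. f \<in> character \<Longrightarrow> f' \<in> character \<Longrightarrow> m (pure_tensor (H1 G T) (H1 G T) {f} {f'}) = cup_cochain G f f'"
    and "\<forall>(a, b)\<in>set ps. a \<in> character \<and> b \<in> character"
  shows "\<exists>t\<in>carrier (tensor_product (H1 G T) (H1 G T)).
     m t = (\<lambda>(g, h)\<in>carrier G \<times> carrier G. (\<Sum>(a, b)\<leftarrow>ps. a g * b h) mod 2)"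
  using assms(3)
proof (induction ps)
  case Nil
  interpret m: group_hom "tensor_product (H1 G T) (H1 G T)" C2 m
    using m group_tensor_product[OF group_H1 group_H1] comm_group.axioms(2)[OF comm_group_C2]
    by (simp add: group_hom_def group_hom_axioms_def)
  show ?case
    using m.hom_one by (intro bexI[OF _ m.G.one_closed]) auto
next
  case (Cons p ps)
  interpret TP: group "tensor_product (H1 G T) (H1 G T)"
    by (rule group_tensor_product[OF group_H1 group_H1])
  obtain a b where p: "p = (a, b)" "a \<in> character" "b \<in> character" using Cons.prems by auto
  obtain t where t: "t \<in> carrier (tensor_product (H1 G T) (H1 G T))"
     "m t = (\<lambda>(g, h)\<in>carrier G \<times> carrier G. (\<Sum>(a, b)\<leftarrow>ps. a g * b h) mod 2)"
    using Cons.IH Cons.prems by (meson list.set_intros(2))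
  let ?s = "pure_tensor (H1 G T) (H1 G T) {a} {b}"
  have s: "?s \<in> carrier (tensor_product (H1 G T) (H1 G T))"
    using p by (intro pure_tensor_closed) (auto simp: carrier_H1)
  show ?case
  proof (rule bexI[OF _ TP.m_closed[OF s t(1)]])
    show "m (?s \<otimes>\<^bsub>tensor_product (H1 G T) (H1 G T)\<^esub> t) =
      (\<lambda>(g, h)\<in>carrier G \<times> carrier G. (\<Sum>(a, b)\<leftarrow>p # ps. a g * b h) mod 2)"
      using hom_mult[OF m s t(1)] assms(2)[OF p(2,3)] t(2)
      by (auto simp: cup_cochain_def p(1) mod_2_eq_iff intro!: restrict_ext)
  qed
qed

text \<open>
  Condition (i) on the level of cochains. The tensors \<open>t\<close> in the kernel for which \<open>m t\<close> is the
  coboundary of a cochain vanishing at \<open>\<sigma>\<close> form a subgroup \<open>E\<close>. If every split product were split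
  by a cochain vanishing at \<open>\<sigma>\<close>, then \<open>E\<close> would contain the generators of the kernel, hence also the
  tensor of the list \<open>ps\<close>. Then \<open>F\<close> would differ by a character from a cochain that vanishes at \<open>\<sigma>\<close>.
\<close>
lemma cup_kernel_condition:
  assumes grt: "galois_relation_type_2 G T"
    and ps: "\<forall>(a, b)\<in>set ps. a \<in> character \<and> b \<in> character"
    and F: "F \<in> cochain1" "\<And>g h. g \<in> carrier G \<Longrightarrow> h \<in> carrier G \<Longrightarrow>
       F (g \<otimes> h) = (F g + F h + (\<Sum>(a, b)\<leftarrow>ps. a g * b h)) mod 2"
    and \<sigma>: "\<sigma> \<in> carrier G" "\<And>f. f \<in> character \<Longrightarrow> f \<sigma> = 0" "F \<sigma> = 1"
  obtains f f' F' where "f \<in> character" "f' \<in> character" "splits_cup F' f f'" "F' \<sigma> = 1"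
proof -
  let ?TP = "tensor_product (H1 G T) (H1 G T)"
  obtain m where m: "m \<in> hom ?TP C2"
    and mp: "\<And>f f'. f \<in> character \<Longrightarrow> f' \<in> character \<Longrightarrow> m (pure_tensor (H1 G T) (H1 G T) {f} {f'}) = cup_cochain G f f'"
    and mc: "\<And>t. t \<in> carrier ?TP \<Longrightarrow> cup_hom G T t = class2 (m t)"
    by (rule cup_hom_lift) (rule that, assumption+)
  interpret m: group_hom ?TP C2 m
    using m group_tensor_product[OF group_H1 group_H1] comm_group.axioms(2)[OF comm_group_C2]
    by (simp add: group_hom_def group_hom_axioms_def)
  interpret K1: comm_group "continuous_functions_group T Z2" by (rule comm_group_functions_Z2)
  obtain S where S: "S \<subseteq> {pure_tensor (H1 G T) (H1 G T) \<psi> \<psi>' | \<psi> \<psi>'. \<psi> \<in> carrier (H1 G T) \<and> \<psi>' \<in> carrier (H1 G T)}"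
    and ker: "kernel ?TP (H2 G T) (cup_hom G T) = generate ?TP S"
    using grt unfolding galois_relation_type_2_def by blast
  have "\<exists>f\<in>character. \<exists>f'\<in>character. \<exists>F'. splits_cup F' f f' \<and> F' \<sigma> = 1"
  proof (rule ccontr)
    assume neg: "\<not> ?thesis"
    define E where "E = {t \<in> carrier ?TP. \<exists>F'\<in>cochain1. F' \<sigma> = 0 \<and> coboundary1 G Z2 F' = m t}"
    have SE: "S \<subseteq> E"
    proof
      fix s assume s: "s \<in> S"
      then obtain f f' where ff: "f \<in> character" "f' \<in> character" "s = pure_tensor (H1 G T) (H1 G T) {f} {f'}"
        using S by (auto simp: carrier_H1)
      have "s \<in> kernel ?TP (H2 G T) (cup_hom G T)" unfolding ker by (rule generate.incl[OF s])
      then have sc: "s \<in> carrier ?TP" and "cup_hom G T s = \<one>\<^bsub>H2 G T\<^esub>" by (auto simp: kernel_def)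
      then have "class2 (cup_cochain G f f') = \<one>\<^bsub>H2 G T\<^esub>"
        using mc[OF sc] mp[OF ff(1,2)] ff(3) by simp
      then obtain F' where F': "splits_cup F' f f'" using splits_cup_exists_iff ff by blast
      then have "F' \<in> cochain1" "coboundary1 G Z2 F' = m s" using mp[OF ff(1,2)] ff(3) by (auto simp: splits_cup_iff)
      moreover have "F' \<sigma> = 0" using neg F' ff cochain1_value[OF \<open>F' \<in> cochain1\<close> \<sigma>(1)] by blast
      ultimately show "s \<in> E" using sc by (auto simp: E_def)
    qed
    have "subgroup E ?TP"
    proof (rule m.G.subgroupI)
      have z: "(\<lambda>x\<in>carrier G. 0) \<in> cochain1" using K1.one_closed by (simp add: cochain1_def)
      have "coboundary1 G Z2 (\<lambda>x\<in>carrier G. 0) = m \<one>\<^bsub>?TP\<^esub>"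
        unfolding coboundary1_Z2[OF z] by (auto intro!: restrict_ext)
      with z \<sigma>(1) have "\<one>\<^bsub>?TP\<^esub> \<in> E" by (auto simp: E_def intro!: bexI[of _ "\<lambda>x\<in>carrier G. 0"])
      then show "E \<noteq> {}" by blast
      fix s t assume "s \<in> E" "t \<in> E"
      then obtain P Q where s: "s \<in> carrier ?TP" "t \<in> carrier ?TP" and P: "P \<in> cochain1" "P \<sigma> = 0" "coboundary1 G Z2 P = m s"
        and Q: "Q \<in> cochain1" "Q \<sigma> = 0" "coboundary1 G Z2 Q = m t"
        by (auto simp: E_def)
      let ?R = "P \<otimes>\<^bsub>continuous_functions_group T Z2\<^esub> Q"
      have "?R \<in> cochain1" "coboundary1 G Z2 ?R = m (s \<otimes>\<^bsub>?TP\<^esub> t)"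
        using coboundary1_add[OF P(1) Q(1)] P Q s by simp_all
      moreover have "?R \<sigma> = 0" using P Q \<sigma>(1) by simp
      ultimately show "s \<otimes>\<^bsub>?TP\<^esub> t \<in> E" using s unfolding E_def by blast
    next
      fix t assume "t \<in> E"
      then obtain P where t: "t \<in> carrier ?TP" and P: "P \<in> cochain1" "P \<sigma> = 0" "coboundary1 G Z2 P = m t"
        by (auto simp: E_def)
      have mt: "m t \<in> carrier K2" using m.hom_closed[OF t] by (simp add: cocycles2_iff)
      have "m (inv\<^bsub>?TP\<^esub> t) = inv\<^bsub>C2\<^esub> m t" using t by simp
      also have "\<dots> = inv\<^bsub>K2\<^esub> m t"
        using group.m_inv_consistent[OF comm_group.axioms(2)[OF comm_group_functions_Z2] subgroup_cocycles2] m.hom_closed[OF t]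
        by simp
      also have "\<dots> = m t" using functions_Z2_inv[OF mt] .
      finally show "inv\<^bsub>?TP\<^esub> t \<in> E" using t P by (auto simp: E_def)
    qed (auto simp: E_def)
    then have gen: "generate ?TP S \<subseteq> E"
      using SE by (intro m.G.generate_subgroup_incl)
    obtain t where t: "t \<in> carrier ?TP" "m t = (\<lambda>(g, h)\<in>carrier G \<times> carrier G. (\<Sum>(a, b)\<leftarrow>ps. a g * b h) mod 2)"
      using tensor_of_list[OF m mp ps] by blast
    have dF: "coboundary1 G Z2 F = m t"
      using coboundary_eq_iff[OF F(1), of "\<lambda>g h. \<Sum>(a, b)\<leftarrow>ps. a g * b h"] F(2) t(2) by simp
    then have "m t \<in> coboundaries2" using F(1) unfolding coboundaries2_def cochain1_def by (metis imageI)
    then have "t \<in> kernel ?TP (H2 G T) (cup_hom G T)"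
      using mc[OF t(1)] class2_trivial_iff[of "m t"] t(1) m.hom_closed[OF t(1)] by (simp add: kernel_def)
    then have "t \<in> E" using gen ker by blast
    then obtain P where P: "P \<in> cochain1" "P \<sigma> = 0" "coboundary1 G Z2 P = m t" by (auto simp: E_def)
    \<comment> \<open>Both \<open>P\<close> and \<open>F\<close> have coboundary \<open>m t\<close>, so their sum is a character.\<close>
    let ?D = "\<lambda>g\<in>carrier G. (P g + F g) mod 2"
    have "?D \<in> cochain1" using coboundary1_add(1)[OF P(1) F(1)] by simp
    moreover have "?D (g \<otimes> h) = (?D g + ?D h) mod 2" if "g \<in> carrier G" "h \<in> carrier G" for g h
    proof -
      have "P (g \<otimes> h) = (P g + P h + (\<Sum>(a, b)\<leftarrow>ps. a g * b h)) mod 2"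
        using coboundary_eq_iff[OF P(1), of "\<lambda>g h. \<Sum>(a, b)\<leftarrow>ps. a g * b h"] P(3) t(2) that by simp
      with F(2)[OF that] that show ?thesis by (auto simp: mod_2_eq_iff)
    qed
    ultimately have "?D \<in> character" by (simp add: character_iff del: restrict_apply)
    from \<sigma>(2)[OF this] show False using P(2) \<sigma>(1,3) by simp
  qed
  then show thesis using that by blast
qed

end

section \<open>Quotients isomorphic to the cyclic group of order 4 and to the dihedral group\<close>

text \<open>
  The commutator of \<open>n \<otimes> x\<close> with \<open>g\<close> is a conjugate of the commutator of \<open>n\<close> times that of \<open>x\<close>, hence
  in \<open>N\<close>; and a subgroup that contains the commutators of its elements is normal.
\<close>
lemma (in group) normal_coset_join:
  assumes N: "N \<lhd> G" and x: "x \<in> carrier G" "x \<otimes> x \<in> N"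
    and com: "\<And>g. g \<in> carrier G \<Longrightarrow> inv x \<otimes> inv g \<otimes> x \<otimes> g \<in> N"
  shows "N \<union> (N #> x) \<lhd> G"
proof -
  have sN: "subgroup N G" using N by (simp add: normal_imp_subgroup)
  have NG: "n \<in> carrier G" if "n \<in> N" for n using subgroup.mem_carrier[OF sN that] .
  have mN: "m \<otimes> n \<in> N" if "m \<in> N" "n \<in> N" for m n using subgroup.m_closed[OF sN that] .
  have cN: "g \<otimes> n \<otimes> inv g \<in> N" if "g \<in> carrier G" "n \<in> N" for g n
    using N that by (simp add: normal_inv_iff)
  let ?K = "N \<union> (N #> x)"
  have K: "h \<in> N \<or> (\<exists>n\<in>N. h = n \<otimes> x)" if "h \<in> ?K" for h
    using that by (auto simp: r_coset_def)
  have NxK: "n \<otimes> x \<in> ?K" if "n \<in> N" for n using that by (auto simp: r_coset_def)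
  have prods: "(n \<otimes> x) \<otimes> m = (n \<otimes> (x \<otimes> m \<otimes> inv x)) \<otimes> x"
    "(n \<otimes> x) \<otimes> (m \<otimes> x) = (n \<otimes> (x \<otimes> m \<otimes> inv x)) \<otimes> (x \<otimes> x)"
    "n \<otimes> (m \<otimes> x) = (n \<otimes> m) \<otimes> x" if "n \<in> N" "m \<in> N" for n m
  proof -
    have "inv x \<otimes> (x \<otimes> w) = w" if "w \<in> carrier G" for w using x(1) that by (simp flip: m_assoc)
    then show "(n \<otimes> x) \<otimes> m = (n \<otimes> (x \<otimes> m \<otimes> inv x)) \<otimes> x"
    "(n \<otimes> x) \<otimes> (m \<otimes> x) = (n \<otimes> (x \<otimes> m \<otimes> inv x)) \<otimes> (x \<otimes> x)"
    "n \<otimes> (m \<otimes> x) = (n \<otimes> m) \<otimes> x"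
      using NG[OF that(1)] NG[OF that(2)] x(1) by (simp_all add: m_assoc)
  qed
  have mult: "h \<otimes> k \<in> ?K" if "h \<in> ?K" "k \<in> ?K" for h k
    using K[OF that(1)] K[OF that(2)]
  proof (elim disjE bexE)
    fix n assume "h \<in> N" "n \<in> N" "k = n \<otimes> x"
    then show ?thesis using NxK mN by (simp add: prods(3))
  next
    fix n assume "n \<in> N" "h = n \<otimes> x" "k \<in> N"
    then show ?thesis using NxK mN cN x(1) by (simp add: prods(1))
  next
    fix n m assume "n \<in> N" "h = n \<otimes> x" "m \<in> N" "k = m \<otimes> x"
    then show ?thesis using mN cN x by (simp add: prods(2))
  qed (use mN in auto)
  have KG: "h \<in> carrier G" if "h \<in> ?K" for h
    using K[OF that] NG x(1) by auto
  have sq: "h \<otimes> h \<in> N" if "h \<in> ?K" for h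
    using K[OF that] mN cN x by (auto simp: prods(2))
  show ?thesis
  proof (rule normal_if_commutators)
    show "subgroup ?K G"
    proof (rule subgroupI)
      fix h assume h: "h \<in> ?K"
      have "inv h = inv (h \<otimes> h) \<otimes> h"
        using KG[OF h] by (simp add: inv_mult_group m_assoc)
      then show "inv h \<in> ?K"
        using mult[OF _ h, of "inv (h \<otimes> h)"] subgroup.m_inv_closed[OF sN sq[OF h]] by simp
    next
      show "?K \<noteq> {}" using subgroup.one_closed[OF sN] by blast
    qed (use mult KG in auto)
    fix h g assume h: "h \<in> ?K" and g: "g \<in> carrier G"
    have comN: "inv n \<otimes> inv g \<otimes> n \<otimes> g \<in> N" if "n \<in> N" for n
      using mN[OF subgroup.m_inv_closed[OF sN that] cN[of "inv g", OF _ that]] g NG[OF that]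
      by (simp add: m_assoc)
    have "inv h \<otimes> inv g \<otimes> h \<otimes> g \<in> N"
      using K[OF h]
    proof (elim disjE bexE)
      fix n assume n: "n \<in> N" "h = n \<otimes> x"
      have "inv g \<otimes> (g \<otimes> w) = w" "g \<otimes> (inv g \<otimes> w) = w" "x \<otimes> (inv x \<otimes> w) = w" if "w \<in> carrier G" for w
        using g x(1) that by (simp_all flip: m_assoc)
      then have "inv h \<otimes> inv g \<otimes> h \<otimes> g =
          (inv x \<otimes> (inv n \<otimes> inv g \<otimes> n \<otimes> g) \<otimes> inv (inv x)) \<otimes> (inv x \<otimes> inv g \<otimes> x \<otimes> g)"
        using NG[OF n(1)] g x(1) by (simp add: n(2) inv_mult_group m_assoc)
      then show ?thesis
        using mN[OF cN[OF inv_closed[OF x(1)] comN[OF n(1)]] com[OF g]] by simp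
    qed (rule comN)
    then show "inv h \<otimes> inv g \<otimes> h \<otimes> g \<in> ?K" by blast
  qed
qed

context profinite
begin

lemma character_one: "f \<in> character \<Longrightarrow> f \<one> = 0"
  using character_mult[of f \<one> \<one>] character_value[of f \<one>] by auto

lemma character_kernel:
  assumes f: "f \<in> character"
  shows "{g \<in> carrier G. f g = 0} \<lhd> G"
  unfolding normal_inv_iff
proof (intro conjI ballI)
  have inv: "f (inv g) = f g" if "g \<in> carrier G" for g
    using character_mult[OF f that inv_closed[OF that]] that character_one[OF f]
      character_value[OF f that] character_value[OF f inv_closed[OF that]] by auto
  show "subgroup {g \<in> carrier G. f g = 0} G"
    using character_one[OF f] inv by (intro subgroupI) (auto simp: character_mult[OF f])
  fix g h assume "g \<in> carrier G" "h \<in> {g \<in> carrier G. f g = 0}"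
  then show "g \<otimes> h \<otimes> inv g \<in> {g \<in> carrier G. f g = 0}"
    using inv by (auto simp: character_mult[OF f])
qed

lemma cochain1_fibre_open:
  assumes "f \<in> cochain1"
  shows "openin T {g \<in> carrier G. f g = d}" "closedin T {g \<in> carrier G. f g = d}"
  using openin_kernel[of "{0, 1}" f] assms by (auto simp: cochain1_iff)

lemma character_G2:
  assumes f: "f \<in> character" and \<sigma>: "\<sigma> \<in> G2"
  shows "f \<sigma> = 0"
proof -
  have "G2 \<subseteq> {g \<in> carrier G. f g = 0}"
    using character_kernel[OF f] cochain1_fibre_open(2)[of f 0] f
    by (intro G2_least normal_imp_subgroup) (auto simp: character_iff)
  with \<sigma> show ?thesis by blast
qed

lemma cochain1_pullback:
  assumes "N \<lhd> G" "openin T N" "\<And>c. c \<in> carrier (G Mod N) \<Longrightarrow> a c \<in> {0, 1}"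
  shows "(\<lambda>g\<in>carrier G. a (N #> g)) \<in> cochain1"
proof -
  have sN: "subgroup N G" using assms(1) by (simp add: normal_imp_subgroup)
  have "continuous_map T (discrete_topology {0, 1}) (\<lambda>g. a (N #> g))"
  proof (rule continuous_map_coset_invariant[OF sN assms(2)])
    show "a (N #> g) \<in> {0, 1}" if "g \<in> carrier G" for g
      using assms(3) that by (simp add: carrier_FactGroup)
    show "a (N #> (n \<otimes> g)) = a (N #> g)" if "n \<in> N" "g \<in> carrier G" for n g
    proof -
      have "n \<otimes> g \<in> N #> g" using that by (auto simp: r_coset_def)
      from repr_independence[OF this that(2) sN] show ?thesis by simp
    qed
  qed
  then show ?thesis by (simp add: cochain1_iff restrict_continuous_map)
qed

definition admissible :: "'a set \<Rightarrow> bool" where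
  "admissible N \<longleftrightarrow> N \<lhd> G \<and> openin T N \<and>
     (trivial_group (G Mod N) \<or> G Mod N \<cong> integer_mod_group 4 \<or> G Mod N \<cong> dihedral4)"

text \<open>
  For \<open>f = f'\<close> the carry \<open>f g f h\<close> is that of binary addition, so \<open>f + 2 F\<close> is a homomorphism to
  \<open>\<int>/4\<close>.
\<close>
lemma admissible_Z4:
  assumes f: "f \<in> character" and F: "splits_cup F f f" and a: "a \<in> carrier G" "f a = 1"
  shows "admissible {g \<in> carrier G. f g = 0 \<and> F g = 0}"
proof -
  define \<phi> where "\<phi> = (\<lambda>g. f g + 2 * F g)"
  have Fc: "F \<in> cochain1" using F by (simp add: splits_cup_def)
  have v: "f g = 0 \<or> f g = 1" "F g = 0 \<or> F g = 1" if "g \<in> carrier G" for g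
    using that f Fc by (simp_all add: character_value cochain1_value)
  have hom: "\<phi> (g \<otimes> h) = (\<phi> g + \<phi> h) mod 4" if "g \<in> carrier G" "h \<in> carrier G" for g h
    using v[OF that(1)] v[OF that(2)] character_mult[OF f that] F that
    by (auto simp: \<phi>_def splits_cup_def)
  have "\<phi> g \<in> carrier (integer_mod_group 4)" if "g \<in> carrier G" for g
    using v[OF that] by (auto simp: \<phi>_def carrier_integer_mod_group)
  then interpret \<phi>: group_hom G "integer_mod_group 4" \<phi>
    using hom by (auto simp: group_hom_def group_hom_axioms_def hom_def is_group)
  have ker: "kernel G (integer_mod_group 4) \<phi> = {g \<in> carrier G. f g = 0 \<and> F g = 0}"
    using v by (force simp: kernel_def \<phi>_def)
  have "\<phi> ` carrier G = carrier (integer_mod_group 4)"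
  proof
    show "\<phi> ` carrier G \<subseteq> carrier (integer_mod_group 4)" by auto
    have u: "\<phi> a = 1 \<or> \<phi> a = 3" using v(2)[OF a(1)] a(2) by (auto simp: \<phi>_def)
    have "carrier (integer_mod_group 4) = {0, 1, 2, 3}" by (auto simp: carrier_integer_mod_group)
    also have "\<dots> \<subseteq> \<phi> ` {\<one>, a, a \<otimes> a, a \<otimes> a \<otimes> a}"
      using u a(1) hom[of a a] hom[of "a \<otimes> a" a] \<phi>.hom_one by (elim disjE) simp_all
    finally show "carrier (integer_mod_group 4) \<subseteq> \<phi> ` carrier G" using a(1) by blast
  qed
  then have "G Mod {g \<in> carrier G. f g = 0 \<and> F g = 0} \<cong> integer_mod_group 4"
    using \<phi>.FactGroup_iso ker by simp
  moreover have "{g \<in> carrier G. f g = 0 \<and> F g = 0} \<lhd> G" using \<phi>.normal_kernel ker by simp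
  moreover have "openin T {g \<in> carrier G. f g = 0 \<and> F g = 0}"
    using openin_Int[OF cochain1_fibre_open(1)[of f 0] cochain1_fibre_open(1)[OF Fc, of 0]] f
    by (simp add: character_iff Collect_conj_eq Int_left_commute Int_assoc)
  ultimately show ?thesis by (simp add: admissible_def)
qed

text \<open>
  In the coordinates \<open>r\<^sup>i s\<^sup>j\<close> the unitriangular matrix with entries \<open>f, f', F\<close> is the element with
  \<open>i = f' + 2 F\<close> and \<open>j = f + f'\<close>: the product of \<open>D\<^sub>4\<close> adds to \<open>i div 2\<close> the carry of the lowest bits
  and, if \<open>j = 1\<close>, the lowest bit of the second factor, which together are \<open>f g f' h\<close>.
\<close>
lemma admissible_D4:
  assumes f: "f \<in> character" "f' \<in> character" and F: "splits_cup F f f'"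
    and a: "a \<in> carrier G" "f a = 1" and b: "b \<in> carrier G" "f' b = 1" and c: "c \<in> carrier G" "f c \<noteq> f' c"
  shows "admissible {g \<in> carrier G. f g = 0 \<and> f' g = 0 \<and> F g = 0}"
proof -
  define \<phi> where "\<phi> = (\<lambda>g. (f' g + 2 * F g, (f g + f' g) mod 2))"
  have Fc: "F \<in> cochain1" using F by (simp add: splits_cup_def)
  have v: "f g = 0 \<or> f g = 1" "f' g = 0 \<or> f' g = 1" "F g = 0 \<or> F g = 1" if "g \<in> carrier G" for g
    using that f Fc by (simp_all add: character_value cochain1_value)
  have hom: "\<phi> (g \<otimes> h) = \<phi> g \<otimes>\<^bsub>dihedral4\<^esub> \<phi> h" if "g \<in> carrier G" "h \<in> carrier G" for g h
  proof -
    have "F (g \<otimes> h) = (F g + F h + f g * f' h) mod 2" using F that by (simp add: splits_cup_def)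
    then show ?thesis
      using v[OF that(1)] v[OF that(2)] character_mult[OF f(1) that] character_mult[OF f(2) that]
      unfolding \<phi>_def by (elim disjE) (simp_all add: dihedral4_simps)
  qed
  have \<phi>_carrier: "\<phi> g \<in> carrier dihedral4" if "g \<in> carrier G" for g
    using v[OF that] by (auto simp: \<phi>_def dihedral4_simps)
  interpret \<phi>: group_hom G dihedral4 \<phi>
    using hom \<phi>_carrier group_dihedral4 by (auto simp: group_hom_def group_hom_axioms_def hom_def is_group)
  have ker: "kernel G dihedral4 \<phi> = {g \<in> carrier G. f g = 0 \<and> f' g = 0 \<and> F g = 0}"
    using v by (force simp: kernel_def \<phi>_def dihedral4_simps)
  \<comment> \<open>The elements \<open>r\<close> and \<open>s\<close> are chosen to map to a rotation of order four and to a reflection.\<close>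
  obtain r where r: "r \<in> carrier G" "f r = 1" "f' r = 1"
  proof (cases "f b = 1 \<or> f' a = 1")
    case True
    then show thesis using that a b by blast
  next
    case False
    then have "f (a \<otimes> b) = 1" "f' (a \<otimes> b) = 1"
      using a b v[OF a(1)] v[OF b(1)] character_mult[OF f(1) a(1) b(1)] character_mult[OF f(2) a(1) b(1)] by auto
    then show thesis using that a(1) b(1) by blast
  qed
  obtain s where s: "s \<in> carrier G" "f s = 1" "f' s = 0"
  proof (cases "f c = 1")
    case True
    then show thesis using c v[OF c(1)] that by auto
  next
    case False
    then have "f (r \<otimes> c) = 1" "f' (r \<otimes> c) = 0"
      using c v[OF c(1)] r character_mult[OF f(1) r(1) c(1)] character_mult[OF f(2) r(1) c(1)] by auto
    then show thesis using that r(1) c(1) by blast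
  qed
  have "\<phi> ` carrier G = carrier dihedral4"
  proof
    show "\<phi> ` carrier G \<subseteq> carrier dihedral4" by auto
    have u: "\<phi> r = (1, 0) \<or> \<phi> r = (3, 0)" using v(3)[OF r(1)] r by (auto simp: \<phi>_def)
    have w: "\<phi> s = (0, 1) \<or> \<phi> s = (2, 1)" using v(3)[OF s(1)] s by (auto simp: \<phi>_def)
    have "{0..<4} = {0, 1, 2, 3 :: int}" "{0..<2} = {0, 1 :: int}" by auto
    then have "carrier dihedral4 = {0, 1, 2, 3} \<times> {0, 1}" by (simp add: dihedral4_simps)
    also have "\<dots> = {(0, 0), (1, 0), (2, 0), (3, 0), (0, 1), (1, 1), (2, 1), (3, 1)}" by blast
    also have "\<dots> \<subseteq> \<phi> ` {\<one>, r, r \<otimes> r, r \<otimes> r \<otimes> r, s, r \<otimes> s, r \<otimes> r \<otimes> s, r \<otimes> r \<otimes> r \<otimes> s}"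
      using u w r(1) s(1) \<phi>.hom_one by (elim disjE) (simp_all add: dihedral4_simps)
    finally show "carrier dihedral4 \<subseteq> \<phi> ` carrier G" using r(1) s(1) by blast
  qed
  then have "G Mod {g \<in> carrier G. f g = 0 \<and> f' g = 0 \<and> F g = 0} \<cong> dihedral4"
    using \<phi>.FactGroup_iso ker by simp
  moreover have "{g \<in> carrier G. f g = 0 \<and> f' g = 0 \<and> F g = 0} \<lhd> G" using \<phi>.normal_kernel ker by simp
  moreover have "openin T ({g \<in> carrier G. f g = 0} \<inter> {g \<in> carrier G. f' g = 0} \<inter> {g \<in> carrier G. F g = 0})"
    using f Fc by (intro openin_Int cochain1_fibre_open) (simp_all add: character_iff)
  moreover have "{g \<in> carrier G. f g = 0} \<inter> {g \<in> carrier G. f' g = 0} \<inter> {g \<in> carrier G. F g = 0} = 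
      {g \<in> carrier G. f g = 0 \<and> f' g = 0 \<and> F g = 0}" by blast
  ultimately show ?thesis by (simp add: admissible_def)
qed

text \<open>
  If \<open>x\<close> is central of order two modulo \<open>N\<close>, then \<open>N \<union> N x\<close> is a normal subgroup, which by
  maximality contains \<open>\<sigma>\<close>.
\<close>
lemma maximal_join:
  assumes N: "N \<lhd> G" "\<And>M. M \<lhd> G \<Longrightarrow> N \<subset> M \<Longrightarrow> \<sigma> \<in> M" "\<sigma> \<notin> N"
    and x: "x \<in> carrier G" "x \<otimes> x \<in> N" "\<And>g. g \<in> carrier G \<Longrightarrow> inv x \<otimes> inv g \<otimes> x \<otimes> g \<in> N"
  shows "x \<in> N \<or> N #> x = N #> \<sigma>"
proof (rule disjCI)
  assume x': "N #> x \<noteq> N #> \<sigma>"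
  have sN: "subgroup N G" using N(1) by (simp add: normal_imp_subgroup)
  show "x \<in> N"
  proof (rule ccontr)
    assume "x \<notin> N"
    then have "N \<subset> N \<union> (N #> x)" using rcos_self[OF x(1) sN] by blast
    with N(2) normal_coset_join[OF N(1) x] have "\<sigma> \<in> N \<union> (N #> x)" by blast
    with N(3) have "\<sigma> \<in> N #> x" by blast
    from repr_independence[OF this x(1) sN] x' show False by simp
  qed
qed

section \<open>Characters and split cup products that do not vanish at a given element\<close>

text \<open>
  In the quotient by a maximal \<open>N\<close> that contains the second term and omits \<open>\<sigma>\<close>, all elements have order
  at most two; by maximality \<open>N\<close> has index two, and the indicator of its complement is a character.
\<close>
lemma character_separation:
  assumes \<sigma>: "\<sigma> \<in> carrier G" "\<sigma> \<notin> G2"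
  obtains f where "f \<in> character" "f \<sigma> = 1"
proof -
  obtain N where N: "N \<lhd> G" "openin T N" "G2 \<subseteq> N" "\<sigma> \<notin> N"
    "\<And>M. M \<lhd> G \<Longrightarrow> N \<subset> M \<Longrightarrow> \<sigma> \<in> M"
    using maximal_open_normal_separation[OF G2_normal G2_closed \<sigma>] by blast
  have sN: "subgroup N G" using N(1) by (simp add: normal_imp_subgroup)
  have sq: "g \<otimes> g \<in> N" if "g \<in> carrier G" for g using G2_squares[OF that] N(3) by blast
  have com: "inv x \<otimes> inv g \<otimes> x \<otimes> g \<in> N" if "x \<in> carrier G" "g \<in> carrier G" for x g
    using that by (subst commutator_eq_squares) (auto intro!: subgroup.m_closed[OF sN] sq)
  have cosets: "N #> x = N #> \<sigma>" if "x \<in> carrier G" "x \<notin> N" for x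
    using maximal_join[OF N(1,5,4) that(1) sq[OF that(1)] com[OF that(1)]] that(2) by blast
  have mem: "g \<in> N \<longleftrightarrow> N #> g = N" if "g \<in> carrier G" for g
    using coset_join1[OF _ that sN] coset_join2[OF that sN] by blast
  define f :: "'a \<Rightarrow> int" where "f = (\<lambda>g\<in>carrier G. if N #> g = N then 0 else 1)"
  have "f \<in> cochain1"
    unfolding f_def using cochain1_pullback[OF N(1,2), of "\<lambda>c. if c = N then 0 else 1"] by simp
  moreover have "f (g \<otimes> h) = (f g + f h) mod 2" if gh: "g \<in> carrier G" "h \<in> carrier G" for g h
  proof -
    have "g \<otimes> h \<in> N \<longleftrightarrow> (g \<in> N \<longleftrightarrow> h \<in> N)"
    proof (cases "g \<in> N")
      case True
      have "h = inv g \<otimes> (g \<otimes> h)" using gh by (simp flip: m_assoc)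
      then show ?thesis using True subgroup.m_closed[OF sN] subgroup.m_inv_closed[OF sN] by metis
    next
      case False
      show ?thesis
      proof (cases "h \<in> N")
        case True
        have "g = (g \<otimes> h) \<otimes> inv h" using gh by (simp add: m_assoc)
        then show ?thesis using True False subgroup.m_closed[OF sN] subgroup.m_inv_closed[OF sN] by metis
      next
        case F': False
        have "N #> g = N #> h" using cosets gh False F' by metis
        then have "g \<in> N #> h" using rcos_self[OF gh(1) sN] by simp
        then obtain n where n: "n \<in> N" "g = n \<otimes> h" by (auto simp: r_coset_def)
        then have "g \<otimes> h = n \<otimes> (h \<otimes> h)" using gh subgroup.mem_carrier[OF sN] by (simp add: m_assoc)
        then show ?thesis using False F' n(1) sq[OF gh(2)] subgroup.m_closed[OF sN] by simp
      qed
    qed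
    then show ?thesis using gh by (simp add: f_def mem[symmetric])
  qed
  ultimately have "f \<in> character" by (simp add: character_iff)
  moreover have "f \<sigma> = 1" using \<sigma>(1) N(4) by (simp add: f_def mem[symmetric])
  ultimately show thesis by (rule that)
qed

text \<open>
  Modulo an \<open>N\<close> that contains the third term, the second term is central of exponent two. If \<open>N\<close> is
  maximal without \<open>\<sigma>\<close>, then its image in \<open>G/N\<close>, which contains all squares, is generated by the
  image of \<open>\<sigma>\<close>.
\<close>
lemma cup_splitting_separation:
  assumes grt: "galois_relation_type_2 G T" and \<sigma>: "\<sigma> \<in> G2" "\<sigma> \<notin> G3"
  obtains f f' F where "f \<in> character" "f' \<in> character" "splits_cup F f f'" "F \<sigma> = 1"
proof -
  have \<sigma>G: "\<sigma> \<in> carrier G" using G2_carrier \<sigma>(1) .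
  obtain N where N: "N \<lhd> G" "openin T N" "G3 \<subseteq> N" "\<sigma> \<notin> N"
    "\<And>M. M \<lhd> G \<Longrightarrow> N \<subset> M \<Longrightarrow> \<sigma> \<in> M"
    using maximal_open_normal_separation[OF G3_normal G3_closed \<sigma>G \<sigma>(2)] by blast
  interpret N: normal N G by (rule N(1))
  have sN: "subgroup N G" by (rule N.is_subgroup)
  have G2_cosets: "N #> x \<in> {N, N #> \<sigma>}" if "x \<in> G2" for x
    using maximal_join[OF N(1,5,4) G2_carrier[OF that]] G3_squares[OF that] G3_commutators[OF that] N(3)
      coset_join2[OF G2_carrier[OF that] sN] by blast
  interpret Q: group "G Mod N" by (rule N.factorgroup_is_group)
  have mem: "g \<in> N \<longleftrightarrow> N #> g = N" if "g \<in> carrier G" for g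
    using coset_join1[OF _ that sN] coset_join2[OF that sN] by blast
  interpret Q: central_involution "G Mod N" "N #> \<sigma>"
  proof
    show "N #> \<sigma> \<in> carrier (G Mod N)" using \<sigma>G by (auto simp: carrier_FactGroup)
    show "N #> \<sigma> \<noteq> \<one>\<^bsub>G Mod N\<^esub>" using mem[OF \<sigma>G] N(4) by simp
    have "\<sigma> \<otimes> \<sigma> \<in> N" using G3_squares[OF \<sigma>(1)] N(3) by blast
    then show "(N #> \<sigma>) \<otimes>\<^bsub>G Mod N\<^esub> (N #> \<sigma>) = \<one>\<^bsub>G Mod N\<^esub>" using \<sigma>G mem by (simp add: N.rcos_sum)
    fix c assume "c \<in> carrier (G Mod N)"
    then obtain g where g: "g \<in> carrier G" "c = N #> g" by (auto simp: carrier_FactGroup)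
    have "inv g \<otimes> (g \<otimes> w) = w" "\<sigma> \<otimes> (inv \<sigma> \<otimes> w) = w" "g \<otimes> (inv g \<otimes> w) = w" if "w \<in> carrier G" for w
      using g \<sigma>G that by (simp_all flip: m_assoc)
    then have "(g \<otimes> \<sigma>) \<otimes> (inv \<sigma> \<otimes> inv g \<otimes> \<sigma> \<otimes> g) = \<sigma> \<otimes> g"
      using g(1) \<sigma>G by (simp add: m_assoc)
    moreover have "inv \<sigma> \<otimes> inv g \<otimes> \<sigma> \<otimes> g \<in> N" using G3_commutators[OF \<sigma>(1) g(1)] N(3) by blast
    ultimately have "N #> (\<sigma> \<otimes> g) = (N #> (g \<otimes> \<sigma>)) <#> N"
      using N.rcos_sum[of "g \<otimes> \<sigma>" "inv \<sigma> \<otimes> inv g \<otimes> \<sigma> \<otimes> g"] g(1) \<sigma>G mem[of "inv \<sigma> \<otimes> inv g \<otimes> \<sigma> \<otimes> g"] by simp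
    also have "\<dots> = N #> (g \<otimes> \<sigma>)"
      using Q.r_one[of "N #> (g \<otimes> \<sigma>)"] g(1) \<sigma>G by (simp add: carrier_FactGroup)
    finally show "(N #> \<sigma>) \<otimes>\<^bsub>G Mod N\<^esub> c = c \<otimes>\<^bsub>G Mod N\<^esub> (N #> \<sigma>)"
      using g \<sigma>G by (simp add: N.rcos_sum)
    show "c \<otimes>\<^bsub>G Mod N\<^esub> c \<in> {\<one>\<^bsub>G Mod N\<^esub>, N #> \<sigma>}"
      using G2_cosets[OF G2_squares[OF g(1)]] g by (simp add: N.rcos_sum)
  qed
  have "finite (carrier (G Mod N))" using finite_rcosets[OF sN N(2)] by (simp add: FactGroup_def)
  then obtain F ps where F: "Q.bilinear_coboundary_on (carrier (G Mod N)) F ps"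
    by (rule Q.bilinear_coboundary_exists)
  define pull where "pull = (\<lambda>a :: 'a set \<Rightarrow> int. \<lambda>g\<in>carrier G. a (N #> g))"
  have cg: "N #> g \<in> carrier (G Mod N)" if "g \<in> carrier G" for g using that by (auto simp: carrier_FactGroup)
  have pull_char: "pull a \<in> character" if "Q.character_on (carrier (G Mod N)) a" for a
  proof -
    have "pull a \<in> cochain1"
      unfolding pull_def using that by (intro cochain1_pullback[OF N(1,2)]) (simp add: Q.character_on_def)
    moreover have "pull a (g \<otimes> h) = (pull a g + pull a h) mod 2" if gh: "g \<in> carrier G" "h \<in> carrier G" for g h
      using that cg[OF gh(1)] cg[OF gh(2)] \<open>Q.character_on (carrier (G Mod N)) a\<close> N.rcos_sum[OF gh]
      by (simp add: pull_def Q.character_on_def) metis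
    ultimately show ?thesis by (simp add: character_iff)
  qed
  let ?ps = "map (\<lambda>(a, b). (pull a, pull b)) ps"
  show thesis
  proof (rule cup_kernel_condition[OF grt, of ?ps "pull F" \<sigma>])
    show "\<forall>(a, b)\<in>set ?ps. a \<in> character \<and> b \<in> character"
      using F pull_char by (auto simp: Q.bilinear_coboundary_on_def)
    show "pull F \<in> cochain1"
      unfolding pull_def using F by (intro cochain1_pullback[OF N(1,2)]) (simp add: Q.bilinear_coboundary_on_def)
    show "pull F \<sigma> = 1" using F \<sigma>G by (simp add: pull_def Q.bilinear_coboundary_on_def)
    show "\<sigma> \<in> carrier G" by (rule \<sigma>G)
    show "f \<sigma> = 0" if "f \<in> character" for f using character_G2[OF that \<sigma>(1)] .
    fix g h assume gh: "g \<in> carrier G" "h \<in> carrier G"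
    have "(\<Sum>(a, b)\<leftarrow>?ps. a g * b h) = (\<Sum>(a, b)\<leftarrow>ps. a (N #> g) * b (N #> h))"
      using gh by (simp add: pull_def case_prod_unfold o_def)
    moreover have "F ((N #> g) <#> (N #> h)) = (F (N #> g) + F (N #> h) + (\<Sum>(a, b)\<leftarrow>ps. a (N #> g) * b (N #> h))) mod 2"
      using F cg[OF gh(1)] cg[OF gh(2)] by (simp add: Q.bilinear_coboundary_on_def)
    ultimately show "pull F (g \<otimes> h) = (pull F g + pull F h + (\<Sum>(a, b)\<leftarrow>?ps. a g * b h)) mod 2"
      using gh by (simp add: pull_def N.rcos_sum)
  qed (rule that)
qed

end

section \<open>The case of a single nonzero character\<close>

text \<open>
  A nontrivial finite \<open>2\<close>-group has a subgroup of index two by Sylow's theorem, and such a subgroup is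
  the kernel of a character.
\<close>
lemma (in group) two_power_quotient_character:
  assumes N: "N \<lhd> G" and ord: "order (G Mod N) = 2 ^ n" and neq: "N \<noteq> carrier G"
  obtains \<eta> :: "'a \<Rightarrow> int" and a where "\<And>g. g \<in> carrier G \<Longrightarrow> \<eta> g \<in> {0, 1}"
    "\<And>g h. g \<in> carrier G \<Longrightarrow> h \<in> carrier G \<Longrightarrow> \<eta> (g \<otimes> h) = (\<eta> g + \<eta> h) mod 2"
    "\<And>g. g \<in> N \<Longrightarrow> \<eta> g = 0" "a \<in> carrier G" "\<eta> a = 1"
proof -
  interpret N: normal N G by (rule N)
  interpret Q: group "G Mod N" by (rule N.factorgroup_is_group)
  have sN: "subgroup N G" by (rule N.is_subgroup)
  have fin: "finite (carrier (G Mod N))" using ord by (intro card_ge_0_finite) (simp add: order_def)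
  have "n \<noteq> 0"
  proof
    assume "n = 0"
    then obtain c where c: "carrier (G Mod N) = {c}" using ord by (auto simp: order_def card_1_singleton_iff)
    have "g \<in> N" if "g \<in> carrier G" for g
    proof -
      have "N #> g \<in> carrier (G Mod N)" "N \<in> carrier (G Mod N)"
        using that Q.one_closed by (auto simp: carrier_FactGroup)
      with c have "N #> g = N" by simp
      then show ?thesis using coset_join1[OF _ that sN] by simp
    qed
    with neq subgroup.subset[OF sN] show False by blast
  qed
  then obtain k where k: "n = Suc k" by (metis not0_implies_Suc)
  then obtain H where H: "subgroup H (G Mod N)" "card H = 2 ^ k"
    using sylow_thm[of 2 "G Mod N" k 2] fin ord Q.is_group by auto
  have "card (rcosets\<^bsub>G Mod N\<^esub> H) * 2 ^ k = 2 * 2 ^ k"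
    using Q.lagrange[OF H(1)] H(2) ord k by simp
  then have idx: "card (rcosets\<^bsub>G Mod N\<^esub> H) = 2" by simp
  have same: "H #>\<^bsub>G Mod N\<^esub> c = H #>\<^bsub>G Mod N\<^esub> d"
    if "c \<in> carrier (G Mod N)" "d \<in> carrier (G Mod N)" "c \<notin> H" "d \<notin> H" for c d
  proof (rule ccontr)
    assume ne: "H #>\<^bsub>G Mod N\<^esub> c \<noteq> H #>\<^bsub>G Mod N\<^esub> d"
    have "H = H #>\<^bsub>G Mod N\<^esub> \<one>\<^bsub>G Mod N\<^esub>"
      using Q.coset_mult_one[of H] subgroup.subset[OF H(1)] by simp
    then have "{H, H #>\<^bsub>G Mod N\<^esub> c, H #>\<^bsub>G Mod N\<^esub> d} \<subseteq> rcosets\<^bsub>G Mod N\<^esub> H"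
      using that(1,2) Q.one_closed unfolding RCOSETS_def by blast
    moreover have "H #>\<^bsub>G Mod N\<^esub> c \<noteq> H" "H #>\<^bsub>G Mod N\<^esub> d \<noteq> H"
      using that Q.coset_join1[OF _ _ H(1)] by blast+
    ultimately have "card {H, H #>\<^bsub>G Mod N\<^esub> c, H #>\<^bsub>G Mod N\<^esub> d} \<le> 2" 
      using idx by (metis card.infinite card_mono zero_neq_numeral)
    with ne \<open>H #>\<^bsub>G Mod N\<^esub> c \<noteq> H\<close> \<open>H #>\<^bsub>G Mod N\<^esub> d \<noteq> H\<close> show False by simp
  qed
  have mult: "c \<otimes>\<^bsub>G Mod N\<^esub> d \<in> H \<longleftrightarrow> (c \<in> H \<longleftrightarrow> d \<in> H)"
    if cd: "c \<in> carrier (G Mod N)" "d \<in> carrier (G Mod N)" for c d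
  proof (cases "c \<in> H \<or> d \<in> H")
    case True
    have "d = inv\<^bsub>G Mod N\<^esub> c \<otimes>\<^bsub>G Mod N\<^esub> (c \<otimes>\<^bsub>G Mod N\<^esub> d)" "c = (c \<otimes>\<^bsub>G Mod N\<^esub> d) \<otimes>\<^bsub>G Mod N\<^esub> inv\<^bsub>G Mod N\<^esub> d"
      using cd Q.m_assoc[of "inv\<^bsub>G Mod N\<^esub> c" c d] Q.m_assoc[of c d "inv\<^bsub>G Mod N\<^esub> d"]
       Q.l_inv[of c] Q.r_inv[of d] Q.l_one[of d] Q.r_one[of c] by simp_all
    then show ?thesis
      using True subgroup.m_closed[OF H(1)] subgroup.m_inv_closed[OF H(1)] by metis
  next
    case False
    have "inv\<^bsub>G Mod N\<^esub> d \<notin> H"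
      using False subgroup.m_inv_closed[OF H(1), of "inv\<^bsub>G Mod N\<^esub> d"] Q.inv_inv[OF cd(2)] by auto
    then have "H #>\<^bsub>G Mod N\<^esub> c = H #>\<^bsub>G Mod N\<^esub> inv\<^bsub>G Mod N\<^esub> d"
      using False by (intro same cd Q.inv_closed) auto
    then have "c \<in> H #>\<^bsub>G Mod N\<^esub> inv\<^bsub>G Mod N\<^esub> d" using Q.rcos_self[OF cd(1) H(1)] by simp
    then show ?thesis
      using subgroup.rcos_module_imp[OF H(1) Q.is_group Q.inv_closed[OF cd(2)], of c] False Q.inv_inv[OF cd(2)]
      by simp
  qed
  define \<eta> :: "'a \<Rightarrow> int" where "\<eta> = (\<lambda>g. if N #> g \<in> H then 0 else 1)"
  have cg: "N #> g \<in> carrier (G Mod N)" if "g \<in> carrier G" for g using that by (auto simp: carrier_FactGroup)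
  have "\<exists>c\<in>carrier (G Mod N). c \<notin> H"
  proof (rule ccontr)
    assume "\<not> ?thesis"
    then have "H = carrier (G Mod N)" using subgroup.subset[OF H(1)] by blast
    then show False using H(2) ord k by (simp add: order_def)
  qed
  then obtain a where a: "a \<in> carrier G" "N #> a \<notin> H" by (auto simp: carrier_FactGroup)
  show thesis
  proof (rule that)
    show "\<eta> g \<in> {0, 1}" for g by (simp add: \<eta>_def)
    show "\<eta> (g \<otimes> h) = (\<eta> g + \<eta> h) mod 2" if "g \<in> carrier G" "h \<in> carrier G" for g h
      using mult[OF cg[OF that(1)] cg[OF that(2)]] that by (simp add: \<eta>_def N.rcos_sum)
    show "\<eta> g = 0" if "g \<in> N" for g
      using subgroup.one_closed[OF H(1)] that coset_join2[OF N.mem_carrier[OF that] sN that] by (simp add: \<eta>_def)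
    show "a \<in> carrier G" "\<eta> a = 1" using a by (simp_all add: \<eta>_def)
  qed
qed

context profinite
begin

lemma invariant_cochain1:
  assumes "N \<lhd> G" "openin T N" "\<And>g. g \<in> carrier G \<Longrightarrow> a g \<in> {0, 1}"
    "\<And>n g. n \<in> N \<Longrightarrow> g \<in> carrier G \<Longrightarrow> a (n \<otimes> g) = a g"
  shows "(\<lambda>g\<in>carrier G. a g) \<in> cochain1"
  using continuous_map_coset_invariant[OF normal_imp_subgroup[OF assms(1)] assms(2), of a "{0, 1}"] assms(3,4)
  by (simp add: cochain1_iff restrict_continuous_map)

text \<open>
  Let \<open>M\<close> be the kernel of \<open>x\<close>. As \<open>G(2)\<close> is not isomorphic to \<open>G/M\<close>, some open normal
  subgroup \<open>N\<close> of \<open>2\<close>-power index does not contain \<open>M\<close>; a character of \<open>G/N\<close> can only be \<open>x\<close>, so \<open>N \<subset> M\<close>. The \<open>2\<close>-group \<open>M/N\<close> has a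
  character \<open>\<eta>\<close>, and conjugation by \<open>b \<notin> M\<close> acts on the characters of \<open>M/N\<close> as an involution,
  because \<open>b\<^sup>2 \<in> M\<close>. So \<open>\<eta>\<close> or the sum of \<open>\<eta>\<close> and its conjugate is a nonzero invariant character \<open>\<theta>\<close>.
  Put \<open>A (m b\<^sup>e) = \<theta> m\<close>. Then the coboundary of \<open>A\<close> is \<open>\<theta> (b\<^sup>2)\<close> times \<open>x \<union> x\<close>. If \<open>\<theta> (b\<^sup>2)\<close> were zero,
  then \<open>A\<close> would be a second nonzero character.
\<close>
lemma unique_character_self_splits:
  assumes pro2: "\<not> maximal_pro2_quotient G T \<cong> integer_mod_group 2"
    and x: "x \<in> character" "b \<in> carrier G" "x b = 1"
    and unique: "\<And>f g. f \<in> character \<Longrightarrow> g \<in> carrier G \<Longrightarrow> f g = 1 \<Longrightarrow> f = x"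
  shows "\<exists>F. splits_cup F x x"
proof -
  define M where "M = {g \<in> carrier G. x g = 0}"
  have M: "M \<lhd> G" "openin T M"
    using character_kernel[OF x(1)] cochain1_fibre_open(1)[of x 0] x(1) by (auto simp: M_def character_iff)
  have sM: "subgroup M G" using M(1) by (simp add: normal_imp_subgroup)
  have bM: "b \<notin> M" using x by (simp add: M_def)
  have xv: "x g = 0 \<or> x g = 1" if "g \<in> carrier G" for g using character_value[OF x(1) that] .
  obtain N n where N: "N \<lhd> G" "openin T N" "order (G Mod N) = 2 ^ n" "\<not> M \<subseteq> N"
  proof (rule ccontr)
    assume "\<not> thesis"
    with that have *: "M \<subseteq> N" if "N \<lhd> G" "openin T N" "order (G Mod N) = 2 ^ n" for N and n :: nat
      using that by blast
    interpret x: group_hom G Z2 x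
      using x(1) xv by (auto simp: group_hom_def group_hom_axioms_def hom_def is_group character_mult carrier_Z2)
    have ker: "kernel G Z2 x = M" by (auto simp: kernel_def M_def)
    have "{x \<one>, x b} \<subseteq> x ` carrier G" using x(2) by blast
    then have "carrier Z2 \<subseteq> x ` carrier G"
      using x(3) character_one[OF x(1)] by (simp only: carrier_Z2)
    moreover have "x ` carrier G \<subseteq> carrier Z2" using xv by (auto simp: carrier_Z2)
    ultimately have "x ` carrier G = carrier Z2" by blast
    then have iso: "G Mod M \<cong> Z2" using x.FactGroup_iso ker by simp
    then have "order (G Mod M) = card (carrier Z2)"
      unfolding is_iso_def iso_def order_def using bij_betw_same_card by blast
    then have "order (G Mod M) = 2 ^ 1" by (simp add: carrier_Z2)
    with M have "pro2_kernel G T \<subseteq> M" unfolding pro2_kernel_def by blast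
    moreover have "M \<subseteq> pro2_kernel G T" unfolding pro2_kernel_def using * by blast
    ultimately have "maximal_pro2_quotient G T = G Mod M" by (simp add: maximal_pro2_quotient_def)
    with iso pro2 show False by simp
  qed
  have sN: "subgroup N G" using N(1) by (simp add: normal_imp_subgroup)
  have NG: "m \<in> carrier G" if "m \<in> N" for m using subgroup.mem_carrier[OF sN that] .
  have "N \<noteq> carrier G" using N(4) subgroup.subset[OF sM] by blast
  then obtain \<eta>0 a0 where \<eta>0: "\<And>g. g \<in> carrier G \<Longrightarrow> \<eta>0 g \<in> {0, 1 :: int}"
    "\<And>g h. g \<in> carrier G \<Longrightarrow> h \<in> carrier G \<Longrightarrow> \<eta>0 (g \<otimes> h) = (\<eta>0 g + \<eta>0 h) mod 2"
    "\<And>g. g \<in> N \<Longrightarrow> \<eta>0 g = 0" "a0 \<in> carrier G" "\<eta>0 a0 = 1"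
    by (rule two_power_quotient_character[OF N(1,3)]) (rule that, assumption+)
  have inv0: "\<eta>0 (m \<otimes> g) = \<eta>0 g" if "m \<in> N" "g \<in> carrier G" for m g
    using \<eta>0(1)[OF that(2)] \<eta>0(2)[OF NG[OF that(1)] that(2)] \<eta>0(3)[OF that(1)] by auto
  have "(\<lambda>g\<in>carrier G. \<eta>0 g) \<in> cochain1"
    by (rule invariant_cochain1[of N \<eta>0, OF N(1,2) \<eta>0(1) inv0])
  then have "(\<lambda>g\<in>carrier G. \<eta>0 g) \<in> character" using \<eta>0(2) by (simp add: character_iff)
  then have "(\<lambda>g\<in>carrier G. \<eta>0 g) = x" by (rule unique[OF _ \<eta>0(4)]) (use \<eta>0(4,5) in simp)
  then have NM: "N \<subseteq> M" using \<eta>0(3) NG by (force simp: M_def fun_eq_iff)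
  define GM where "GM = G\<lparr>carrier := M\<rparr>"
  interpret GM: group GM unfolding GM_def using subgroup.subgroup_is_group[OF sM is_group] .
  have GM_simps: "carrier GM = M" "g \<otimes>\<^bsub>GM\<^esub> h = g \<otimes> h" for g h by (simp_all add: GM_def)
  have NGM: "N \<lhd> GM" unfolding GM_def using normal_restrict_supergroup[OF sM N(1) NM] .
  interpret N: normal N G by (rule N(1))
  interpret Q: group "G Mod N" by (rule N.factorgroup_is_group)
  have "subgroup ((\<lambda>g. N #> g) ` M) (G Mod N)"
  proof -
    interpret h: group_hom G "G Mod N" "\<lambda>g. N #> g"
      using N.r_coset_hom_Mod Q.is_group by (simp add: group_hom_def group_hom_axioms_def is_group)
    show ?thesis by (rule h.subgroup_img_is_subgroup[OF sM])
  qed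
  moreover have "carrier (GM Mod N) = (\<lambda>g. N #> g) ` M"
    by (simp add: carrier_FactGroup GM_def r_coset_def)
  ultimately have "order (GM Mod N) dvd 2 ^ n"
    using Q.lagrange[of "(\<lambda>g. N #> g) ` M"] N(3) by (simp add: order_def) (metis dvd_triv_right)
  then obtain k where "order (GM Mod N) = 2 ^ k"
    using divides_primepow_nat[of 2 "order (GM Mod N)" n] by auto
  moreover have "N \<noteq> M" using N(4) by blast
  ultimately obtain \<eta> a where \<eta>: "\<And>g. g \<in> M \<Longrightarrow> \<eta> g \<in> {0, 1 :: int}"
    "\<And>g h. g \<in> M \<Longrightarrow> h \<in> M \<Longrightarrow> \<eta> (g \<otimes> h) = (\<eta> g + \<eta> h) mod 2"
    "\<And>g. g \<in> N \<Longrightarrow> \<eta> g = 0" "a \<in> M" "\<eta> a = 1"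
    by (rule GM.two_power_quotient_character[OF NGM, unfolded GM_simps]) (rule that, assumption+)
  have MG: "m \<in> carrier G" if "m \<in> M" for m using subgroup.mem_carrier[OF sM that] .
  have mM: "m \<otimes> m' \<in> M" if "m \<in> M" "m' \<in> M" for m m' using subgroup.m_closed[OF sM that] .
  define cj where "cj = (\<lambda>m. b \<otimes> m \<otimes> inv b)"
  have cjM: "cj m \<in> M" if "m \<in> M" for m using M(1) x(2) that by (simp add: normal_inv_iff cj_def)
  have cjN: "cj m \<in> N" if "m \<in> N" for m using N(1) x(2) that by (simp add: normal_inv_iff cj_def)
  have cancel: "inv b \<otimes> (b \<otimes> w) = w" "b \<otimes> (inv b \<otimes> w) = w" if "w \<in> carrier G" for w
    using x(2) that by (simp_all flip: m_assoc)
  have cj_mult: "cj (m \<otimes> m') = cj m \<otimes> cj m'" if "m \<in> M" "m' \<in> M" for m m'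
    using MG[OF that(1)] MG[OF that(2)] x(2) by (simp add: cj_def m_assoc cancel)
  have bb: "b \<otimes> b \<in> M" using x character_mult[OF x(1,2,2)] by (simp add: M_def)
  \<comment> \<open>Conjugation by \<open>b \<otimes> b \<in> M\<close> does not change the values of a homomorphism on \<open>M\<close>.\<close>
  have cj_cj: "\<eta> (cj (cj m)) = \<eta> m" if m: "m \<in> M" for m
  proof -
    have "cj (cj m) \<otimes> (b \<otimes> b) = (b \<otimes> b) \<otimes> m"
      using MG[OF m] x(2) by (simp add: cj_def m_assoc cancel)
    then have "(\<eta> (cj (cj m)) + \<eta> (b \<otimes> b)) mod 2 = (\<eta> (b \<otimes> b) + \<eta> m) mod 2"
      using \<eta>(2)[OF cjM[OF cjM[OF m]] bb] \<eta>(2)[OF bb m] by simp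
    then show ?thesis
      using \<eta>(1)[OF cjM[OF cjM[OF m]]] \<eta>(1)[OF m] \<eta>(1)[OF bb] by auto
  qed
  have cj_bb: "cj (b \<otimes> b) = b \<otimes> b" using x(2) by (simp add: cj_def m_assoc)
  obtain \<theta> a' where \<theta>: "\<And>g. g \<in> M \<Longrightarrow> \<theta> g \<in> {0, 1 :: int}"
    "\<And>g h. g \<in> M \<Longrightarrow> h \<in> M \<Longrightarrow> \<theta> (g \<otimes> h) = (\<theta> g + \<theta> h) mod 2"
    "\<And>g. g \<in> N \<Longrightarrow> \<theta> g = 0" "a' \<in> M" "\<theta> a' = 1" "\<And>g. g \<in> M \<Longrightarrow> \<theta> (cj g) = \<theta> g"
  proof (cases "\<forall>m\<in>M. \<eta> (cj m) = \<eta> m")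
    case True
    then show thesis using that[of \<eta> a] \<eta> by blast
  next
    case False
    then obtain m where m: "m \<in> M" "\<eta> (cj m) \<noteq> \<eta> m" by blast
    show thesis
    proof (rule that[of "\<lambda>m. (\<eta> m + \<eta> (cj m)) mod 2" m])
      show "(\<eta> m + \<eta> (cj m)) mod 2 = 1"
        using m \<eta>(1)[OF m(1)] \<eta>(1)[OF cjM[OF m(1)]] by auto
      show "(\<eta> g + \<eta> (cj g)) mod 2 \<in> {0, 1}" for g by auto
      show "(\<eta> (g \<otimes> h) + \<eta> (cj (g \<otimes> h))) mod 2 = ((\<eta> g + \<eta> (cj g)) mod 2 + (\<eta> h + \<eta> (cj h)) mod 2) mod 2"
        if "g \<in> M" "h \<in> M" for g h
        using that by (auto simp: cj_mult \<eta>(2) cjM mod_2_eq_iff)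
      show "(\<eta> g + \<eta> (cj g)) mod 2 = 0" if "g \<in> N" for g using that \<eta>(3) cjN by simp
      show "(\<eta> (cj g) + \<eta> (cj (cj g))) mod 2 = (\<eta> g + \<eta> (cj g)) mod 2" if "g \<in> M" for g
        using cj_cj[OF that] by (simp add: add.commute)
    qed (rule m)
  qed
  define \<rho> where "\<rho> = (\<lambda>g. if g \<in> M then g else g \<otimes> inv b)"
  have \<rho>M: "\<rho> g \<in> M" if g: "g \<in> carrier G" for g
  proof (cases "g \<in> M")
    case False
    then have "x g = 1" using xv[OF g] g by (auto simp: M_def)
    moreover have "x (inv b) = 1"
      using character_mult[OF x(1,2) inv_closed[OF x(2)]] x xv[of "inv b"] character_one[OF x(1)] by auto
    ultimately show ?thesis using False g x(2) character_mult[OF x(1) g, of "inv b"] by (simp add: \<rho>_def M_def)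
  qed (simp add: \<rho>_def)
  \<comment> \<open>Every \<open>g\<close> is \<open>\<rho> g\<close> or \<open>\<rho> g b\<close>, according to the value of \<open>x g\<close>.\<close>
  have decomp: "(g \<in> M \<and> \<rho> g = g \<and> x g = 0) \<or> (g \<notin> M \<and> g = \<rho> g \<otimes> b \<and> x g = 1)" if g: "g \<in> carrier G" for g
    using xv[OF g] g x(2) by (auto simp: \<rho>_def M_def m_assoc)
  define A where "A = (\<lambda>g. \<theta> (\<rho> g))"
  have A01: "A g \<in> {0, 1}" if "g \<in> carrier G" for g using \<theta>(1) \<rho>M that by (simp add: A_def)
  have A_mult: "A (g \<otimes> h) = (A g + A h + x g * x h * \<theta> (b \<otimes> b)) mod 2" if gh: "g \<in> carrier G" "h \<in> carrier G" for g h
  proof -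
    have \<rho>G: "\<rho> g \<in> carrier G" "\<rho> h \<in> carrier G" using \<rho>M gh MG by auto
    have x_mult: "x (g \<otimes> h) = (x g + x h) mod 2" using character_mult[OF x(1) gh] .
    have inM: "g \<otimes> h \<in> M \<longleftrightarrow> x (g \<otimes> h) = 0" using gh by (simp add: M_def)
    have move: "b \<otimes> \<rho> h = cj (\<rho> h) \<otimes> b" using \<rho>G x(2) by (simp add: cj_def m_assoc)
    from decomp[OF gh(1)] decomp[OF gh(2)] show ?thesis
    proof (elim disjE conjE)
      assume "g \<in> M" "\<rho> g = g" "x g = 0" "h \<in> M" "\<rho> h = h" "x h = 0"
      then show ?thesis using \<theta>(2)[of g h] inM x_mult by (simp add: A_def \<rho>_def)
    next
      assume g: "g \<in> M" "\<rho> g = g" "x g = 0" and h: "h \<notin> M" "h = \<rho> h \<otimes> b" "x h = 1"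
      have "g \<otimes> h \<otimes> inv b = g \<otimes> \<rho> h" using h(1) gh x(2) by (simp add: \<rho>_def m_assoc)
      then have "\<rho> (g \<otimes> h) = g \<otimes> \<rho> h" using inM x_mult g h by (simp add: \<rho>_def)
      then show ?thesis using \<theta>(2)[OF g(1) \<rho>M[OF gh(2)]] g by (simp add: A_def)
    next
      assume g: "g \<notin> M" "g = \<rho> g \<otimes> b" "x g = 1" and h: "h \<in> M" "\<rho> h = h" "x h = 0"
      have "g \<otimes> h = \<rho> g \<otimes> (b \<otimes> \<rho> h)" using g(2) h(2) \<rho>G x(2) by (metis m_assoc)
      also have "\<dots> = \<rho> g \<otimes> cj (\<rho> h) \<otimes> b"
        using move \<rho>G x(2) MG[OF cjM[OF \<rho>M[OF gh(2)]]] by (simp add: m_assoc)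
      finally have "g \<otimes> h \<otimes> inv b = \<rho> g \<otimes> cj (\<rho> h)"
        using \<rho>G x(2) MG[OF cjM[OF \<rho>M[OF gh(2)]]] by (simp add: m_assoc)
      then have "\<rho> (g \<otimes> h) = \<rho> g \<otimes> cj (\<rho> h)" using inM x_mult g h by (simp add: \<rho>_def)
      then show ?thesis
        using \<theta>(2)[OF \<rho>M[OF gh(1)] cjM[OF \<rho>M[OF gh(2)]]] \<theta>(6)[OF \<rho>M[OF gh(2)]] h by (simp add: A_def)
    next
      assume g: "g \<notin> M" "g = \<rho> g \<otimes> b" "x g = 1" and h: "h \<notin> M" "h = \<rho> h \<otimes> b" "x h = 1"
      have "g \<otimes> h = \<rho> g \<otimes> (b \<otimes> \<rho> h) \<otimes> b" using g(2) h(2) \<rho>G x(2) by (metis m_assoc m_closed)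
      also have "\<dots> = \<rho> g \<otimes> cj (\<rho> h) \<otimes> (b \<otimes> b)"
        using move \<rho>G x(2) MG[OF cjM[OF \<rho>M[OF gh(2)]]] by (simp add: m_assoc)
      finally have "\<rho> (g \<otimes> h) = \<rho> g \<otimes> cj (\<rho> h) \<otimes> (b \<otimes> b)" using inM x_mult g h by (simp add: \<rho>_def)
      then have "A (g \<otimes> h) = ((A g + A h) mod 2 + \<theta> (b \<otimes> b)) mod 2"
        using \<theta>(2)[OF mM[OF \<rho>M[OF gh(1)] cjM[OF \<rho>M[OF gh(2)]]] bb]
          \<theta>(2)[OF \<rho>M[OF gh(1)] cjM[OF \<rho>M[OF gh(2)]]] \<theta>(6)[OF \<rho>M[OF gh(2)]] by (simp add: A_def)
      then show ?thesis using g h by (simp add: mod_simps)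
    qed
  qed
  have A_inv: "A (m \<otimes> g) = A g" if "m \<in> N" "g \<in> carrier G" for m g
  proof -
    have "A m = 0" "x m = 0" using \<theta>(3)[OF that(1)] NM that(1) by (auto simp: A_def \<rho>_def M_def)
    then show ?thesis using A_mult[OF NG[OF that(1)] that(2)] A01[OF that(2)] by auto
  qed
  have Ac: "(\<lambda>g\<in>carrier G. A g) \<in> cochain1"
    by (rule invariant_cochain1[of N A, OF N(1,2) A01 A_inv])
  have "\<theta> (b \<otimes> b) = 1"
  proof (rule ccontr)
    assume "\<theta> (b \<otimes> b) \<noteq> 1"
    then have "\<theta> (b \<otimes> b) = 0" using \<theta>(1)[OF bb] by simp
    then have "(\<lambda>g\<in>carrier G. A g) \<in> character" using Ac A_mult by (simp add: character_iff)
    moreover have "A a' = 1" using \<theta>(4,5) by (simp add: A_def \<rho>_def)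
    ultimately have "(\<lambda>g\<in>carrier G. A g) = x" using unique[of _ a'] MG[OF \<theta>(4)] by simp
    then have "x a' = 1" using \<open>A a' = 1\<close> MG[OF \<theta>(4)] by (metis restrict_apply')
    then show False using \<theta>(4) by (simp add: M_def)
  qed
  then have "splits_cup (\<lambda>g\<in>carrier G. A g) x x" using Ac A_mult by (simp add: splits_cup_def)
  then show ?thesis by blast
qed

text \<open>
  The two cases \<open>f = f'\<close> and \<open>f \<noteq> f'\<close> give the two isomorphism types of quotients.
\<close>
lemma admissible_of_splitting:
  assumes f: "f \<in> character" "f' \<in> character" and F: "splits_cup F f f'"
    and a: "a \<in> carrier G" "f a = 1" and b: "b \<in> carrier G" "f' b = 1"
  shows "\<exists>N. admissible N \<and> N \<subseteq> {g. f g = 0 \<and> f' g = 0 \<and> F g = 0}"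
proof (cases "\<forall>c\<in>carrier G. f c = f' c")
  case True
  then have "f = f'" using f by (intro extensionalityI[of _ "carrier G"]) (auto simp: character_iff cochain1_iff)
  then show ?thesis using admissible_Z4[OF f(1) _ a] F by blast
next
  case False
  then show ?thesis using admissible_D4[OF f F a b] by blast
qed

section \<open>Conclusion\<close>

lemma admissible_separation:
  assumes grt: "galois_relation_type_2 G T"
    and pro2: "\<not> maximal_pro2_quotient G T \<cong> integer_mod_group 2"
    and \<sigma>: "\<sigma> \<in> carrier G" "\<sigma> \<notin> G3"
  shows "\<exists>N. admissible N \<and> \<sigma> \<notin> N"
proof (cases "\<sigma> \<in> G2")
  case True
  then obtain f f' F where F: "f \<in> character" "f' \<in> character" "splits_cup F f f'" "F \<sigma> = 1"
    using cup_splitting_separation[OF grt _ \<sigma>(2)] by blast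
  have nonzero: "\<exists>a\<in>carrier G. f a = 1 \<and> (\<exists>b\<in>carrier G. f' b = 1)"
  proof (rule ccontr)
    assume "\<not> ?thesis"
    then have "f g * f' h = 0" if "g \<in> carrier G" "h \<in> carrier G" for g h
      using character_value[OF F(1) that(1)] character_value[OF F(2) that(2)] that by force
    then have "F (g \<otimes> h) = (F g + F h) mod 2" if "g \<in> carrier G" "h \<in> carrier G" for g h
      using F(3) that by (metis add.right_neutral splits_cup_def)
    then have "F \<in> character" using F(3) unfolding splits_cup_def character_iff by blast
    with character_G2[OF this True] F(4) show False by simp
  qed
  then show ?thesis using admissible_of_splitting[OF F(1-3)] F(4) by fastforce
next
  case False
  obtain x where x: "x \<in> character"
    and rel: "\<And>f. f \<in> character \<Longrightarrow> \<exists>F. splits_cup F f (\<lambda>g\<in>carrier G. (f g + x g) mod 2)"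
    by (rule bockstein_condition[OF grt]) (rule that)
  have other: "\<exists>N. admissible N \<and> \<sigma> \<notin> N" if f: "f \<in> character" "f \<sigma> = 1" "f \<noteq> x" for f
  proof -
    let ?f' = "\<lambda>g\<in>carrier G. (f g + x g) mod 2"
    obtain F where F: "splits_cup F f ?f'" using rel[OF f(1)] by blast
    have f': "?f' \<in> character" using character_add[OF f(1) x] .
    have "\<exists>c\<in>carrier G. f c \<noteq> x c"
      using f x extensionalityI[of f "carrier G" x] by (auto simp: character_iff cochain1_iff)
    then obtain c where c: "c \<in> carrier G" "f c \<noteq> x c" by blast
    then have "?f' c = 1" using character_value[OF f(1) c(1)] character_value[OF x c(1)] by auto
    then show ?thesis
      using admissible_of_splitting[OF f(1) f' F \<sigma>(1) f(2) c(1)] f(2) by fastforce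
  qed
  obtain f where f: "f \<in> character" "f \<sigma> = 1" using character_separation[OF \<sigma>(1) False] .
  show ?thesis
  proof (cases "f = x")
    case False
    then show ?thesis using other f by blast
  next
    case True
    show ?thesis
    proof (cases "\<forall>h\<in>character. \<forall>g\<in>carrier G. h g = 1 \<longrightarrow> h = x")
      case unique: True
      then obtain F where "splits_cup F x x"
        using unique_character_self_splits[OF pro2 x \<sigma>(1)] f True by blast
      then show ?thesis
        using admissible_of_splitting[OF x x _ \<sigma>(1) _ \<sigma>(1)] f True by fastforce
    next
      case False
      then obtain h a where h: "h \<in> character" "a \<in> carrier G" "h a = 1" "h \<noteq> x" by blast
      show ?thesis
      proof (cases "h \<sigma> = 1")
        case True
        then show ?thesis using other h by blast
      next
        case False
        let ?k = "\<lambda>g\<in>carrier G. (h g + x g) mod 2"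
        have "?k \<sigma> = 1" using False character_value[OF h(1) \<sigma>(1)] f \<open>f = x\<close> \<sigma>(1) by auto
        moreover have "?k a \<noteq> x a" using h(2,3) character_value[OF x h(2)] by auto
        then have "?k \<noteq> x" by metis
        ultimately show ?thesis using other[OF character_add[OF h(1) x]] by blast
      qed
    qed
  qed
qed

lemma admissible_carrier: "admissible (carrier G)"
proof -
  have "carrier G \<lhd> G" by (simp add: normal_inv_iff subgroup_self)
  moreover have "trivial_group (G Mod carrier G)"
    using calculation normal.factorgroup_is_group coset_join2[OF _ subgroup_self]
    by (auto simp: trivial_group_def carrier_FactGroup)
  ultimately show ?thesis using openin_topspace[of T] by (simp add: admissible_def)
qed

theorem G3_eq_Inter_admissible:
  assumes "galois_relation_type_2 G T" "\<not> maximal_pro2_quotient G T \<cong> integer_mod_group 2"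
  shows "G3 = \<Inter>{N. admissible N}"
proof
  show "G3 \<subseteq> \<Inter>{N. admissible N}"
    using G3_subset_admissible by (auto simp: admissible_def)
  show "\<Inter>{N. admissible N} \<subseteq> G3"
    using admissible_carrier admissible_separation[OF assms] by blast
qed

end

theorem corollary11p4:
  fixes G :: "('a, 'm) monoid_scheme" and T :: "'a topology"
  assumes "profinite_group G T"
    and "galois_relation_type_2 G T"
    and "\<not> maximal_pro2_quotient G T \<cong> integer_mod_group 2"
  shows "two_central_series G T 3 =
    \<Inter>{N. N \<lhd> G \<and> openin T N \<and>
       (trivial_group (G Mod N) \<or> G Mod N \<cong> integer_mod_group 4 \<or> G Mod N \<cong> dihedral4)}"
proof -
  interpret profinite G T
    using assms(1) by (simp add: profinite_def profinite_axioms_def profinite_group_def topological_group_def)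
  show ?thesis
    using G3_eq_Inter_admissible[OF assms(2,3)] by (simp add: admissible_def)
qed

end
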